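(* Let $d\ge 2$, $\tau\in\mathbb N$, $\Lambda\ge\lambda>0$, $\mu>0$. Suppose $J$ satisfies (J1), (J2), (J3), (J4), (J5) and $h$ satisfies (h1), (h2), (h3). Then there exist a constant $\mu_0>0$, depending only on $d$, $\tau$ and $\lambda$, and a constant $M>0$, which may depend also on $\Lambda$ and on the function $\sigma$, such that, provided $\mu\le\mu_0$, for every direction $\omega\in\mathbb R^d\setminus\{0\}$ there exists a ground state $u_\omega$ for $H$ with $$\partial u_\omega\subset\Big\{i\in\mathbb Z^d:\ \tfrac{\omega}{|\omega|}\cdot i\in[0,M]\Big\}.$$ More precisely, $u_{\omega,i}=-1$ for all $i\in\mathbb Z^d$ with $\frac{\omega}{|\omega|}\cdot i\ge M$, and $u_{\omega,i}=1$ for all $i\in\mathbb Z^d$ with $\frac{\omega}{|\omega|}\cdot i\le 0$. Furthermore, if in addition $J$ satisfies (JP) for some $s\in(0,1)$ and $h\equiv 0$, then $M$ can be chosen of the form $M=M_0\tau$, with $M_0>0$ depending only on $d$, $s$, $\lambda$ and $\Lambda$.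
   Context: Fix $d\ge2$. For $x\in\mathbb R^d$, $|x|:=\sum_{n=1}^d|x_n|$ denotes the $\ell^1$ norm (this convention is used throughout, also for vectors in $\mathbb R^d$, e.g. in $\omega/|\omega|$) and $|x|_\infty:=\max_n|x_n|$. A configuration is a map $u:\mathbb Z^d\to\{-1,1\}$, $i\mapsto u_i$. Its interface is $\partial u:=\{i\in\mathbb Z^d: u_i=1 \text{ and there is } j\in\mathbb Z^d \text{ with } |i-j|=1,\ u_j=-1\}$. Given $J:\mathbb Z^d\times\mathbb Z^d\to[0,\infty)$ and $h:\mathbb Z^d\to\mathbb R$, for a finite set $\Gamma\subset\mathbb Z^d$ and a configuration $u$ set $H_\Gamma(u):=\sum_{(i,j)\in\mathbb Z^{2d}\setminus(\mathbb Z^d\setminus\Gamma)^2}J_{ij}(1-u_iu_j)+\sum_{i\in\Gamma}h_iu_i$. A configuration $u$ is a minimizer for $H$ in $\Gamma$ if $H_\Gamma(u)\le H_\Gamma(v)$ for every configuration $v$ with $v_i=u_i$ for all $i\notin\Gamma$; $u$ is a ground state for $H$ if it is a minimizer for $H$ in every finite $\Gamma\subset\mathbb Z^d$. Conditions on $J$ (with constants $\Lambda\ge\lambda>0$, $\tau\in\mathbb N$): (J1) $J_{ij}=J_{ji}$ for all $i,j$; (J2) $J_{ii}=0$ for all $i$; (J3) $J_{ij}\ge\lambda$ whenever $|i-j|=1$; (J4) $\sum_{j\in\mathbb Z^d}J_{ij}\le\Lambda$ for all $i$; (J5) $J_{ij}=J_{i'j'}$ whenever $i-i'=j-j'\in\tau\mathbb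 Z^d$; (JP) for some $s\in(0,1)$, $\lambda|i-j|^{-d-s}\le J_{ij}\le\Lambda|i-j|^{-d-s}$ for all $i\neq j$. Conditions on $h$: (h1) $\sup_i|h_i|\le\mu$; (h2) $\sum_{i\in F}h_i=0$ for every fundamental domain $F$ of the quotient $\mathbb Z^d/\tau\mathbb Z^d$ (i.e. every set of representatives); (h3) $h_i=h_{i'}$ whenever $i-i'\in\tau\mathbb Z^d$. For $R\in\mathbb N$, $\sigma(R):=\sup_{i\in\mathbb Z^d}\sum_{j\in\mathbb Z^d,\ |j-i|_\infty\ge R}J_{ij}$. *)

theory Defs
  imports "HOL-Analysis.Analysis"
begin

definition l1 :: "int ^ 'd \<Rightarrow> int" where
  "l1 x = (\<Sum>k\<in>UNIV. \<bar>x $ k\<bar>)"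

definition linf :: "int ^ 'd \<Rightarrow> int" where
  "linf x = Max (range (\<lambda>k. \<bar>x $ k\<bar>))"

definition rl1 :: "real ^ 'd \<Rightarrow> real" where
  "rl1 w = (\<Sum>k\<in>UNIV. \<bar>w $ k\<bar>)"

definition dotp :: "real ^ 'd \<Rightarrow> int ^ 'd \<Rightarrow> real" where
  "dotp w i = (\<Sum>k\<in>UNIV. w $ k * of_int (i $ k))"

definition config :: "(int ^ 'd \<Rightarrow> int) \<Rightarrow> bool" where
  "config u \<longleftrightarrow> (\<forall>i. u i = 1 \<or> u i = -1)"

definition interface :: "(int ^ 'd \<Rightarrow> int) \<Rightarrow> (int ^ 'd) set" where
  "interface u = {i. u i = 1 \<and> (\<exists>j. l1 (i - j) = 1 \<and> u j = -1)}"

definition Ham :: "(int ^ 'd \<Rightarrow> int ^ 'd \<Rightarrow> real) \<Rightarrow> (int ^ 'd \<Rightarrow> real)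
    \<Rightarrow> (int ^ 'd) set \<Rightarrow> (int ^ 'd \<Rightarrow> int) \<Rightarrow> real" where
  "Ham J h \<Gamma> u =
     infsum (\<lambda>(i, j). J i j * (1 - of_int (u i * u j))) {p. fst p \<in> \<Gamma> \<or> snd p \<in> \<Gamma>}
     + (\<Sum>i\<in>\<Gamma>. h i * of_int (u i))"

definition minimizer_in where
  "minimizer_in J h \<Gamma> u \<longleftrightarrow>
     (\<forall>v. config v \<longrightarrow> (\<forall>i. i \<notin> \<Gamma> \<longrightarrow> v i = u i) \<longrightarrow> Ham J h \<Gamma> u \<le> Ham J h \<Gamma> v)"

definition ground_state where
  "ground_state J h u \<longleftrightarrow> config u \<and> (\<forall>\<Gamma>. finite \<Gamma> \<longrightarrow> minimizer_in J h \<Gamma> u)"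

definition lat_cong :: "nat \<Rightarrow> int ^ 'd \<Rightarrow> int ^ 'd \<Rightarrow> bool" where
  "lat_cong \<tau> i j \<longleftrightarrow> (\<forall>k. int \<tau> dvd (i $ k - j $ k))"

definition fund_domain :: "nat \<Rightarrow> (int ^ 'd) set \<Rightarrow> bool" where
  "fund_domain \<tau> F \<longleftrightarrow> (\<forall>i. \<exists>!f. f \<in> F \<and> lat_cong \<tau> i f)"

definition J_conds :: "real \<Rightarrow> real \<Rightarrow> nat \<Rightarrow> (int ^ 'd \<Rightarrow> int ^ 'd \<Rightarrow> real) \<Rightarrow> bool" where
  "J_conds lam \<Lambda> \<tau> J \<longleftrightarrow>
     (\<forall>i j. J i j \<ge> 0) \<and>
     (\<forall>i j. J i j = J j i) \<and>
     (\<forall>i. J i i = 0) \<and>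
     (\<forall>i j. l1 (i - j) = 1 \<longrightarrow> J i j \<ge> lam) \<and>
     (\<forall>i. (\<lambda>j. J i j) summable_on UNIV \<and> infsum (\<lambda>j. J i j) UNIV \<le> \<Lambda>) \<and>
     (\<forall>i j i' j'. i - i' = j - j' \<and> lat_cong \<tau> i i' \<longrightarrow> J i j = J i' j')"

definition JP :: "real \<Rightarrow> real \<Rightarrow> real \<Rightarrow> (int ^ 'd \<Rightarrow> int ^ 'd \<Rightarrow> real) \<Rightarrow> bool" where
  "JP s lam \<Lambda> J \<longleftrightarrow> (\<forall>i j. i \<noteq> j \<longrightarrow>
      lam * real_of_int (l1 (i - j)) powr (- real CARD('d) - s) \<le> J i j \<and>
      J i j \<le> \<Lambda> * real_of_int (l1 (i - j)) powr (- real CARD('d) - s))"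

definition h_conds :: "real \<Rightarrow> nat \<Rightarrow> (int ^ 'd \<Rightarrow> real) \<Rightarrow> bool" where
  "h_conds \<mu> \<tau> h \<longleftrightarrow>
     (\<forall>i. \<bar>h i\<bar> \<le> \<mu>) \<and>
     (\<forall>F. fund_domain \<tau> F \<longrightarrow> sum h F = 0) \<and>
     (\<forall>i i'. lat_cong \<tau> i i' \<longrightarrow> h i = h i')"

definition sigma :: "(int ^ 'd \<Rightarrow> int ^ 'd \<Rightarrow> real) \<Rightarrow> nat \<Rightarrow> real" where
  "sigma J R = (SUP i. infsum (\<lambda>j. J i j) {j. linf (j - i) \<ge> int R})"

definition planelike :: "real \<Rightarrow> real ^ 'd \<Rightarrow> (int ^ 'd \<Rightarrow> int) \<Rightarrow> bool" where
  "planelike M w u \<longleftrightarrow>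
     interface u \<subseteq> {i. 0 \<le> dotp (w /\<^sub>R rl1 w) i \<and> dotp (w /\<^sub>R rl1 w) i \<le> M} \<and>
     (\<forall>i. dotp (w /\<^sub>R rl1 w) i \<ge> M \<longrightarrow> u i = -1) \<and>
     (\<forall>i. dotp (w /\<^sub>R rl1 w) i \<le> 0 \<longrightarrow> u i = 1)"

end

theory Submission
  imports Defs "HOL-Library.Diagonal_Subsequence" "HOL-Real_Asymp.Real_Asymp"
begin

text \<open>A configuration is identified with the set of its plus sites. For an integer direction \<open>q\<close> one
  minimizes the energy among sets that are periodic under a large sublattice of the hyperplane orthogonal
  to \<open>q\<close> and lie between two half spaces; among the minimizers one takes one with the fewest plus sites.
  Minimality makes it monotone under all translations of the period lattice that point in the direction
  \<open>q\<close> (Birkhoff property), so a single cell of side \<open>\<tau>\<close> on which it is constant confines the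
  interface: a minus cell bounds the plus set from above, while a plus cell would permit a
  downward translation with the same energy and fewer plus sites.
  Constant cells exist in large cubes by comparing surface and bulk energy: if every cell were mixed, the
  energy in a cube would grow like its volume, whereas flipping the whole cube costs less. For
  power law interactions the energy carried by a mixed cell comes from a density estimate, which gives the linear
  dependence on \<open>\<tau>\<close>. General directions follow by compactness, as the strip width does not depend on
  \<open>q\<close> or on the period.\<close>

section \<open>Periodic sets and their relative energy\<close>

text \<open>A plane-like set has infinite energy, so no total energy is minimized:
  \<open>delta\<close> records only the cost of flipping a set, once per period. Two facts about it
  carry the argument. It is additive when sites are flipped in two rounds (\<open>delta_Un\<close>),
  and it falls when the plus background grows (\<open>delta_antimono\<close>). The latter is
  submodularity, and it is why testing additions and removals separately amounts to full minimality.
  The obstacle is that barriers and period are artificial, while a ground state must resist every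
  finite perturbation. The upper barrier is harmless because the strip bound does not depend on its
  position. The lower one is felt by the minimizer and is moved away by a lattice translation whose
  layer costs nothing; here the zero mean of \<open>h\<close> enters. The period is harmless because
  periodic copies of a perturbation only help one another, so resisting them jointly is the stronger
  property. What remains is a radius \<open>D\<close> such that every cube of that radius contains a
  constant cell; the strip width is \<open>2 * D + 6 * \<tau>\<close>.\<close>

definition subgrp :: "'a::ab_group_add set \<Rightarrow> bool" where
  "subgrp L \<longleftrightarrow> 0 \<in> L \<and> (\<forall>x\<in>L. \<forall>y\<in>L. x - y \<in> L)"

lemma subgrp_closed:
  assumes "subgrp L"
  shows "0 \<in> L" and "x \<in> L \<Longrightarrow> y \<in> L \<Longrightarrow> x - y \<in> L"
    and "x \<in> L \<Longrightarrow> - x \<in> L" and "x \<in> L \<Longrightarrow> y \<in> L \<Longrightarrow> x + y \<in> L"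
proof -
  have z: "0 \<in> L" using assms by (auto simp: subgrp_def)
  show d: "x - y \<in> L" if "x \<in> L" "y \<in> L" for x y
    using assms that by (auto simp: subgrp_def)
  show m: "- x \<in> L" if "x \<in> L" for x
    using d[of 0 x] z that by simp
  show "x + y \<in> L" if "x \<in> L" "y \<in> L" for x y
    using d[of x "- y"] m[of y] that by simp
  show "0 \<in> L" by (rule z)
qed

definition invar :: "'a::ab_group_add set \<Rightarrow> 'a set \<Rightarrow> bool" where
  "invar L A \<longleftrightarrow> (\<forall>k\<in>L. \<forall>i. i + k \<in> A \<longleftrightarrow> i \<in> A)"

lemma invarD: "invar L A \<Longrightarrow> k \<in> L \<Longrightarrow> i + k \<in> A \<longleftrightarrow> i \<in> A"
  by (auto simp: invar_def)

lemma invarD_diff: "invar L A \<Longrightarrow> k \<in> L \<Longrightarrow> i - k \<in> A \<longleftrightarrow> i \<in> A"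
  using invarD[of L A k "i - k"] by simp

lemma invar_ops:
  assumes "invar L A" "invar L B"
  shows "invar L (A \<union> B)" "invar L (A \<inter> B)" "invar L (A - B)" "invar L (- A)"
  using assms by (auto simp: invar_def)

definition transv :: "'a::ab_group_add set \<Rightarrow> 'a set \<Rightarrow> 'a set \<Rightarrow> bool" where
  "transv L A R \<longleftrightarrow> R \<subseteq> A \<and> (\<forall>i\<in>A. \<exists>!k. k \<in> L \<and> i - k \<in> R)"

definition translate :: "'a::ab_group_add \<Rightarrow> 'a set \<Rightarrow> 'a set" where
  "translate k A = {i. i - k \<in> A}"

lemma mem_translate [simp]: "i \<in> translate k A \<longleftrightarrow> i - k \<in> A"
  by (simp add: translate_def)

lemma translate_ops:
  "translate k (A \<union> B) = translate k A \<union> translate k B"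
  "translate k (A \<inter> B) = translate k A \<inter> translate k B"
  "translate k (A - B) = translate k A - translate k B"
  "translate k (- A) = - translate k A"
  "translate k (translate l A) = translate (k + l) A"
  by (auto simp: algebra_simps)

lemma translate_eq_image: "translate k A = (\<lambda>i. i + k) ` A"
  by (auto simp: image_iff algebra_simps intro!: bexI[where x = "_ - k"])

lemma invar_translate: "invar L A \<Longrightarrow> invar L (translate k A)"
proof (unfold invar_def, intro ballI allI)
  fix l i assume A: "\<forall>k\<in>L. \<forall>i. (i + k \<in> A) = (i \<in> A)" and l: "l \<in> L"
  have "i + l - k = (i - k) + l" by (simp add: algebra_simps)
  then show "(i + l \<in> translate k A) = (i \<in> translate k A)"
    using A l by (metis mem_translate)
qed

lemma transv_restrict:
  assumes "transv L UNIV R" "invar L A"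
  shows "transv L A (A \<inter> R)"
  using assms invarD_diff[OF assms(2)] unfolding transv_def by (auto; blast)

lemma transv_translate:
  assumes "transv L A R"
  shows "transv L (translate k A) (translate k R)"
  unfolding transv_def
proof (intro conjI ballI)
  show "translate k R \<subseteq> translate k A" using assms by (auto simp: transv_def)
next
  fix i assume "i \<in> translate k A"
  then have "\<exists>!l. l \<in> L \<and> (i - k) - l \<in> R" using assms by (auto simp: transv_def)
  moreover have "i - k - l = i - l - k" for l by (simp add: algebra_simps)
  ultimately show "\<exists>!l. l \<in> L \<and> i - l \<in> translate k R" by simp
qed

lemma transv_exists:
  assumes "subgrp L"
  shows "\<exists>R. transv L UNIV R"
proof -
  \<comment> \<open>The choice depends only on the class of \<open>i\<close> modulo
    \<open>L\<close>, so the range of \<open>\<rho>\<close> meets each class exactly once.\<close>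
  define \<rho> where "\<rho> i = (SOME j. i - j \<in> L)" for i
  have "\<exists>j. i - j \<in> L" for i using subgrp_closed(1)[OF assms] by (intro exI[of _ i]) simp
  then have \<rho>: "i - \<rho> i \<in> L" for i unfolding \<rho>_def by (rule someI_ex)
  have eq: "\<rho> i = \<rho> j" if "i - j \<in> L" for i j
  proof -
    have "(i - x \<in> L) = (j - x \<in> L)" for x
      using subgrp_closed(2,4)[OF assms, of "i - j"] that
        subgrp_closed(2)[OF assms, of "i - x" "i - j"] subgrp_closed(4)[OF assms, of "j - x" "i - j"]
      by (auto simp: algebra_simps)
    then show ?thesis by (simp add: \<rho>_def)
  qed
  have "transv L UNIV (range \<rho>)"
    unfolding transv_def
  proof (intro conjI ballI)
    fix i
    show "\<exists>!k. k \<in> L \<and> i - k \<in> range \<rho>"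
    proof (rule ex1I[of _ "i - \<rho> i"])
      show "i - \<rho> i \<in> L \<and> i - (i - \<rho> i) \<in> range \<rho>" using \<rho> by simp
      fix k assume k: "k \<in> L \<and> i - k \<in> range \<rho>"
      then obtain j where j: "i - k = \<rho> j" by auto
      have "\<rho> j = \<rho> (\<rho> j)" by (rule eq) (rule \<rho>)
      also have "\<dots> = \<rho> (i - k)" by (simp add: j)
      also have "\<dots> = \<rho> i"
        using eq[of i "i - k"] k by simp
      finally show "k = i - \<rho> i" using j by (simp add: algebra_simps)
    qed
  qed auto
  then show ?thesis by blast
qed

text \<open>Representatives of the same class differ by an element of \<open>L\<close>, which yields
  a bijection preserving \<open>f\<close>. This makes energies per period independent of the
  transversal.\<close>

lemma transv_sum:
  fixes f :: "'a::ab_group_add \<Rightarrow> real"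
  assumes "subgrp L" "transv L A R" "transv L A S"
    and f: "\<And>i k. k \<in> L \<Longrightarrow> f (i + k) = f i"
  shows "sum f R = sum f S"
proof -
  define \<kappa> where "\<kappa> T i = (THE k. k \<in> L \<and> i - k \<in> T)" for T i
  have \<kappa>: "\<kappa> T i \<in> L" "i - \<kappa> T i \<in> T" if "transv L A T" "i \<in> A" for T i
    using theI'[of "\<lambda>k. k \<in> L \<and> i - k \<in> T"] that by (auto simp: transv_def \<kappa>_def)
  have \<kappa>_eq: "\<kappa> T i = k" if "transv L A T" "i \<in> A" "k \<in> L" "i - k \<in> T" for T i k
    using the1_equality[of "\<lambda>k. k \<in> L \<and> i - k \<in> T"] that by (auto simp: transv_def \<kappa>_def)
  have sub: "R \<subseteq> A" "S \<subseteq> A" using assms by (auto simp: transv_def)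
  have inv: "(i - \<kappa> T i) - \<kappa> U (i - \<kappa> T i) = i"
    if "transv L A T" "transv L A U" "i \<in> U" for T U i
  proof -
    have "i \<in> A" using that by (auto simp: transv_def)
    then have *: "\<kappa> T i \<in> L" "i - \<kappa> T i \<in> T" using \<kappa> that by auto
    then have "i - \<kappa> T i \<in> A" using that by (auto simp: transv_def)
    then have "\<kappa> U (i - \<kappa> T i) = - \<kappa> T i"
      using * that by (intro \<kappa>_eq) (auto intro: subgrp_closed[OF assms(1)])
    then show ?thesis by simp
  qed
  show ?thesis
  proof (rule sum.reindex_bij_witness[where j = "\<lambda>i. i - \<kappa> S i" and i = "\<lambda>i. i - \<kappa> R i"])
    fix i assume "i \<in> R"
    then have k: "\<kappa> S i \<in> L" "i - \<kappa> S i \<in> S" using \<kappa>[OF assms(3)] sub by auto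
    show "i - \<kappa> S i \<in> S" by fact
    show "i - \<kappa> S i - \<kappa> R (i - \<kappa> S i) = i" using inv assms \<open>i \<in> R\<close> by auto
    show "f (i - \<kappa> S i) = f i" using f[OF k(1), of "i - \<kappa> S i"] by simp
  next
    fix i assume "i \<in> S"
    then show "i - \<kappa> R i \<in> R" using \<kappa>[OF assms(2)] sub by auto
    show "i - \<kappa> R i - \<kappa> S (i - \<kappa> R i) = i" using inv assms \<open>i \<in> S\<close> by auto
  qed
qed

section \<open>Relative energy of flips for a translation-invariant pair interaction\<close>

locale interaction =
  fixes J :: "'a::ab_group_add \<Rightarrow> 'a \<Rightarrow> real" and h :: "'a \<Rightarrow> real" and G :: "'a set"
  assumes J_nonneg: "0 \<le> J i j"
    and J_sym: "J i j = J j i"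
    and J_summable: "J i summable_on UNIV"
    and J_shift: "k \<in> G \<Longrightarrow> J (i + k) (j + k) = J i j"
    and h_shift: "k \<in> G \<Longrightarrow> h (i + k) = h i"
    and G_subgrp: "subgrp G"
begin

definition I :: "'a \<Rightarrow> 'a set \<Rightarrow> real" where
  "I i B = infsum (J i) B"

lemma summ: "J i summable_on B"
  using J_summable by (rule summable_on_subset_banach) auto

lemma I_nonneg: "0 \<le> I i B"
  unfolding I_def by (rule infsum_nonneg) (rule J_nonneg)

lemma I_mono: "B \<subseteq> C \<Longrightarrow> I i B \<le> I i C"
  unfolding I_def by (rule infsum_mono2) (auto intro: summ J_nonneg)

lemma I_Un: "B \<inter> C = {} \<Longrightarrow> I i (B \<union> C) = I i B + I i C"
  unfolding I_def by (rule infsum_Un_disjoint) (auto intro: summ)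

lemma I_translate:
  assumes "k \<in> G" shows "I (i + k) (translate k B) = I i B"
proof -
  have "infsum (J (i + k)) ((\<lambda>j. j + k) ` B) = infsum (J (i + k) \<circ> (\<lambda>j. j + k)) B"
    by (rule infsum_reindex) (auto simp: inj_on_def)
  also have "J (i + k) \<circ> (\<lambda>j. j + k) = J i" using J_shift[OF assms] by auto
  finally show ?thesis by (simp add: I_def translate_eq_image)
qed

lemma I_invar: "k \<in> G \<Longrightarrow> k \<in> L \<Longrightarrow> invar L B \<Longrightarrow> I (i + k) B = I i B"
  using I_translate[of k i B] invarD_diff[of L B k] by (metis (no_types, lifting) mem_translate subsetI subset_antisym)

text \<open>The energy flux through an invariant set of pairs is symmetric: moving \<open>j\<close> instead of
  \<open>i\<close> into the transversal is an involution on the pairs.\<close>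

lemma flux_swap:
  assumes L: "subgrp L" "L \<subseteq> G" and R: "transv L UNIV R"
    and W: "\<And>k i j. k \<in> L \<Longrightarrow> W i j \<Longrightarrow> W (i + k) (j + k)"
    and S: "S \<subseteq> R" "finite S" "\<And>i j. i \<in> R \<Longrightarrow> W i j \<Longrightarrow> i \<in> S"
    and T: "T \<subseteq> R" "finite T" "\<And>i j. j \<in> R \<Longrightarrow> W i j \<Longrightarrow> j \<in> T"
  shows "(\<Sum>i\<in>S. I i {j. W i j}) = (\<Sum>j\<in>T. I j {i. W i j})"
proof -
  define \<rho> where "\<rho> i = (THE k. k \<in> L \<and> i - k \<in> R)" for i
  have \<rho>: "\<rho> i \<in> L" "i - \<rho> i \<in> R" for i
    using theI'[of "\<lambda>k. k \<in> L \<and> i - k \<in> R"] R by (auto simp: transv_def \<rho>_def)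
  have \<rho>_eq: "\<rho> i = k" if "k \<in> L" "i - k \<in> R" for i k
    using the1_equality[of "\<lambda>k. k \<in> L \<and> i - k \<in> R"] R that by (auto simp: transv_def \<rho>_def)
  have fiber: "(\<Sum>i\<in>U. I i (V i)) = infsum (\<lambda>(i, j). J i j) (Sigma U V)" if "finite U" for U V
  proof -
    have inf: "infsum (\<lambda>(i, j). J i j) (Pair i ` V i) = I i (V i)" for i
      unfolding I_def by (subst infsum_reindex) (auto simp: inj_on_def o_def)
    have "(\<lambda>(i, j). J i j) summable_on (Pair i ` V i)" for i
      by (subst summable_on_reindex) (auto simp: inj_on_def o_def summ)
    then have "(\<Sum>i\<in>U. infsum (\<lambda>(i, j). J i j) (Pair i ` V i)) =
        infsum (\<lambda>(i, j). J i j) (\<Union>i\<in>U. Pair i ` V i)"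
      using that by (intro sum_infsum) auto
    also have "(\<Union>i\<in>U. Pair i ` V i) = Sigma U V" by auto
    finally show ?thesis by (simp add: inf)
  qed
  define \<phi> where "\<phi> = (\<lambda>(i, j). (j - \<rho> j, i - \<rho> j))"
  have *: "\<phi> (\<phi> p) = p" if "fst p \<in> R" for p
  proof -
    obtain i j where p: "p = (i, j)" by force
    have "\<rho> (i - \<rho> j) = - \<rho> j"
      using that p \<rho> by (intro \<rho>_eq) (auto intro: subgrp_closed[OF L(1)])
    then show ?thesis by (simp add: p \<phi>_def)
  qed
  have "infsum (\<lambda>(i, j). J i j) (SIGMA i:S. {j. W i j}) = infsum (\<lambda>(i, j). J i j) (SIGMA j:T. {i. W i j})"
  proof (rule infsum_reindex_bij_witness[where i = \<phi> and j = \<phi>])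
    fix p assume p: "p \<in> (SIGMA i:S. {j. W i j})"
    then show "\<phi> (\<phi> p) = p" using * S by auto
    obtain i j where ij: "p = (i, j)" "i \<in> R" "W i j" using p S by auto
    have "W (i + - \<rho> j) (j + - \<rho> j)" using W ij subgrp_closed(3)[OF L(1) \<rho>(1)] by blast
    then show "\<phi> p \<in> (SIGMA j:T. {i. W i j})" using T(3)[OF \<rho>(2)] by (simp add: ij \<phi>_def)
    have "- \<rho> j \<in> G" using subgrp_closed(3)[OF L(1) \<rho>(1)] L by auto
    then show "(case \<phi> p of (i, j) \<Rightarrow> J i j) = (case p of (i, j) \<Rightarrow> J i j)"
      using J_shift[of "- \<rho> j" j i] J_sym by (simp add: ij \<phi>_def)
  next
    fix p assume p: "p \<in> (SIGMA j:T. {i. W i j})"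
    then show "\<phi> (\<phi> p) = p" using * T by auto
    obtain i j where ij: "p = (j, i)" "j \<in> R" "W i j" using p T by auto
    have "W (i + - \<rho> i) (j + - \<rho> i)" using W ij subgrp_closed(3)[OF L(1) \<rho>(1)] by blast
    then show "\<phi> p \<in> (SIGMA i:S. {j. W i j})" using S(3)[OF \<rho>(2)] by (simp add: ij \<phi>_def)
  qed
  then show ?thesis using fiber[OF S(2)] fiber[OF T(2)] by simp
qed

text \<open>One quarter of the energy change, per period, when the sites of \<open>A\<close> are flipped from
  \<open>- 1\<close> to \<open>1\<close> while \<open>B\<close> carries the value \<open>1\<close>. The
  purely local version is the one for the trivial group, with transversal \<open>UNIV\<close>.\<close>

definition delta :: "'a set \<Rightarrow> 'a set \<Rightarrow> 'a set \<Rightarrow> real" where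
  "delta R A B = (\<Sum>i\<in>A \<inter> R. I i (- (A \<union> B)) - I i B + h i / 2)"

text \<open>Submodularity, site by site: since \<open>J\<close> is nonnegative, a larger plus
  background increases the flux gained and decreases the flux to the remaining minus sites.\<close>

lemma delta_antimono: "B \<subseteq> C \<Longrightarrow> delta R A C \<le> delta R A B"
  unfolding delta_def
  by (rule sum_mono) (smt (verit) I_mono Compl_anti_mono Un_mono subset_refl)

text \<open>\<open>C\<close> is flipped when \<open>A\<close> already belongs to the background. The
  mixed terms cancel because the flux from one period of \<open>A\<close> into \<open>C\<close>
  equals that from one period of \<open>C\<close> into \<open>A\<close>, by
  \<open>flux_swap\<close>.\<close>

lemma delta_Un:
  assumes L: "subgrp L" "L \<subseteq> G" and R: "transv L UNIV R"
    and inv: "invar L A" "invar L C" and fin: "finite (A \<inter> R)" "finite (C \<inter> R)"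
    and dis: "A \<inter> C = {}" "A \<inter> B = {}" "C \<inter> B = {}"
  shows "delta R (A \<union> C) B = delta R A B + delta R C (B \<union> A)"
proof -
  have "(\<Sum>i\<in>A \<inter> R. I i {j. i \<in> A \<and> j \<in> C}) = (\<Sum>j\<in>C \<inter> R. I j {i. i \<in> A \<and> j \<in> C})"
    by (rule flux_swap[OF L R]) (use inv fin in \<open>auto simp: invarD\<close>)
  moreover have "(\<Sum>i\<in>A \<inter> R. I i {j. i \<in> A \<and> j \<in> C}) = (\<Sum>i\<in>A \<inter> R. I i C)"
    by (rule sum.cong) auto
  moreover have "(\<Sum>j\<in>C \<inter> R. I j {i. i \<in> A \<and> j \<in> C}) = (\<Sum>i\<in>C \<inter> R. I i A)"
    by (rule sum.cong) auto
  ultimately have swap: "(\<Sum>i\<in>A \<inter> R. I i C) = (\<Sum>i\<in>C \<inter> R. I i A)"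
    by simp
  have c1: "I i (- (A \<union> B)) = I i (- (A \<union> C \<union> B)) + I i C" for i
    by (subst I_Un[symmetric]) (use dis in \<open>auto intro!: arg_cong[where f = "I i"]\<close>)
  have c2: "I i (B \<union> A) = I i B + I i A" for i
    by (rule I_Un) (use dis in auto)
  have e: "- (C \<union> (B \<union> A)) = - (A \<union> C \<union> B)" by auto
  have "delta R (A \<union> C) B = (\<Sum>i\<in>(A \<inter> R) \<union> (C \<inter> R). I i (- (A \<union> C \<union> B)) - I i B + h i / 2)"
    by (simp add: delta_def Int_Un_distrib2)
  also have "\<dots> = (\<Sum>i\<in>A \<inter> R. I i (- (A \<union> C \<union> B)) - I i B + h i / 2) +
      (\<Sum>i\<in>C \<inter> R. I i (- (A \<union> C \<union> B)) - I i B + h i / 2)"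
    by (rule sum.union_disjoint) (use fin dis in auto)
  also have "\<dots> = delta R A B + delta R C (B \<union> A)"
    unfolding delta_def e c1 c2 using swap by (simp add: sum.distrib sum_subtractf)
  finally show ?thesis .
qed

text \<open>Translation also moves the transversal; \<open>transv_sum\<close> moves it back to
  \<open>R\<close>.\<close>

lemma delta_translate:
  assumes L: "subgrp L" "L \<subseteq> G" and R: "transv L UNIV R"
    and inv: "invar L A" "invar L B" and k: "k \<in> G"
  shows "delta R (translate k A) (translate k B) = delta R A B"
proof -
  let ?f = "\<lambda>A B i. I i (- (A \<union> B)) - I i B + h i / 2"
  have per: "?f A' B' (i + l) = ?f A' B' i" if "l \<in> L" "invar L A'" "invar L B'" for l i A' B'
  proof -
    have "l \<in> G" using that L by auto
    then show ?thesis
      using I_invar[OF _ that(1), of "- (A' \<union> B')" i] I_invar[OF _ that(1), of B' i] h_shift[of l i]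
        that invar_ops(1,4) by metis
  qed
  have "delta R A B = (\<Sum>i\<in>A \<inter> R. ?f (translate k A) (translate k B) (i + k))"
    unfolding delta_def translate_ops[symmetric]
    using I_translate[OF k] h_shift[OF k] by simp
  also have "\<dots> = (\<Sum>i\<in>(\<lambda>i. i + k) ` (A \<inter> R). ?f (translate k A) (translate k B) i)"
    by (subst sum.reindex) (auto simp: inj_on_def)
  also have "\<dots> = (\<Sum>i\<in>translate k A \<inter> translate k R. ?f (translate k A) (translate k B) i)"
    by (simp only: translate_eq_image[symmetric] translate_ops)
  also have "\<dots> = (\<Sum>i\<in>translate k A \<inter> R. ?f (translate k A) (translate k B) i)"
  proof (rule transv_sum[OF L(1)])
    show "transv L (translate k A) (translate k A \<inter> translate k R)"
      using transv_translate[OF transv_restrict[OF R inv(1)], of k] by (simp only: translate_ops)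
    show "transv L (translate k A) (translate k A \<inter> R)"
      by (intro transv_restrict R invar_translate inv)
  qed (intro per invar_translate inv, assumption)
  finally show ?thesis by (simp add: delta_def)
qed

end

section \<open>Lattice geometry\<close>

lemma vec_box_eq: "{v::'a^'d. \<forall>n. v $ n \<in> S n} = vec_lambda ` (Pi\<^sub>E UNIV S)"
proof (intro equalityI subsetI)
  fix v :: "'a^'d" assume "v \<in> {v. \<forall>n. v $ n \<in> S n}"
  then have "v = vec_lambda (vec_nth v)" "vec_nth v \<in> Pi\<^sub>E UNIV S" by auto
  then show "v \<in> vec_lambda ` (Pi\<^sub>E UNIV S)" by (rule image_eqI)
qed auto

lemma finite_vec_box: "(\<And>n. finite (S n)) \<Longrightarrow> finite {v::'a^'d. \<forall>n. v $ n \<in> S n}"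
  unfolding vec_box_eq by (intro finite_imageI finite_PiE) auto

lemma card_vec_box: "card {v::'a^'d. \<forall>n. v $ n \<in> S n} = (\<Prod>n\<in>UNIV. card (S n))"
  unfolding vec_box_eq
  by (subst card_image) (auto simp: card_PiE inj_on_def vec_lambda_inject)

definition lat :: "nat \<Rightarrow> (int^'d) set" where
  "lat \<tau> = {k. \<forall>n. int \<tau> dvd k $ n}"

lemma lat_subgrp: "subgrp (lat \<tau>)"
  by (auto simp: subgrp_def lat_def)

lemma lat_scale: "k \<in> lat \<tau> \<Longrightarrow> n *s k \<in> lat \<tau>"
  by (auto simp: lat_def)

definition cell :: "nat \<Rightarrow> int^'d \<Rightarrow> (int^'d) set" where
  "cell \<tau> c = {i. \<forall>n. c $ n \<le> i $ n \<and> i $ n < c $ n + int \<tau>}"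

definition cube :: "int^'d \<Rightarrow> nat \<Rightarrow> (int^'d) set" where
  "cube x t = {i. \<forall>n. \<bar>i $ n - x $ n\<bar> \<le> int t}"

lemma finite_cell: "finite (cell \<tau> c)" and card_cell: "card (cell \<tau> (c::int^'d)) = \<tau> ^ CARD('d)"
proof -
  have *: "cell \<tau> c = {v. \<forall>n. v $ n \<in> {c $ n..<c $ n + int \<tau>}}" by (auto simp: cell_def)
  show "finite (cell \<tau> c)" unfolding * by (rule finite_vec_box) auto
  show "card (cell \<tau> c) = \<tau> ^ CARD('d)" unfolding * card_vec_box by simp
qed

lemma finite_cube: "finite (cube x t)" and card_cube: "card (cube (x::int^'d) t) = (2 * t + 1) ^ CARD('d)"
proof -
  have *: "cube x t = {v. \<forall>n. v $ n \<in> {x $ n - int t..x $ n + int t}}"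
    by (auto simp: cube_def abs_le_iff; smt (verit))
  show "finite (cube x t)" unfolding * by (rule finite_vec_box) auto
  have "card {x $ n - int t..x $ n + int t} = 2 * t + 1" for n by auto
  then show "card (cube x t) = (2 * t + 1) ^ CARD('d)" unfolding * card_vec_box by simp
qed

lemma cell_lat:
  assumes "\<tau> \<ge> 1"
  shows "\<exists>k\<in>lat \<tau>. i - k \<in> cell \<tau> c"
proof (intro bexI)
  define k where "k = (\<chi> n. int \<tau> * ((i $ n - c $ n) div int \<tau>))"
  show "k \<in> lat \<tau>" by (simp add: k_def lat_def)
  have "i $ n - k $ n = c $ n + (i $ n - c $ n) mod int \<tau>" for n
    by (simp add: k_def minus_mult_div_eq_mod[symmetric])
  then show "i - k \<in> cell \<tau> c" using assms by (simp add: cell_def)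
qed

definition ht :: "int^'d \<Rightarrow> int^'d \<Rightarrow> int" where
  "ht q i = (\<Sum>n\<in>UNIV. q $ n * i $ n)"

lemma ht_linear [simp]:
  "ht q (i + j) = ht q i + ht q j" "ht q (i - j) = ht q i - ht q j"
  "ht q (- i) = - ht q i" "ht q (m *s i) = m * ht q i" "ht q 0 = 0"
  by (simp_all add: ht_def algebra_simps sum.distrib sum_subtractf sum_negf sum_distrib_left)

lemma l1_pos: "q \<noteq> 0 \<Longrightarrow> 0 < l1 q"
proof -
  assume "q \<noteq> 0"
  then obtain n where "q $ n \<noteq> 0" by (auto simp: vec_eq_iff)
  then show ?thesis unfolding l1_def by (intro sum_pos2[of UNIV n]) auto
qed

lemma abs_ht_le:
  assumes "\<And>n. \<bar>i $ n\<bar> \<le> t"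
  shows "\<bar>ht q i\<bar> \<le> t * l1 q"
proof -
  have "\<bar>ht q i\<bar> \<le> (\<Sum>n\<in>UNIV. \<bar>q $ n * i $ n\<bar>)" unfolding ht_def by (rule sum_abs)
  also have "\<dots> \<le> (\<Sum>n\<in>UNIV. t * \<bar>q $ n\<bar>)"
  proof (rule sum_mono)
    fix n
    show "\<bar>q $ n * i $ n\<bar> \<le> t * \<bar>q $ n\<bar>"
      using mult_left_mono[OF assms[of n], of "\<bar>q $ n\<bar>"] by (simp add: abs_mult mult.commute)
  qed
  finally show ?thesis by (simp add: l1_def sum_distrib_left)
qed

text \<open>A vector with entries in -1, 0, 1 that climbs fastest in direction \<open>q\<close>:
  \<open>m *s sgnv q\<close> rises by \<open>m * l1 q\<close>, the unit in which
  \<open>abs_ht_le\<close> bounds the heights in a cube.\<close>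

definition sgnv :: "int^'d \<Rightarrow> int^'d" where
  "sgnv q = (\<chi> n. sgn (q $ n))"

lemma ht_sgnv: "ht q (sgnv q) = l1 q"
  by (simp add: ht_def sgnv_def l1_def abs_sgn)

locale spin_model = interaction J h "lat \<tau>" for J h and \<tau> :: nat +
  assumes tau_pos: "\<tau> \<ge> 1"
    and h_cell: "sum h (cell \<tau> c) = 0"
begin

text \<open>Only pure additions and pure removals are tested; \<open>ground_state_spin\<close>
  recovers mixed changes. The set \<open>X\<close> itself is not confined to
  \<open>S\<close>.\<close>

definition local_min :: "(int^'a) set \<Rightarrow> (int^'a) set \<Rightarrow> bool" where
  "local_min S X \<longleftrightarrow> (\<forall>A. finite A \<longrightarrow> A \<subseteq> S \<longrightarrow>
     (A \<inter> X = {} \<longrightarrow> 0 \<le> delta UNIV A X) \<and> (A \<subseteq> X \<longrightarrow> delta UNIV A (X - A) \<le> 0))"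

text \<open>Quantifying over every locally minimal \<open>X\<close> makes \<open>D\<close>
  independent of direction, period and barriers, as the compactness argument for real directions
  requires.\<close>

definition pure_radius :: "nat \<Rightarrow> bool" where
  "pure_radius D \<longleftrightarrow> (\<forall>x X. local_min (cube x D) X \<longrightarrow>
     (\<exists>c. cell \<tau> c \<subseteq> cube x D \<and> (cell \<tau> c \<subseteq> X \<or> cell \<tau> c \<inter> X = {})))"

end

section \<open>Constrained periodic minimizers in an integer direction\<close>

locale periodic = spin_model J h \<tau> for J h and \<tau> :: nat +
  fixes q :: "int^'a" and N :: nat
  assumes q_nonzero: "q \<noteq> 0" and N_pos: "N \<ge> 1" and N_dvd: "\<tau> dvd N"
begin

definition K :: "(int^'a) set" where
  "K = {k. ht q k = 0} \<inter> lat N"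

definition R :: "(int^'a) set" where
  "R = (SOME R. transv K UNIV R)"

definition P :: "int \<Rightarrow> (int^'a) set" where
  "P a = {i. ht q i \<le> a}"

lemma K_subgrp: "subgrp K"
  using lat_subgrp[of N] by (auto simp: subgrp_def K_def)

lemma K_lat: "K \<subseteq> lat \<tau>"
  using N_dvd by (auto simp: K_def lat_def intro: dvd_trans[of "int \<tau>" "int N"])

lemma R_transv: "transv K UNIV R"
  unfolding R_def by (rule someI_ex) (rule transv_exists[OF K_subgrp])

lemma invar_P: "invar K (P a)"
  by (auto simp: invar_def P_def K_def)

text \<open>The height together with the coordinates modulo \<open>N\<close> determines a site up to
  \<open>K\<close>, and in a slab both take finitely many values.\<close>

lemma finite_slab: "finite ((P b - P a) \<inter> R)"
proof (rule finite_imageD)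
  define \<phi> where "\<phi> i = (ht q i, \<chi> n. i $ n mod int N)" for i :: "int^'a"
  have "\<phi> ` ((P b - P a) \<inter> R) \<subseteq> {a..b} \<times> {v. \<forall>n. v $ n \<in> {0..<int N}}"
    using N_pos by (auto simp: \<phi>_def P_def)
  moreover have "finite ({a..b} \<times> {v::int^'a. \<forall>n. v $ n \<in> {0..<int N}})"
    by (intro finite_SigmaI finite_vec_box) auto
  ultimately show "finite (\<phi> ` ((P b - P a) \<inter> R))" by (rule finite_subset)
  show "inj_on \<phi> ((P b - P a) \<inter> R)"
  proof (rule inj_onI)
    fix i j assume ij: "i \<in> (P b - P a) \<inter> R" "j \<in> (P b - P a) \<inter> R" "\<phi> i = \<phi> j"
    have "i $ n mod int N = j $ n mod int N" for n
      using ij(3) by (auto simp: \<phi>_def vec_eq_iff)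
    then have "i - j \<in> K" using ij by (auto simp: \<phi>_def K_def lat_def mod_eq_dvd_iff)
    moreover have "0 \<in> K" using K_subgrp by (auto simp: subgrp_def)
    moreover have "i - (i - j) \<in> R" "i - 0 \<in> R" using ij(1,2) by simp_all
    moreover have "\<exists>!k. k \<in> K \<and> i - k \<in> R" using R_transv by (simp add: transv_def)
    ultimately have "i - j = 0" by blast
    then show "i = j" by simp
  qed
qed

lemma finite_in_slab: "A \<subseteq> P b \<Longrightarrow> A \<inter> P a = {} \<Longrightarrow> finite (A \<inter> R)"
  by (rule finite_subset[OF _ finite_slab[of b a]]) auto

text \<open>The one-sided consequences of minimality between the barriers \<open>P 0\<close> and
  \<open>P M\<close>. The strict sign for removals encodes the fewest plus sites: a removal at zero
  cost would leave a smaller minimizer.\<close>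

definition minimal :: "int \<Rightarrow> (int^'a) set \<Rightarrow> bool" where
  "minimal M X \<longleftrightarrow> invar K X \<and> P 0 \<subseteq> X \<and> X \<subseteq> P M \<and>
     (\<forall>A. invar K A \<longrightarrow> A \<subseteq> P M - X \<longrightarrow> 0 \<le> delta R A X) \<and>
     (\<forall>A. invar K A \<longrightarrow> A \<noteq> {} \<longrightarrow> A \<subseteq> X - P 0 \<longrightarrow> delta R A (X - A) < 0)"

lemma invar_determined:
  assumes "invar K X" "invar K Y" "X \<inter> R = Y \<inter> R"
  shows "X = Y"
proof -
  have "i \<in> X \<longleftrightarrow> i \<in> Y" for i
  proof -
    obtain k where k: "k \<in> K" "i - k \<in> R" using R_transv unfolding transv_def by (meson UNIV_I ex1_implies_ex)
    have "i - k \<in> X \<longleftrightarrow> i - k \<in> Y" using assms(3) k(2) by blast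
    then show ?thesis using invarD_diff[OF assms(1) k(1)] invarD_diff[OF assms(2) k(1)] by simp
  qed
  then show ?thesis by auto
qed

lemma minimal_exists:
  assumes "M \<ge> 0"
  shows "\<exists>X. minimal M X"
proof -
  define F where "F = {X. invar K X \<and> P 0 \<subseteq> X \<and> X \<subseteq> P M}"
  define E where "E X = delta R (X - P 0) (P 0)" for X
  have "finite F"
  proof (rule finite_imageD)
    have "(\<lambda>X. (X - P 0) \<inter> R) ` F \<subseteq> Pow ((P M - P 0) \<inter> R)" by (auto simp: F_def)
    then show "finite ((\<lambda>X. (X - P 0) \<inter> R) ` F)"
      by (rule finite_subset) (simp only: finite_Pow_iff finite_slab)
    show "inj_on (\<lambda>X. (X - P 0) \<inter> R) F"
    proof (rule inj_onI)
      fix X Y assume XY: "X \<in> F" "Y \<in> F" "(X - P 0) \<inter> R = (Y - P 0) \<inter> R"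
      have F: "invar K X" "invar K Y" "P 0 \<subseteq> X" "P 0 \<subseteq> Y" using XY(1,2) by (simp_all add: F_def)
      have split: "Z \<inter> R = (P 0 \<inter> R) \<union> ((Z - P 0) \<inter> R)" if "P 0 \<subseteq> Z" for Z
        using that by auto
      have "X \<inter> R = Y \<inter> R" by (simp only: split[OF F(3)] split[OF F(4)] XY(3))
      with F(1,2) show "X = Y" by (rule invar_determined)
    qed
  qed
  moreover have "P 0 \<in> F" using assms by (auto simp: F_def invar_P) (auto simp: P_def)
  ultimately have "\<exists>X. is_arg_min E (\<lambda>X. X \<in> F) X" by (intro ex_is_arg_min_if_finite) auto
  then obtain X0 where X0: "X0 \<in> F \<and> (\<forall>Y\<in>F. E X0 \<le> E Y)" by (auto simp: is_arg_min_linorder)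
  define Q where "Q X \<longleftrightarrow> X \<in> F \<and> (\<forall>Y\<in>F. E X \<le> E Y)" for X
  have "Q X0" unfolding Q_def by (rule X0)
  then obtain X where QX: "Q X" and least: "\<And>Y. Q Y \<Longrightarrow> card ((X - P 0) \<inter> R) \<le> card ((Y - P 0) \<inter> R)"
    using ex_has_least_nat[of Q X0 "\<lambda>X. card ((X - P 0) \<inter> R)"] by blast
  from QX have X: "X \<in> F" "\<And>Y. Y \<in> F \<Longrightarrow> E X \<le> E Y" unfolding Q_def by blast+
  have XF: "invar K X" "P 0 \<subseteq> X" "X \<subseteq> P M" using X by (auto simp: F_def)
  have step: "E (Y \<union> A) = E Y + delta R A Y" if "Y \<in> F" "invar K A" "A \<inter> Y = {}" "A \<subseteq> P M" for Y A
  proof -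
    have Y: "invar K Y" "P 0 \<subseteq> Y" "Y \<subseteq> P M" using that by (auto simp: F_def)
    have "E (Y \<union> A) = delta R ((Y - P 0) \<union> A) (P 0)"
      unfolding E_def using that Y by (auto intro!: arg_cong2[where f = "delta R"])
    also have "\<dots> = delta R (Y - P 0) (P 0) + delta R A (P 0 \<union> (Y - P 0))"
      using that Y finite_in_slab[of "Y - P 0" M 0] finite_in_slab[of A M 0]
      by (intro delta_Un[OF K_subgrp K_lat R_transv] invar_ops invar_P) auto
    also have "P 0 \<union> (Y - P 0) = Y" using Y by auto
    finally show ?thesis by (simp add: E_def)
  qed
  show ?thesis
  proof (intro exI[of _ X], unfold minimal_def, intro conjI allI impI XF)
    fix A assume A: "invar K A" "A \<subseteq> P M - X"
    then have "X \<union> A \<in> F" using XF by (auto simp: F_def intro: invar_ops)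
    then have "E X \<le> E (X \<union> A)" by (rule X)
    also have "\<dots> = E X + delta R A X" using A X by (intro step) auto
    finally show "0 \<le> delta R A X" by simp
  next
    fix A assume A: "invar K A" "A \<noteq> {}" "A \<subseteq> X - P 0"
    then have Y: "X - A \<in> F" using XF by (auto simp: F_def intro: invar_ops)
    have "X = (X - A) \<union> A" using A by auto
    then have eq: "E X = E (X - A) + delta R A (X - A)"
      using step[OF Y A(1)] A XF by auto
    \<comment> \<open>Equality would make \<open>X - A\<close> a minimizer as well, with fewer plus
      sites per period, since a nonempty invariant set meets \<open>R\<close>.\<close>
    have "E X \<noteq> E (X - A)"
    proof
      assume *: "E X = E (X - A)"
      have "card ((X - P 0) \<inter> R) \<le> card ((X - A - P 0) \<inter> R)"
      proof (rule least, unfold Q_def, intro conjI ballI Y)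
        show "E (X - A) \<le> E Z" if "Z \<in> F" for Z using X(2)[OF that] * by simp
      qed
      moreover have "(X - A - P 0) \<inter> R \<subset> (X - P 0) \<inter> R"
      proof -
        have "A \<inter> R \<noteq> {}" using invar_determined[OF A(1), of "{}"] A(2) by (auto simp: invar_def)
        then show ?thesis using A by auto
      qed
      then have "card ((X - A - P 0) \<inter> R) < card ((X - P 0) \<inter> R)"
        using finite_in_slab[of "X - P 0" M 0] XF by (intro psubset_card_mono) auto
      ultimately show False by simp
    qed
    then show "delta R A (X - A) < 0" using eq X(2)[OF Y] by linarith
  qed
qed

text \<open>Let \<open>A\<close> be the part of \<open>X\<close> outside the translate. Putting
  \<open>A\<close> back onto \<open>X - A\<close> has negative cost, hence by submodularity so has
  adding it to the larger set \<open>translate k X\<close>. Translated by \<open>- k\<close> this is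
  an admissible addition to \<open>X\<close>, whose cost cannot be negative. For
  \<open>ht q k = 0\<close> both \<open>k\<close> and \<open>- k\<close> qualify, so
  \<open>X\<close> is invariant under all such \<open>k\<close> and not merely under
  \<open>K\<close>.\<close>

lemma minimal_birkhoff:
  assumes X: "minimal M X" and k: "k \<in> lat \<tau>" "0 \<le> ht q k"
  shows "X \<subseteq> translate k X"
proof (rule ccontr)
  assume *: "\<not> X \<subseteq> translate k X"
  define A where "A = X - translate k X"
  have inv: "invar K X" "P 0 \<subseteq> X" "X \<subseteq> P M" using X by (auto simp: minimal_def)
  have A: "invar K A" "A \<noteq> {}"
    using * inv by (auto simp: A_def intro!: invar_ops invar_translate)
  have P_mem: "i \<in> X" if "ht q i \<le> 0" for i using inv(2) that by (auto simp: P_def)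
  have "A \<subseteq> X - P 0" using k(2) P_mem[of "_ - k"] by (auto simp: A_def P_def)
  then have "delta R A (X - A) < 0" using X A by (auto simp: minimal_def)
  moreover have "delta R A (translate k X) \<le> delta R A (X - A)"
    by (rule delta_antimono) (auto simp: A_def)
  moreover have "delta R A (translate k X) = delta R (translate (- k) A) X"
    using delta_translate[OF K_subgrp K_lat R_transv, of A "translate k X" "- k"] inv A k
    by (simp add: translate_ops invar_translate subgrp_closed(3)[OF lat_subgrp])
      (simp add: translate_def)
  moreover have "0 \<le> delta R (translate (- k) A) X"
  proof -
    have P_mem: "ht q i \<le> M" if "i \<in> X" for i using inv(3) that by (auto simp: P_def)
    have "translate (- k) A \<subseteq> P M - X"
    proof
      fix i assume "i \<in> translate (- k) A"
      then have i: "i + k \<in> X" "i \<notin> X" by (auto simp: A_def)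
      show "i \<in> P M - X" using P_mem[OF i(1)] i(2) k(2) by (simp add: P_def)
    qed
    then show ?thesis using X A by (auto simp: minimal_def invar_translate)
  qed
  ultimately show False by linarith
qed

end

section \<open>Periodic minimizers\<close>

context spin_model
begin

text \<open>Shifting a transversal by \<open>c\<close> does not change the sum; averaging over all
  \<open>c\<close> in a cell turns every term into a cell sum of \<open>h\<close>, which
  vanishes.\<close>

lemma sum_h_transversal:
  assumes L: "subgrp L" "L \<subseteq> lat \<tau>" and S: "transv L UNIV S"
  shows "sum h S = 0"
proof -
  have shift: "(\<Sum>i\<in>S. h (i + c)) = sum h S" for c
  proof -
    have "(\<Sum>i\<in>S. h (i + c)) = sum h (translate c S)"
      unfolding translate_eq_image by (subst sum.reindex) (auto simp: inj_on_def)
    also have "\<dots> = sum h S"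
    proof (rule transv_sum[OF L(1) _ S])
      have "translate c UNIV = UNIV" by auto
      then show "transv L UNIV (translate c S)" using transv_translate[OF S, of c] by simp
      show "h (i + k) = h i" if "k \<in> L" for i k using that L h_shift by auto
    qed
    finally show ?thesis .
  qed
  have mean: "(\<Sum>c\<in>cell \<tau> 0. h (i + c)) = 0" for i
  proof -
    have "(\<Sum>c\<in>cell \<tau> 0. h (i + c)) = sum h (cell \<tau> i)"
      by (rule sum.reindex_bij_witness[where j = "\<lambda>c. i + c" and i = "\<lambda>c. c - i"])
        (auto simp: cell_def algebra_simps)
    then show ?thesis by (simp add: h_cell)
  qed
  have "real (card (cell \<tau> (0::int^'a))) * sum h S = (\<Sum>c\<in>cell \<tau> 0. \<Sum>i\<in>S. h (i + c))"
    by (simp add: shift)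
  also have "\<dots> = (\<Sum>i\<in>S. \<Sum>c\<in>cell \<tau> 0. h (i + c))" by (rule sum.swap)
  finally show ?thesis using tau_pos by (simp add: mean card_cell)
qed

end

context periodic
begin

text \<open>The set between \<open>X\<close> and its translate is a transversal of the lattice generated by \<open>K\<close>
  and \<open>k\<close>, so the fluxes above and below it agree by the swap lemma for this larger lattice.\<close>

lemma delta_translation_slab:
  assumes X: "invar K X" "P a \<subseteq> X" "X \<subseteq> P b"
    and k: "k \<in> lat \<tau>" "0 < ht q k" and down: "translate (- k) X \<subseteq> X"
  shows "delta R (X - translate (- k) X) (translate (- k) X) = 0"
proof -
  define A where "A = X - translate (- k) X"
  have A: "i \<in> A \<longleftrightarrow> i \<in> X \<and> i + k \<notin> X" for i by (auto simp: A_def)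
  have inv_A: "invar K A" unfolding A_def by (intro invar_ops invar_translate X)
  define L where "L = {l. \<exists>\<kappa>\<in>K. \<exists>n::int. l = \<kappa> + n *s k}"
  have L: "subgrp L"
    unfolding subgrp_def
  proof (intro conjI ballI)
    show "0 \<in> L" unfolding L_def
      using subgrp_closed(1)[OF K_subgrp] by (auto intro!: bexI[of _ 0] exI[of _ 0])
    fix x y assume "x \<in> L" "y \<in> L"
    then obtain \<kappa> \<kappa>' n n' where "\<kappa> \<in> K" "\<kappa>' \<in> K" "x = \<kappa> + n *s k" "y = \<kappa>' + n' *s k"
      by (auto simp: L_def)
    then have "x - y = (\<kappa> - \<kappa>') + (n - n') *s k" "\<kappa> - \<kappa>' \<in> K"
      by (auto simp: vec_eq_iff algebra_simps intro: subgrp_closed(2)[OF K_subgrp])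
    then show "x - y \<in> L" unfolding L_def by blast
  qed
  have L_lat: "L \<subseteq> lat \<tau>"
    using K_lat k lat_scale by (auto simp: L_def intro!: subgrp_closed(4)[OF lat_subgrp])
  have down1: "i - k \<in> X" if "i \<in> X" for i
    using down that by (auto simp: subset_iff)
  have downs: "i - n *s k \<in> X" if "i \<in> X" "0 \<le> n" for i n
    using \<open>0 \<le> n\<close>
  proof (induction n rule: int_ge_induct)
    case (step n)
    have "i - (n + 1) *s k = i - n *s k - k" by (simp add: vec_eq_iff algebra_simps)
    then show ?case using down1 step by metis
  qed (use that in simp)
  \<comment> \<open>Along \<open>i - n *s k\<close> membership in \<open>X\<close> is monotone in
    \<open>n\<close>, false for very negative \<open>n\<close> and true for large \<open>n\<close>;
    \<open>A\<close> marks the single transition.\<close>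
  have slab: "\<exists>!n. i - n *s k \<in> A" for i
  proof -
    have below: "i - n *s k \<in> X" if "n \<ge> \<bar>ht q i\<bar> + \<bar>a\<bar>" for n
    proof -
      have "n * 1 \<le> n * ht q k" using that k by (intro mult_left_mono) auto
      then have "ht q (i - n *s k) \<le> a" using that by simp
      then show ?thesis using X by (auto simp: P_def)
    qed
    have above: "i - n *s k \<notin> X" if "n < - (\<bar>ht q i\<bar> + \<bar>b\<bar>)" for n
    proof -
      have "n * ht q k \<le> n * 1" using that k by (intro mult_left_mono_neg) auto
      then have "ht q (i - n *s k) > b" using that by simp
      then show ?thesis using X by (auto simp: P_def)
    qed
    define Z where "Z = {m::nat. i - (int m - (\<bar>ht q i\<bar> + \<bar>b\<bar> + 1)) *s k \<in> X}"
    have "i - (int (nat (2 * (\<bar>ht q i\<bar> + \<bar>b\<bar> + 1) + \<bar>a\<bar>)) - (\<bar>ht q i\<bar> + \<bar>b\<bar> + 1)) *s k \<in> X"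
      by (rule below) simp
    then have "nat (2 * (\<bar>ht q i\<bar> + \<bar>b\<bar> + 1) + \<bar>a\<bar>) \<in> Z"
      unfolding Z_def by (rule CollectI)
    then have Zm: "(LEAST m. m \<in> Z) \<in> Z" by (rule LeastI)
    have "i - (int 0 - (\<bar>ht q i\<bar> + \<bar>b\<bar> + 1)) *s k \<notin> X" by (rule above) simp
    then have "0 \<notin> Z" unfolding Z_def by blast
    then obtain m where m: "(LEAST m. m \<in> Z) = Suc m" using Zm by (metis not0_implies_Suc)
    then have "m \<notin> Z" using not_less_Least[of m "\<lambda>m. m \<in> Z"] by simp
    define n where "n = int (Suc m) - (\<bar>ht q i\<bar> + \<bar>b\<bar> + 1)"
    have "Suc m \<in> Z" using Zm by (simp only: m)
    then have n1: "i - n *s k \<in> X" unfolding n_def Z_def by blast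
    have "n - 1 = int m - (\<bar>ht q i\<bar> + \<bar>b\<bar> + 1)" by (simp add: n_def)
    then have n2: "i - (n - 1) *s k \<notin> X" using \<open>m \<notin> Z\<close> unfolding Z_def by (simp only: mem_Collect_eq not_False_eq_True)
    have e: "i - n *s k + k = i - (n - 1) *s k" for n by (simp add: vec_eq_iff algebra_simps)
    show ?thesis
    proof (rule ex1I[of _ n])
      show "i - n *s k \<in> A" using n1 n2 by (simp add: A e)
      fix n' assume "i - n' *s k \<in> A"
      then have n': "i - n' *s k \<in> X" "i - (n' - 1) *s k \<notin> X" by (simp_all add: A e)
      have mono: "i - v *s k \<in> X" if "i - u *s k \<in> X" "u \<le> v" for u v
      proof -
        have "i - v *s k = (i - u *s k) - (v - u) *s k" by (simp add: vec_eq_iff algebra_simps)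
        then show ?thesis using downs[OF that(1), of "v - u"] that(2) by simp
      qed
      show "n' = n"
        using mono[OF n1, of "n' - 1"] mono[OF n'(1), of "n - 1"] n' n2 by linarith
    qed
  qed
  define S where "S = A \<inter> R"
  have S: "transv L UNIV S"
    unfolding transv_def
  proof (intro conjI ballI)
    fix i :: "int^'a"
    obtain n where n: "i - n *s k \<in> A" using slab by blast
    obtain \<kappa> where \<kappa>: "\<kappa> \<in> K" "i - n *s k - \<kappa> \<in> R"
      using R_transv unfolding transv_def by blast
    show "\<exists>!l. l \<in> L \<and> i - l \<in> S"
    proof (rule ex1I[of _ "\<kappa> + n *s k"])
      have e: "i - (\<kappa> + n *s k) = i - n *s k - \<kappa>" by simp
      have "i - n *s k - \<kappa> \<in> A" using n invarD_diff[OF inv_A \<kappa>(1)] by blast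
      then have "i - (\<kappa> + n *s k) \<in> S" unfolding e S_def using \<kappa>(2) by blast
      then show "\<kappa> + n *s k \<in> L \<and> i - (\<kappa> + n *s k) \<in> S" using \<kappa>(1) by (auto simp: L_def)
      fix l assume "l \<in> L \<and> i - l \<in> S"
      then obtain \<kappa>' n' where l: "\<kappa>' \<in> K" "l = \<kappa>' + n' *s k" "i - l \<in> A \<inter> R"
        unfolding L_def S_def by blast
      moreover have "i - (\<kappa>' + n' *s k) = i - n' *s k - \<kappa>'" by simp
      ultimately have l: "\<kappa>' \<in> K" "l = \<kappa>' + n' *s k" "i - n' *s k - \<kappa>' \<in> A \<inter> R"
        by (simp_all only:)
      then have "i - n' *s k \<in> A" using invarD_diff[OF inv_A] by blast
      then have "n' = n" using n slab by blast
      moreover have "\<kappa>' = \<kappa>" using l \<kappa> R_transv \<open>n' = n\<close> unfolding transv_def by blast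
      ultimately show "l = \<kappa> + n *s k" using l by simp
    qed
  qed simp
  have fin: "finite S" unfolding S_def
  proof (rule finite_in_slab)
    show "A \<subseteq> P b" using X by (auto simp: A_def)
    show "A \<inter> P (a - ht q k) = {}" using X(2) by (auto simp: A P_def subset_iff)
  qed
  \<comment> \<open>\<open>W\<close> relates sites separated by some translate of \<open>X\<close>
    by a multiple of \<open>k\<close>. These translates are nested, so for \<open>i\<close> in the
    layer \<open>A\<close> the condition \<open>W i j\<close> says that \<open>j\<close> is above
    \<open>X\<close>, and for \<open>j\<close> in the layer it says that \<open>i\<close> is in
    \<open>translate (- k) X\<close>.\<close>
  define W where "W i j \<longleftrightarrow> (\<exists>n::int. i - n *s k \<in> X \<and> j - n *s k \<notin> X)" for i j
  have swap: "(\<Sum>i\<in>S. I i {j. W i j}) = (\<Sum>j\<in>S. I j {i. W i j})"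
  proof (rule flux_swap[OF L L_lat S])
    fix l i j assume "l \<in> L" "W i j"
    then obtain \<kappa> n m where *: "\<kappa> \<in> K" "l = \<kappa> + n *s k" "i - m *s k \<in> X" "j - m *s k \<notin> X"
      by (auto simp: L_def W_def)
    have e: "x + l - (m + n) *s k = (x - m *s k) + \<kappa>" for x
      by (simp add: *(2) vec_eq_iff algebra_simps)
    have "i + l - (m + n) *s k \<in> X" "j + l - (m + n) *s k \<notin> X"
      unfolding e using *(3,4) invarD[OF X(1) *(1)] by blast+
    then show "W (i + l) (j + l)" unfolding W_def by blast
  qed (auto simp: fin)
  have up: "I i {j. W i j} = I i (- X)" if "i \<in> S" for i
  proof -
    have i: "i \<in> X" "i + k \<notin> X" using that by (auto simp: S_def A)
    have "W i j \<longleftrightarrow> j \<notin> X" for j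
    proof
      assume "W i j"
      then obtain n where n: "i - n *s k \<in> X" "j - n *s k \<notin> X" by (auto simp: W_def)
      have "0 \<le> n"
      proof (rule ccontr)
        assume "\<not> 0 \<le> n"
        then have "i - n *s k - (- n - 1) *s k \<in> X" by (intro downs[OF n(1)]) simp
        moreover have "i - n *s k - (- n - 1) *s k = i + k"
          by (simp add: vec_eq_iff algebra_simps)
        ultimately show False using i(2) by (simp only:)
      qed
      then show "j \<notin> X" using downs[of j n] n by blast
    next
      assume "j \<notin> X"
      then have "i - 0 *s k \<in> X \<and> j - 0 *s k \<notin> X" using i by simp
      then show "W i j" unfolding W_def by blast
    qed
    then have "{j. W i j} = - X" by auto
    then show ?thesis by simp
  qed
  have dn: "I j {i. W i j} = I j (translate (- k) X)" if "j \<in> S" for j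
  proof -
    have j: "j \<in> X" "j + k \<notin> X" using that by (auto simp: S_def A)
    have "W i j \<longleftrightarrow> i + k \<in> X" for i
    proof
      assume "W i j"
      then obtain n where n: "i - n *s k \<in> X" "j - n *s k \<notin> X" by (auto simp: W_def)
      then have "n < 0" using downs[OF j(1), of n] by fastforce
      then have "i - n *s k - (- n - 1) *s k \<in> X" by (intro downs[OF n(1)]) simp
      moreover have "i - n *s k - (- n - 1) *s k = i + k"
        by (simp add: vec_eq_iff algebra_simps)
      ultimately show "i + k \<in> X" by (simp only:)
    next
      assume "i + k \<in> X"
      moreover have e: "x - (- 1) *s k = x + k" for x by (simp add: vec_eq_iff)
      ultimately have "i - (- 1) *s k \<in> X \<and> j - (- 1) *s k \<notin> X" using j unfolding e by blast
      then show "W i j" unfolding W_def by blast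
    qed
    then have "{i. W i j} = translate (- k) X"
      by (intro set_eqI) (simp only: mem_Collect_eq mem_translate diff_minus_eq_add)
    then show ?thesis by simp
  qed
  have "(\<Sum>i\<in>S. I i (- X)) = (\<Sum>i\<in>S. I i {j. W i j})"
    by (rule sum.cong[OF refl]) (rule up[symmetric])
  also note swap
  also have "(\<Sum>j\<in>S. I j {i. W i j}) = (\<Sum>j\<in>S. I j (translate (- k) X))"
    by (rule sum.cong[OF refl]) (rule dn)
  finally have flux: "(\<Sum>i\<in>S. I i (- X)) = (\<Sum>i\<in>S. I i (translate (- k) X))" .
  have "A \<union> translate (- k) X = X" using down by (auto simp: A_def)
  then have "delta R A (translate (- k) X) = (\<Sum>i\<in>S. I i (- X) - I i (translate (- k) X) + h i / 2)"
    by (simp only: delta_def S_def)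
  also have "\<dots> = (\<Sum>i\<in>S. I i (- X)) - (\<Sum>i\<in>S. I i (translate (- k) X)) + sum h S / 2"
    by (simp only: sum.distrib sum_subtractf sum_divide_distrib)
  also have "\<dots> = 0" using flux sum_h_transversal[OF L L_lat S] by simp
  finally show ?thesis by (simp only: A_def)
qed

text \<open>Otherwise the top layer \<open>X - translate (- k) X\<close> could be removed without
  touching \<open>P 0\<close>, at zero cost by \<open>delta_translation_slab\<close>, against the
  strict sign in \<open>minimal\<close>. The layer is nonempty because \<open>X\<close> is bounded
  above.\<close>

lemma minimal_not_above_translate:
  assumes X: "minimal M X" and k: "k \<in> lat \<tau>" "0 < ht q k"
  shows "\<not> P (ht q k) \<subseteq> X"
proof
  assume above: "P (ht q k) \<subseteq> X"
  have inv: "invar K X" "P 0 \<subseteq> X" "X \<subseteq> P M" using X by (auto simp: minimal_def)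
  have down: "translate (- k) X \<subseteq> X"
    using minimal_birkhoff[OF X k(1)] k(2) by (auto simp: subset_iff)
  define A where "A = X - translate (- k) X"
  have "A \<noteq> {}"
  proof
    assume "A = {}"
    then have step: "i + k \<in> X" if "i \<in> X" for i using that by (auto simp: A_def)
    have "int n *s k \<in> X" for n
    proof (induction n)
      case 0 show ?case using inv(2) by (auto simp: P_def)
    next
      case (Suc n)
      have "int (Suc n) *s k = int n *s k + k" by (simp add: vec_eq_iff algebra_simps)
      then show ?case using step[OF Suc] by (simp only:)
    qed
    moreover have "ht q i \<le> M" if "i \<in> X" for i using inv(3) that by (auto simp: P_def)
    ultimately have "ht q (int (nat (\<bar>M\<bar> + 1)) *s k) \<le> M" by blast
    then have "(\<bar>M\<bar> + 1) * ht q k \<le> M" by (simp only: ht_linear) simp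
    moreover have "(\<bar>M\<bar> + 1) * 1 \<le> (\<bar>M\<bar> + 1) * ht q k" using k(2) by (intro mult_left_mono) auto
    ultimately have "(\<bar>M\<bar> + 1) * 1 \<le> M" by (rule order_trans[rotated])
    then show False by simp
  qed
  moreover have "A \<subseteq> X - P 0"
  proof
    fix i assume "i \<in> A"
    then have i: "i \<in> X" "i + k \<notin> X" by (auto simp: A_def)
    then have "i + k \<notin> P (ht q k)" using above by blast
    then show "i \<in> X - P 0" using i by (simp add: P_def)
  qed
  moreover have "invar K A" using inv by (auto simp: A_def intro!: invar_ops invar_translate)
  ultimately have "delta R A (X - A) < 0" using X by (auto simp: minimal_def)
  moreover have "X - A = translate (- k) X" using down by (auto simp: A_def)
  moreover have "delta R A (translate (- k) X) = 0"
    unfolding A_def by (rule delta_translation_slab[OF inv k down])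
  ultimately show False by simp
qed

text \<open>Lifts the lower constraint \<open>P 0 \<subseteq> X\<close>: the translate of \<open>X\<close> by \<open>- k\<close> is minimal
  for the constraint \<open>P (- ht q k)\<close> and has the same energy as \<open>X\<close>.\<close>

lemma minimal_removal:
  assumes X: "minimal M X" and k: "k \<in> lat \<tau>" "0 < ht q k" and le: "X \<subseteq> P (M - ht q k)"
    and A: "invar K A" "A \<subseteq> X" "A \<inter> P (- ht q k) = {}"
  shows "delta R A (X - A) \<le> 0"
proof -
  have inv: "invar K X" "P 0 \<subseteq> X" "X \<subseteq> P M" using X by (auto simp: minimal_def)
  define Y where "Y = translate (- k) X"
  have down: "Y \<subseteq> X"
    using minimal_birkhoff[OF X k(1)] k(2) by (auto simp: Y_def subset_iff)
  have inv_Y: "invar K Y" unfolding Y_def by (intro invar_translate inv)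
  have nk: "- k \<in> lat \<tau>" using k subgrp_closed(3)[OF lat_subgrp] by auto
  have Y_add: "0 \<le> delta R C Y" if "invar K C" "C \<subseteq> P (M - ht q k) - Y" for C
  proof -
    have "delta R C Y = delta R (translate k C) (translate k Y)"
      by (rule delta_translate[OF K_subgrp K_lat R_transv, symmetric]) (use that inv_Y k in auto)
    also have "translate k Y = X" by (auto simp: Y_def)
    also have "0 \<le> delta R (translate k C) X"
    proof -
      have "translate k C \<subseteq> P M - X"
      proof
        fix i assume "i \<in> translate k C"
        then have "i - k \<in> P (M - ht q k) - Y" using that(2) by auto
        then show "i \<in> P M - X" by (simp add: Y_def P_def)
      qed
      then show ?thesis using X that by (auto simp: minimal_def invar_translate)
    qed
    finally show ?thesis .
  qed
  have Y_rem: "delta R C (Y - C) \<le> 0" if "invar K C" "C \<subseteq> Y" "C \<inter> P (- ht q k) = {}" for C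
  proof (cases "C = {}")
    case False
    have "delta R C (Y - C) = delta R (translate k C) (translate k (Y - C))"
      by (rule delta_translate[OF K_subgrp K_lat R_transv, symmetric])
        (use that inv_Y k in \<open>auto intro!: invar_ops\<close>)
    also have "translate k (Y - C) = X - translate k C"
      by (auto simp: Y_def)
    also have "delta R (translate k C) (X - translate k C) < 0"
    proof -
      have "translate k C \<subseteq> X - P 0"
      proof
        fix i assume "i \<in> translate k C"
        then have "i - k \<in> Y" "i - k \<notin> P (- ht q k)" using that(2,3) by auto
        then show "i \<in> X - P 0" by (simp add: Y_def P_def)
      qed
      moreover have "translate k C \<noteq> {}" using False by (auto simp: translate_eq_image)
      ultimately show ?thesis using X that by (auto simp: minimal_def invar_translate)
    qed
    finally show ?thesis by simp
  qed (simp add: delta_def)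
  define B where "B = X - Y"
  define Z where "Z = X - (A \<union> B)"
  have fin: "finite (C \<inter> R)" if "C \<subseteq> X" "C \<inter> P (- ht q k) = {}" for C
    using that inv(3) finite_in_slab[of C M "- ht q k"] by auto
  have B_P: "B \<inter> P (- ht q k) = {}" using inv(2) by (auto simp: B_def Y_def P_def subset_iff)
  have inv_B: "invar K B" unfolding B_def by (intro invar_ops inv inv_Y)
  have Z_Y: "Z = Y - (A \<inter> Y)" using down by (auto simp: Z_def B_def)
  have "A \<inter> Y \<inter> P (- ht q k) = {}" "(B - A) \<inter> P (- ht q k) = {}" using A(3) B_P by auto
  then have fins: "finite (A \<inter> Y \<inter> R)" "finite (B \<inter> R)" "finite ((B - A) \<inter> R)" "finite (A \<inter> R)"
    using A(2,3) B_P by (intro fin; auto simp: B_def)+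
  have invs: "invar K (A \<inter> Y)" "invar K (B - A)" by (intro invar_ops A inv_Y inv_B)+
  \<comment> \<open>The cost of adding \<open>A \<union> B\<close> to \<open>Z\<close> is computed
    in two orders. Here \<open>A \<inter> Y\<close> comes first, at cost at most zero because
    \<open>Y\<close> tolerates removals, and then the layer \<open>B\<close>, which is free.\<close>
  have "delta R ((A \<inter> Y) \<union> B) Z = delta R (A \<inter> Y) Z + delta R B (Z \<union> (A \<inter> Y))"
    by (rule delta_Un[OF K_subgrp K_lat R_transv invs(1) inv_B fins(1,2)]) (auto simp: Z_def B_def)
  also have "Z \<union> (A \<inter> Y) = Y" using Z_Y by auto
  also have "delta R B Y = 0" unfolding B_def Y_def
    by (rule delta_translation_slab[OF inv k]) (use down in \<open>simp add: Y_def\<close>)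
  also have "delta R (A \<inter> Y) Z \<le> 0" unfolding Z_Y
    by (rule Y_rem[OF invs(1)]) (use A(3) in auto)
  finally have "delta R (A \<inter> Y \<union> B) Z \<le> 0" by simp
  moreover have "A \<inter> Y \<union> B = A \<union> B" using A(2) by (auto simp: B_def)
  ultimately have 1: "delta R (A \<union> B) Z \<le> 0" by (simp only:)
  \<comment> \<open>In the other order \<open>B - A\<close> comes first, at nonnegative cost by
    minimality of \<open>Y\<close> and submodularity. The remaining step, \<open>A\<close> onto
    \<open>X - A\<close>, must therefore cost at most zero.\<close>
  have "delta R ((B - A) \<union> A) Z = delta R (B - A) Z + delta R A (Z \<union> (B - A))"
    by (rule delta_Un[OF K_subgrp K_lat R_transv invs(2) A(1) fins(3,4)]) (auto simp: Z_def B_def)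
  moreover have "(B - A) \<union> A = A \<union> B" "Z \<union> (B - A) = X - A" by (auto simp: Z_def B_def)
  moreover have "0 \<le> delta R (B - A) Y"
    by (rule Y_add[OF invs(2)]) (use le in \<open>auto simp: B_def\<close>)
  moreover have "delta R (B - A) Y \<le> delta R (B - A) Z"
    by (rule delta_antimono) (auto simp: Z_Y)
  ultimately show ?thesis using 1 by simp
qed

section \<open>From periodic to local minimality, and confinement to a strip\<close>

definition orbit :: "(int^'a) set \<Rightarrow> (int^'a) set" where
  "orbit A = {i. \<exists>k\<in>K. i - k \<in> A}"

lemma invar_orbit: "invar K (orbit A)"
  unfolding invar_def
proof (intro ballI allI iffI)
  fix k i assume k: "k \<in> K"
  show "i \<in> orbit A" if *: "i + k \<in> orbit A"
  proof -
    obtain l where l: "l \<in> K" "i + k - l \<in> A" using * unfolding orbit_def by blast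
    have "l - k \<in> K" by (rule subgrp_closed(2)[OF K_subgrp l(1) k])
    moreover have "i - (l - k) \<in> A" using l(2) by (simp add: algebra_simps)
    ultimately show ?thesis unfolding orbit_def by blast
  qed
  show "i + k \<in> orbit A" if *: "i \<in> orbit A"
  proof -
    obtain l where l: "l \<in> K" "i - l \<in> A" using * unfolding orbit_def by blast
    have "l + k \<in> K" by (rule subgrp_closed(4)[OF K_subgrp l(1) k])
    moreover have "i + k - (l + k) \<in> A" using l(2) by simp
    ultimately show ?thesis unfolding orbit_def by blast
  qed
qed

lemma subset_orbit: "A \<subseteq> orbit A"
  using subgrp_closed(1)[OF K_subgrp] by (auto simp: orbit_def intro!: bexI[of _ 0])

lemma orbit_subset: "invar K X \<Longrightarrow> A \<subseteq> X \<Longrightarrow> orbit A \<subseteq> X"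
  unfolding orbit_def using invarD_diff by blast

lemma delta_orbit:
  assumes inj: "\<And>i j. i \<in> A \<Longrightarrow> j \<in> A \<Longrightarrow> i - j \<in> K \<Longrightarrow> i = j" and B: "invar K B"
  shows "delta R (orbit A) B = (\<Sum>i\<in>A. I i (- (orbit A \<union> B)) - I i B + h i / 2)"
  unfolding delta_def
proof (rule transv_sum[OF K_subgrp])
  show "transv K (orbit A) (orbit A \<inter> R)" by (rule transv_restrict[OF R_transv invar_orbit])
  show "transv K (orbit A) A"
    unfolding transv_def
  proof (intro conjI ballI subset_orbit)
    fix i assume "i \<in> orbit A"
    then obtain k where k: "k \<in> K" "i - k \<in> A" unfolding orbit_def by blast
    show "\<exists>!k. k \<in> K \<and> i - k \<in> A"
    proof (rule ex1I[of _ k])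
      fix l assume l: "l \<in> K \<and> i - l \<in> A"
      have "l - k \<in> K" by (rule subgrp_closed(2)[OF K_subgrp conjunct1[OF l] k(1)])
      moreover have "(i - k) - (i - l) = l - k" by simp
      ultimately have "(i - k) - (i - l) \<in> K" by (simp only:)
      then have "i - k = i - l" by (rule inj[OF k(2) conjunct2[OF l]])
      then show "l = k" by simp
    qed (use k in simp)
  qed
  fix i k assume k: "k \<in> K"
  then have kG: "k \<in> lat \<tau>" using K_lat by auto
  have inv: "invar K (orbit A \<union> B)" by (rule invar_ops(1)[OF invar_orbit B])
  have "I (i + k) (- (orbit A \<union> B)) = I i (- (orbit A \<union> B))"
    by (rule I_invar[OF kG k invar_ops(4)[OF inv inv]])
  moreover have "I (i + k) B = I i B" by (rule I_invar[OF kG k B])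
  ultimately show "I (i + k) (- (orbit A \<union> B)) - I (i + k) B + h (i + k) / 2 =
      I i (- (orbit A \<union> B)) - I i B + h i / 2"
    using h_shift[OF kG, of i] by (simp only:)
qed

text \<open>The periodic cost benefits in addition from couplings between different copies of
  \<open>A\<close>, which are nonnegative; so adding a single copy is at least as expensive.\<close>

lemma local_add:
  assumes inj: "\<And>i j. i \<in> A \<Longrightarrow> j \<in> A \<Longrightarrow> i - j \<in> K \<Longrightarrow> i = j" and X: "invar K X"
    and "0 \<le> delta R (orbit A) X"
  shows "0 \<le> delta UNIV A X"
proof -
  have "delta R (orbit A) X = (\<Sum>i\<in>A. I i (- (orbit A \<union> X)) - I i X + h i / 2)"
    by (rule delta_orbit[OF inj X])
  also have "\<dots> \<le> (\<Sum>i\<in>A. I i (- (A \<union> X)) - I i X + h i / 2)"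
  proof (rule sum_mono)
    fix i
    have "I i (- (orbit A \<union> X)) \<le> I i (- (A \<union> X))" by (rule I_mono) (use subset_orbit[of A] in auto)
    then show "I i (- (orbit A \<union> X)) - I i X + h i / 2 \<le> I i (- (A \<union> X)) - I i X + h i / 2" by simp
  qed
  also have "\<dots> = delta UNIV A X" by (simp add: delta_def)
  finally show ?thesis using assms by simp
qed

text \<open>Removing all copies at once leaves the smaller background \<open>X - orbit A\<close>, so
  per period it is at most as costly as removing \<open>A\<close> alone.\<close>

lemma local_remove:
  assumes inj: "\<And>i j. i \<in> A \<Longrightarrow> j \<in> A \<Longrightarrow> i - j \<in> K \<Longrightarrow> i = j" and X: "invar K X"
    and A: "A \<subseteq> X" and "delta R (orbit A) (X - orbit A) \<le> 0"
  shows "delta UNIV A (X - A) \<le> 0"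
proof -
  have inv: "invar K (X - orbit A)" by (intro invar_ops X invar_orbit)
  have 1: "orbit A \<union> (X - orbit A) = X" using orbit_subset[OF X A] by auto
  have 2: "A \<union> (X - A) = X" using A by auto
  have 3: "I i (X - orbit A) \<le> I i (X - A)" for i
    by (rule I_mono) (use subset_orbit[of A] in auto)
  have "delta UNIV A (X - A) = (\<Sum>i\<in>A. I i (- X) - I i (X - A) + h i / 2)"
    unfolding delta_def 2 by simp
  also have "\<dots> \<le> (\<Sum>i\<in>A. I i (- X) - I i (X - orbit A) + h i / 2)"
    by (intro sum_mono) (simp add: 3)
  also have "\<dots> = delta R (orbit A) (X - orbit A)"
    using delta_orbit[of A "X - orbit A", OF inj inv] by (simp only: 1)
  finally show ?thesis using assms by simp
qed

lemma cube_injective: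
  assumes "int (2 * t) < int N" "i \<in> cube x t" "j \<in> cube x t" "i - j \<in> K"
  shows "i = j"
proof -
  have "i $ n = j $ n" for n
  proof -
    have "\<bar>i $ n - x $ n\<bar> \<le> int t" "\<bar>j $ n - x $ n\<bar> \<le> int t" "int N dvd i $ n - j $ n"
      using assms by (auto simp: cube_def K_def lat_def)
    then show ?thesis
      using zdvd_imp_le[of "int N" "\<bar>i $ n - j $ n\<bar>"] assms(1) by (auto simp: dvd_abs_iff) linarith
  qed
  then show ?thesis by (simp add: vec_eq_iff)
qed

lemma minimal_add:
  assumes "minimal M X" "invar K A" "A \<subseteq> P M" "A \<subseteq> - X"
  shows "0 \<le> delta R A X"
proof -
  have "A \<subseteq> P M - X" using assms(3,4) by blast
  moreover have "\<forall>A. invar K A \<longrightarrow> A \<subseteq> P M - X \<longrightarrow> 0 \<le> delta R A X"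
    using assms(1) unfolding minimal_def by (elim conjE)
  ultimately show ?thesis using assms(2) by (elim allE impE)
qed

text \<open>The bound does not involve \<open>M\<close>, so the upper barrier can later be placed
  out of reach. The sign of a constant cell spreads to a half space because its lattice translates
  cover all sites and \<open>minimal_birkhoff\<close> orders them by height.\<close>

lemma minimal_in_strip:
  assumes D: "pure_radius D" "2 * D < N"
    and X: "minimal M X" and M: "int (2 * D + 3 * \<tau>) * l1 q \<le> M"
  shows "X \<subseteq> P (int (2 * D + 3 * \<tau>) * l1 q)"
proof -
  have inv: "invar K X" "P 0 \<subseteq> X" "X \<subseteq> P M" using X by (auto simp: minimal_def)
  \<comment> \<open>All heights in the cube around \<open>x\<close> lie between
    \<open>3 * \<tau> * l1 q\<close> and \<open>(2 * D + 3 * \<tau>) * l1 q\<close>: strictly above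
    \<open>P 0\<close>, with room below for a shift by \<open>\<tau>\<close> times
    \<open>sgnv q\<close>.\<close>
  define x where "x = int (D + 3 * \<tau>) *s sgnv q"
  have ht_cube: "int (3 * \<tau>) * l1 q \<le> ht q i" "ht q i \<le> int (2 * D + 3 * \<tau>) * l1 q"
    if "i \<in> cube x D" for i
  proof -
    have "\<bar>ht q (i - x)\<bar> \<le> int D * l1 q" using that by (intro abs_ht_le) (auto simp: cube_def)
    then have 1: "\<bar>ht q i - int (D + 3 * \<tau>) * l1 q\<bar> \<le> int D * l1 q"
      by (simp add: x_def ht_sgnv algebra_simps)
    have 2: "int (D + 3 * \<tau>) * l1 q - int D * l1 q = int (3 * \<tau>) * l1 q"
      "int (D + 3 * \<tau>) * l1 q + int D * l1 q = int (2 * D + 3 * \<tau>) * l1 q"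
      by (simp_all add: algebra_simps)
    have 3: "c \<le> y \<and> y \<le> d" if "\<bar>y - a\<bar> \<le> b" "a - b = c" "a + b = d" for y a b c d :: int
      using that by arith
    show "int (3 * \<tau>) * l1 q \<le> ht q i" "ht q i \<le> int (2 * D + 3 * \<tau>) * l1 q"
      by (rule 3[OF 1 2, THEN conjunct1] 3[OF 1 2, THEN conjunct2])+
  qed
  have pos: "0 < int (3 * \<tau>) * l1 q"
    by (rule mult_pos_pos[OF _ l1_pos[OF q_nonzero]]) (use tau_pos in linarith)
  have strip: "cube x D \<subseteq> P M - P 0"
  proof
    fix i assume "i \<in> cube x D"
    then have "ht q i \<le> M" "0 < ht q i"
      by (rule order_trans[OF ht_cube(2) M], rule less_le_trans[OF pos ht_cube(1)])
    then show "i \<in> P M - P 0" unfolding P_def by simp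
  qed
  have inj: "i = j" if "A \<subseteq> cube x D" "i \<in> A" "j \<in> A" "i - j \<in> K" for A i j
    using cube_injective[of D i x j] that D(2) by auto
  have "local_min (cube x D) X"
    unfolding local_min_def
  proof (intro allI impI conjI)
    fix A assume A: "finite A" "A \<subseteq> cube x D"
    have orb: "orbit A \<subseteq> P M - P 0"
      by (rule orbit_subset) (use strip A in \<open>auto intro!: invar_ops invar_P\<close>)
    show "0 \<le> delta UNIV A X" if "A \<inter> X = {}"
    proof (rule local_add[OF inj[OF A(2)] inv(1)])
      have "orbit A \<subseteq> - X" by (rule orbit_subset) (use that inv in \<open>auto intro!: invar_ops\<close>)
      moreover have "orbit A \<subseteq> P M" using orb by blast
      ultimately show "0 \<le> delta R (orbit A) X" by (intro minimal_add[OF X invar_orbit])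
    qed
    show "delta UNIV A (X - A) \<le> 0" if "A \<subseteq> X"
    proof (rule local_remove[OF inj[OF A(2)] inv(1) that])
      have sub: "orbit A \<subseteq> X - P 0" using orb orbit_subset[OF inv(1) that] by auto
      show "delta R (orbit A) (X - orbit A) \<le> 0"
      proof (cases "orbit A = {}")
        case False
        then have "delta R (orbit A) (X - orbit A) < 0"
          using X sub invar_orbit unfolding minimal_def by blast
        then show ?thesis by simp
      qed (simp add: delta_def)
    qed
  qed
  then obtain c where c: "cell \<tau> c \<subseteq> cube x D" "cell \<tau> c \<subseteq> X \<or> cell \<tau> c \<inter> X = {}"
    using D(1) unfolding pure_radius_def by blast
  have up: "i - k \<in> X" if "i \<in> X" "k \<in> lat \<tau>" "0 \<le> ht q k" for i k
    using minimal_birkhoff[OF X that(2,3)] that(1) by auto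
  from c(2) show ?thesis
  proof
    assume plus: "cell \<tau> c \<subseteq> X"
    \<comment> \<open>A site below the cube is no higher than its representative in the plus cell,
      so monotonicity carries the plus sign down to it.\<close>
    have "P (int (3 * \<tau>) * l1 q) \<subseteq> X"
    proof
      fix i assume i: "i \<in> P (int (3 * \<tau>) * l1 q)"
      obtain k where k: "k \<in> lat \<tau>" "i - k \<in> cell \<tau> c" using cell_lat[OF tau_pos] by blast
      then have "int (3 * \<tau>) * l1 q \<le> ht q (i - k)" using ht_cube c(1) by blast
      moreover have "ht q i \<le> int (3 * \<tau>) * l1 q" using i by (simp only: P_def mem_Collect_eq)
      ultimately have "ht q i \<le> ht q (i - k)" by (rule order_trans[rotated])
      then have "0 \<le> ht q (- k)" by simp
      moreover have "i - k \<in> X" using k(2) plus by blast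
      ultimately have "i - k - (- k) \<in> X"
        by (intro up[OF _ subgrp_closed(3)[OF lat_subgrp k(1)]])
      then show "i \<in> X" by simp
    qed
    moreover define k where "k = int \<tau> *s sgnv q"
    have ht_k: "ht q k = int \<tau> * l1 q" by (simp only: k_def ht_linear ht_sgnv)
    have "int \<tau> * l1 q \<le> int (3 * \<tau>) * l1 q"
      by (rule mult_right_mono) (use l1_pos[OF q_nonzero] in auto)
    then have "P (ht q k) \<subseteq> P (int (3 * \<tau>) * l1 q)"
      unfolding P_def ht_k by (intro Collect_mono impI) (rule order_trans)
    ultimately have "P (ht q k) \<subseteq> X" by (rule order_trans[rotated])
    moreover have "k \<in> lat \<tau>" by (simp add: lat_def k_def)
    moreover have "0 < ht q k" unfolding ht_k
      by (rule mult_pos_pos[OF _ l1_pos[OF q_nonzero]]) (use tau_pos in linarith)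
    ultimately show ?thesis using minimal_not_above_translate[OF X] by blast
  next
    assume minus: "cell \<tau> c \<inter> X = {}"
    show ?thesis
    proof
      fix i assume i: "i \<in> X"
      obtain k where k: "k \<in> lat \<tau>" "i - k \<in> cell \<tau> c" using cell_lat[OF tau_pos] by blast
      then have 1: "ht q (i - k) \<le> int (2 * D + 3 * \<tau>) * l1 q" using ht_cube c(1) by blast
      have "\<not> 0 \<le> ht q k" using up[OF i k(1)] k(2) minus by blast
      then have "ht q i \<le> ht q (i - k)" by simp
      then show "i \<in> P (int (2 * D + 3 * \<tau>) * l1 q)" using 1 unfolding P_def mem_Collect_eq by (rule order_trans)
    qed
  qed
qed

end

context spin_model
begin

lemma planelike_integer_direction:
  fixes q :: "int^'a"
  assumes D: "pure_radius D" and q: "q \<noteq> 0"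
  shows "\<exists>X. (\<forall>i. ht q i \<le> 0 \<longrightarrow> i \<in> X) \<and>
    (\<forall>i\<in>X. ht q i \<le> int (2 * D + 3 * \<tau>) * l1 q) \<and> local_min (cube 0 n) X"
proof -
  \<comment> \<open>A multiple of \<open>\<tau>\<close> larger than twice either radius, so that the
    cubes of radius \<open>D\<close> and \<open>n\<close> both inject modulo
    \<open>K\<close>.\<close>
  define N where "N = \<tau> * (2 * D + 2 * n + 1)"
  interpret periodic J h \<tau> q N
    by unfold_locales (use q tau_pos in \<open>auto simp: N_def\<close>)
  have "1 * (2 * D + 2 * n + 1) \<le> N" unfolding N_def by (rule mult_right_mono) (use tau_pos in auto)
  then have N: "2 * D < N" "2 * n < N" by auto
  \<comment> \<open>The factor \<open>n + 1\<close> makes the rise of \<open>k\<close> exceed every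
    height in \<open>cube 0 n\<close>, so the lowered barrier \<open>P (- ht q k)\<close> misses
    that cube.\<close>
  define k where "k = int ((n + 1) * \<tau>) *s sgnv q"
  have k_lat: "k \<in> lat \<tau>" by (auto simp: k_def lat_def)
  have ht_k: "ht q k = int ((n + 1) * \<tau>) * l1 q" by (simp only: k_def ht_sgnv ht_linear)
  have "int n * l1 q < int ((n + 1) * \<tau>) * l1 q"
  proof (rule mult_strict_right_mono)
    have "n < (n + 1) * 1" by simp
    also have "\<dots> \<le> (n + 1) * \<tau>" by (rule mult_left_mono) (use tau_pos in auto)
    finally show "int n < int ((n + 1) * \<tau>)" by (simp only: of_nat_less_iff)
  qed (rule l1_pos[OF q])
  then have n_k: "int n * l1 q < ht q k" by (simp only: ht_k)
  moreover have "0 \<le> int n * l1 q" using l1_pos[OF q] by simp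
  ultimately have k_pos: "0 < ht q k" by linarith
  define W where "W = int (2 * D + 3 * \<tau>) * l1 q"
  have W: "0 \<le> W" using l1_pos[OF q] by (simp add: W_def)
  \<comment> \<open>\<open>M\<close> leaves room above the strip for the test cube and for the
    shift: \<open>P (M - ht q k)\<close> still contains both, as \<open>minimal_removal\<close>
    requires.\<close>
  define M where "M = W + int n * l1 q + ht q k"
  have MW: "W \<le> M - ht q k" "int n * l1 q \<le> M - ht q k" using W \<open>0 \<le> int n * l1 q\<close>
    by (auto simp: M_def)
  obtain X where X: "minimal M X" using minimal_exists[of M] MW W k_pos by auto
  have inv: "invar K X" "P 0 \<subseteq> X" "X \<subseteq> P M" using X by (auto simp: minimal_def)
  have XW: "X \<subseteq> P W"
    unfolding W_def by (rule minimal_in_strip[OF D N(1) X]) (use MW k_pos in \<open>simp add: W_def\<close>)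
  have strip: "cube 0 n \<subseteq> P (M - ht q k) - P (- ht q k)"
  proof
    fix i :: "int^'a" assume "i \<in> cube 0 n"
    then have "\<bar>ht q i\<bar> \<le> int n * l1 q" by (intro abs_ht_le) (auto simp: cube_def)
    then show "i \<in> P (M - ht q k) - P (- ht q k)" using MW n_k by (auto simp: P_def)
  qed
  have inj: "i = j" if "A \<subseteq> cube 0 n" "i \<in> A" "j \<in> A" "i - j \<in> K" for A i j
  proof (rule cube_injective[OF _ _ _ that(4)])
    show "int (2 * n) < int N" using N(2) by (simp only: of_nat_less_iff)
    show "i \<in> cube 0 n" by (rule subsetD[OF that(1,2)])
    show "j \<in> cube 0 n" by (rule subsetD[OF that(1,3)])
  qed
  have "local_min (cube 0 n) X"
    unfolding local_min_def
  proof (intro allI impI conjI)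
    fix A :: "(int^'a) set" assume A: "finite A" "A \<subseteq> cube 0 n"
    have orb: "orbit A \<subseteq> P (M - ht q k) - P (- ht q k)"
      by (rule orbit_subset) (use strip A in \<open>auto intro!: invar_ops invar_P\<close>)
    show "0 \<le> delta UNIV A X" if "A \<inter> X = {}"
    proof (rule local_add[OF inj[OF A(2)] inv(1)])
      have "orbit A \<subseteq> - X" by (rule orbit_subset) (use that inv in \<open>auto intro!: invar_ops\<close>)
      moreover have "P (M - ht q k) \<subseteq> P M" using k_pos by (auto simp: P_def)
      then have "orbit A \<subseteq> P M" using orb by blast
      ultimately show "0 \<le> delta R (orbit A) X" by (intro minimal_add[OF X invar_orbit])
    qed
    show "delta UNIV A (X - A) \<le> 0" if "A \<subseteq> X"
    proof -
      have "P W \<subseteq> P (M - ht q k)" using MW(1) by (auto simp: P_def)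
      then have "X \<subseteq> P (M - ht q k)" using XW by blast
      moreover have "orbit A \<subseteq> X" by (rule orbit_subset[OF inv(1) that])
      moreover have "orbit A \<inter> P (- ht q k) = {}" using orb by blast
      ultimately have rem: "delta R (orbit A) (X - orbit A) \<le> 0"
        by (intro minimal_removal[OF X k_lat k_pos _ invar_orbit])
      show ?thesis by (rule local_remove[OF _ inv(1) that rem]) (rule inj[OF A(2)])
    qed
  qed
  moreover have "\<forall>i. ht q i \<le> 0 \<longrightarrow> i \<in> X"
    using subsetD[OF inv(2)] unfolding P_def mem_Collect_eq by blast
  moreover have "\<forall>i\<in>X. ht q i \<le> W"
    using subsetD[OF XW] unfolding P_def mem_Collect_eq by (intro ballI)
  ultimately show ?thesis unfolding W_def by (intro exI[of _ X] conjI)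
qed

end

section \<open>Limits of local minimizers and ground states\<close>

text \<open>Diagonal extraction: along the subsequence chosen at stage \<open>m\<close>, membership
  of the \<open>m\<close>-th element is constant.\<close>

lemma convergent_subsequence_of_sets:
  fixes X :: "nat \<Rightarrow> 'b::countable set"
  shows "\<exists>r Y. strict_mono r \<and> (\<forall>x. \<forall>\<^sub>F n in sequentially. x \<in> X (r n) \<longleftrightarrow> x \<in> Y)"
proof -
  define Q where "Q m s \<longleftrightarrow> (\<forall>k. from_nat m \<in> X (s k)) \<or> (\<forall>k. from_nat m \<notin> X (s k))"
    for m and s :: "nat \<Rightarrow> nat"
  interpret subseqs Q
  proof
    fix m and s :: "nat \<Rightarrow> nat" assume "strict_mono s"
    show "\<exists>r. strict_mono r \<and> Q m (s \<circ> r)"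
    proof (cases "infinite {k. from_nat m \<in> X (s k)}")
      case True
      then obtain r :: "nat \<Rightarrow> nat" where "strict_mono r" "\<And>k. r k \<in> {k. from_nat m \<in> X (s k)}"
        using infinite_enumerate by blast
      then show ?thesis by (intro exI[of _ r]) (auto simp: Q_def)
    next
      case False
      then have "infinite (UNIV - {k. from_nat m \<in> X (s k)})" by (intro Diff_infinite_finite) auto
      then obtain r :: "nat \<Rightarrow> nat" where "strict_mono r" "\<And>k. r k \<in> UNIV - {k. from_nat m \<in> X (s k)}"
        using infinite_enumerate by blast
      then show ?thesis by (intro exI[of _ r]) (auto simp: Q_def)
    qed
  qed
  have tail: "Q m (diagseq \<circ> ((+) (Suc m)))" for m
    by (rule diagseq_holds) (auto simp: Q_def)
  define Y where "Y = {x. x \<in> X (diagseq (Suc (to_nat x)))}"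
  have "x \<in> X (diagseq n) \<longleftrightarrow> x \<in> Y" if "n \<ge> Suc (to_nat x)" for x n
  proof -
    obtain k where n: "n = Suc (to_nat x) + k" using \<open>n \<ge> Suc (to_nat x)\<close> le_Suc_ex by blast
    have "(\<forall>k. x \<in> X (diagseq (Suc (to_nat x) + k))) \<or> (\<forall>k. x \<notin> X (diagseq (Suc (to_nat x) + k)))"
      using tail[of "to_nat x"] by (simp only: Q_def o_apply from_nat_to_nat)
    then have "x \<in> X (diagseq (Suc (to_nat x) + k)) \<longleftrightarrow> x \<in> X (diagseq (Suc (to_nat x) + 0))"
      by (elim disjE) (simp_all only:)
    then show ?thesis by (simp add: n Y_def)
  qed
  then have "\<forall>\<^sub>F n in sequentially. x \<in> X (diagseq n) \<longleftrightarrow> x \<in> Y" for x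
    by (intro eventually_sequentiallyI[of "Suc (to_nat x)"])
  then show ?thesis using subseq_diagseq by blast
qed

context interaction
begin

lemma I_split: "I i B = I i (B \<inter> F) + I i (B - F)"
proof -
  have "I i ((B \<inter> F) \<union> (B - F)) = I i (B \<inter> F) + I i (B - F)" by (rule I_Un) auto
  moreover have "(B \<inter> F) \<union> (B - F) = B" by auto
  ultimately show ?thesis by (simp only:)
qed

lemma I_tail:
  assumes "0 < e"
  shows "\<exists>F. finite F \<and> I i (- F) \<le> e"
proof -
  have "(J i has_sum I i UNIV) UNIV"
    unfolding I_def by (rule has_sum_infsum) (rule J_summable)
  then obtain F where F: "finite F" "dist (sum (J i) F) (I i UNIV) \<le> e"
    using has_sum_finite_approximation[OF _ assms] by blast
  have "I i UNIV = I i F + I i (- F)" using I_split[of i UNIV F] by (simp add: Compl_eq_Diff_UNIV)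
  moreover have "I i F = sum (J i) F" using F(1) by (simp add: I_def)
  ultimately show ?thesis using F by (intro exI[of _ F]) (auto simp: dist_real_def)
qed

lemma I_close:
  assumes "B \<inter> F = C \<inter> F" "I i (- F) \<le> e"
  shows "I i B \<le> I i C + e"
proof -
  have "I i (B - F) \<le> I i (- F)" by (rule I_mono) auto
  then show ?thesis using I_split[of i B F] I_split[of i C F] I_nonneg[of i "C - F"] assms by simp
qed

text \<open>Continuity of the cost in the background: a change outside \<open>F\<close> alters each
  of the two fluxes of a site of \<open>A\<close> by at most \<open>e\<close>, hence the factor
  2.\<close>

lemma delta_close:
  assumes "B \<inter> F = C \<inter> F" and tail: "\<And>i. i \<in> A \<Longrightarrow> I i (- F) \<le> e"
  shows "delta UNIV A B \<le> delta UNIV A C + 2 * e * real (card A)"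
proof -
  have "delta UNIV A B \<le> (\<Sum>i\<in>A. (I i (- (A \<union> C)) - I i C + h i / 2) + 2 * e)"
    unfolding delta_def Int_UNIV_right
  proof (rule sum_mono)
    fix i assume i: "i \<in> A"
    have "(- (A \<union> B)) \<inter> F = (- (A \<union> C)) \<inter> F" using assms(1) by auto
    then have "I i (- (A \<union> B)) \<le> I i (- (A \<union> C)) + e" by (rule I_close) (rule tail[OF i])
    moreover have "I i C \<le> I i B + e" by (rule I_close[OF assms(1)[symmetric]]) (rule tail[OF i])
    ultimately show "I i (- (A \<union> B)) - I i B + h i / 2 \<le> I i (- (A \<union> C)) - I i C + h i / 2 + 2 * e"
      by simp
  qed
  then show ?thesis by (simp add: delta_def sum.distrib mult.commute)
qed

lemma has_sum_pairs:
  assumes "finite U"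
  shows "((\<lambda>(i, j). J i j) has_sum (\<Sum>i\<in>U. I i (V i))) (Sigma U V)"
proof -
  have "((\<lambda>(i, j). J i j) has_sum I i (V i)) (Pair i ` V i)" for i
    unfolding I_def by (subst has_sum_reindex) (auto simp: inj_on_def o_def summ)
  then have "((\<lambda>(i, j). J i j) has_sum (\<Sum>i\<in>U. I i (V i))) (\<Union>i\<in>U. Pair i ` V i)"
    using assms by (intro sum_has_sum) auto
  also have "(\<Union>i\<in>U. Pair i ` V i) = Sigma U V" by auto
  finally show ?thesis .
qed

lemma has_sum_swap:
  assumes "((\<lambda>(i, j). J i j) has_sum a) S"
  shows "((\<lambda>(i, j). J i j) has_sum a) (prod.swap ` S)"
proof -
  have "(\<lambda>(i, j). J i j) \<circ> prod.swap = (\<lambda>(i, j). J i j)" using J_sym by auto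
  then show ?thesis using assms by (subst has_sum_reindex) auto
qed

end

section \<open>Local minimality, the Hamiltonian and ground states\<close>

definition spin :: "'b set \<Rightarrow> 'b \<Rightarrow> int" where
  "spin X i = (if i \<in> X then 1 else - 1)"

context spin_model
begin

lemma delta_Un_local:
  assumes "finite A" "finite C" "A \<inter> C = {}" "A \<inter> B = {}" "C \<inter> B = {}"
  shows "delta UNIV (A \<union> C) B = delta UNIV A B + delta UNIV C (B \<union> A)"
  by (rule delta_Un[of "{0}"]) (use assms in \<open>auto simp: subgrp_def lat_def transv_def invar_def\<close>)

lemma delta_translate_local:
  assumes "k \<in> lat \<tau>"
  shows "delta UNIV (translate k A) (translate k B) = delta UNIV A B"
  by (rule delta_translate[of "{0}"]) (use assms in \<open>auto simp: subgrp_def lat_def transv_def invar_def\<close>)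

lemma local_min_translate:
  assumes "local_min UNIV X" "k \<in> lat \<tau>"
  shows "local_min UNIV (translate k X)"
  unfolding local_min_def
proof (intro allI impI conjI)
  fix A assume "finite A" "A \<subseteq> (UNIV::(int^'a) set)"
  define C where "C = translate (- k) A"
  have C: "finite C" using \<open>finite A\<close> by (simp add: C_def translate_eq_image)
  have A: "A = translate k C" by (auto simp: C_def)
  show "0 \<le> delta UNIV A (translate k X)" if "A \<inter> translate k X = {}"
  proof -
    have "C \<inter> X = {}" using that by (auto simp: C_def disjoint_iff)
    then show ?thesis unfolding A delta_translate_local[OF assms(2)]
      using assms(1) C by (auto simp: local_min_def)
  qed
  show "delta UNIV A (translate k X - A) \<le> 0" if "A \<subseteq> translate k X"
  proof -
    have "C \<subseteq> X" using that by (auto simp: C_def)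
    then show ?thesis unfolding A translate_ops(3)[symmetric] delta_translate_local[OF assms(2)]
      using assms(1) C by (auto simp: local_min_def)
  qed
qed

text \<open>All terms besides \<open>delta\<close> depend only on \<open>\<Gamma>\<close> and
  \<open>X - \<Gamma>\<close>, so competitors in \<open>\<Gamma>\<close> are ranked by
  \<open>delta\<close> alone. The factor 4 arises since a disagreeing pair has weight
  \<open>2 * J\<close> and occurs in both orders.\<close>

lemma Ham_spin:
  assumes "finite \<Gamma>"
  shows "Ham J h \<Gamma> (spin X) =
    4 * delta UNIV (X \<inter> \<Gamma>) (X - \<Gamma>) + 4 * (\<Sum>i\<in>\<Gamma>. I i (X - \<Gamma>)) - sum h \<Gamma>"
proof -
  let ?J = "\<lambda>(i, j). J i j"
  define a where "a = (\<Sum>i\<in>X \<inter> \<Gamma>. I i (- X))"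
  define b where "b = (\<Sum>i\<in>\<Gamma> - X. I i (X - \<Gamma>))"
  \<comment> \<open>The disagreeing pairs that meet \<open>\<Gamma>\<close>, written with the plus
    site first; \<open>prod.swap\<close> supplies the opposite order.\<close>
  define T where "T = (SIGMA i:X \<inter> \<Gamma>. - X) \<union> prod.swap ` (SIGMA i:\<Gamma> - X. X - \<Gamma>)"
  have T: "(?J has_sum (a + b)) T"
    unfolding T_def a_def b_def
    by (intro has_sum_Un_disjoint has_sum_swap has_sum_pairs) (use assms in auto)
  have T_eq: "T = {p. fst p \<in> X \<and> snd p \<notin> X \<and> (fst p \<in> \<Gamma> \<or> snd p \<in> \<Gamma>)}"
    by (auto simp: T_def image_iff)
  have "p \<in> prod.swap ` T \<longleftrightarrow> prod.swap p \<in> T" for p by force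
  then have T_swap: "prod.swap ` T = {p. snd p \<in> X \<and> fst p \<notin> X \<and> (fst p \<in> \<Gamma> \<or> snd p \<in> \<Gamma>)}"
    by (auto simp: T_eq)
  have "T \<inter> prod.swap ` T = {}" unfolding T_swap T_eq by auto
  then have "(?J has_sum (a + b + (a + b))) (T \<union> prod.swap ` T)"
    by (intro has_sum_Un_disjoint T has_sum_swap)
  then have "((\<lambda>p. 2 * ?J p) has_sum (2 * (a + b + (a + b)))) (T \<union> prod.swap ` T)"
    by (rule has_sum_cmult_right)
  also have "?this \<longleftrightarrow> ((\<lambda>(i, j). J i j * (1 - of_int (spin X i * spin X j))) has_sum (2 * (a + b + (a + b))))
      {p. fst p \<in> \<Gamma> \<or> snd p \<in> \<Gamma>}"
    unfolding T_swap unfolding T_eq by (rule has_sum_cong_neutral) (auto simp: spin_def)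
  finally have "infsum (\<lambda>(i, j). J i j * (1 - of_int (spin X i * spin X j))) {p. fst p \<in> \<Gamma> \<or> snd p \<in> \<Gamma>}
      = 4 * a + 4 * b"
    by (simp add: infsumI)
  moreover have split: "(\<Sum>i\<in>\<Gamma>. f i) = (\<Sum>i\<in>X \<inter> \<Gamma>. f i) + (\<Sum>i\<in>\<Gamma> - X. f i)" for f :: "int^'a \<Rightarrow> real"
    using sum.Int_Diff[OF assms, of f X] by (simp add: Int_commute)
  have "(\<Sum>i\<in>\<Gamma>. h i * of_int (spin X i)) = 2 * sum h (X \<inter> \<Gamma>) - sum h \<Gamma>"
    unfolding split by (simp add: spin_def sum_negf)
  moreover have "delta UNIV (X \<inter> \<Gamma>) (X - \<Gamma>) = a - (\<Sum>i\<in>X \<inter> \<Gamma>. I i (X - \<Gamma>)) + sum h (X \<inter> \<Gamma>) / 2"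
  proof -
    have "X \<inter> \<Gamma> \<union> (X - \<Gamma>) = X" by auto
    then show ?thesis
      by (simp add: delta_def a_def sum.distrib sum_subtractf sum_divide_distrib)
  qed
  moreover have "(\<Sum>i\<in>\<Gamma>. I i (X - \<Gamma>)) = (\<Sum>i\<in>X \<inter> \<Gamma>. I i (X - \<Gamma>)) + b"
    unfolding b_def by (rule split)
  ultimately show ?thesis unfolding Ham_def by simp
qed

text \<open>A competitor adds some \<open>A\<close> and removes some \<open>B\<close>. Built up from
  the common part, the two energies differ by the costs of \<open>A\<close> and of \<open>B\<close>
  over \<open>X - B\<close>. The latter is at most zero; the former is at least the cost of
  \<open>A\<close> over \<open>X\<close>, by submodularity, hence nonnegative.\<close>

lemma ground_state_spin:
  assumes "local_min UNIV X"
  shows "ground_state J h (spin X)"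
  unfolding ground_state_def minimizer_in_def
proof (intro conjI allI impI)
  show "config (spin X)" by (simp add: config_def spin_def)
  fix \<Gamma> v assume \<Gamma>: "finite \<Gamma>" and v: "config v" "\<forall>i. i \<notin> \<Gamma> \<longrightarrow> v i = spin X i"
  define V where "V = {i. v i = 1}"
  have vV: "v = spin V" using v(1) by (intro ext) (auto simp: V_def spin_def config_def)
  have out: "V - \<Gamma> = X - \<Gamma>" using v(2) by (auto simp: V_def spin_def split: if_splits)
  define Z C A B where "Z = X - \<Gamma>" and "C = V \<inter> X \<inter> \<Gamma>" and "A = V \<inter> \<Gamma> - X" and "B = X \<inter> \<Gamma> - V"
  have fin: "finite C" "finite A" "finite B" using \<Gamma> by (auto simp: C_def A_def B_def)
  have eqs: "V \<inter> \<Gamma> = C \<union> A" "X \<inter> \<Gamma> = C \<union> B" "Z \<union> C = X - B"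
    using out by (auto simp: Z_def C_def A_def B_def)
  have "delta UNIV (V \<inter> \<Gamma>) Z = delta UNIV C Z + delta UNIV A (X - B)"
    unfolding eqs(1) eqs(3)[symmetric]
    by (rule delta_Un_local) (use fin in \<open>auto simp: Z_def C_def A_def\<close>)
  moreover have "delta UNIV (X \<inter> \<Gamma>) Z = delta UNIV C Z + delta UNIV B (X - B)"
    unfolding eqs(2) eqs(3)[symmetric]
    by (rule delta_Un_local) (use fin in \<open>auto simp: Z_def C_def B_def\<close>)
  moreover have "delta UNIV A X \<le> delta UNIV A (X - B)" by (rule delta_antimono) auto
  moreover have "0 \<le> delta UNIV A X" "delta UNIV B (X - B) \<le> 0"
    using assms fin by (auto simp: local_min_def A_def B_def)
  ultimately have "delta UNIV (X \<inter> \<Gamma>) Z \<le> delta UNIV (V \<inter> \<Gamma>) Z" by linarith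
  then show "Ham J h \<Gamma> (spin X) \<le> Ham J h \<Gamma> v"
    unfolding vV Ham_spin[OF \<Gamma>] out Z_def by simp
qed

text \<open>For fixed \<open>A\<close> the costs depend, up to \<open>e\<close>, on the background
  in a finite set only. Agreement with a local minimizer there transfers both inequalities, and
  \<open>e\<close> is arbitrary.\<close>

lemma local_min_limit:
  assumes approx: "\<And>F n. finite F \<Longrightarrow> \<exists>X'. X' \<inter> F = X \<inter> F \<and> local_min (cube 0 n) X'"
  shows "local_min UNIV X"
  unfolding local_min_def
proof (intro allI impI)
  fix A :: "(int^'a) set" assume A: "finite A"
  obtain n where n: "A \<subseteq> cube 0 n"
  proof -
    have "i \<in> cube 0 (nat (\<Sum>i\<in>A. l1 i))" if "i \<in> A" for i
    proof -
      have "\<bar>i $ k\<bar> \<le> l1 i" for k unfolding l1_def by (rule member_le_sum) auto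
      moreover have "l1 i \<le> (\<Sum>i\<in>A. l1 i)"
        by (rule member_le_sum) (use A that in \<open>auto simp: l1_def intro!: sum_nonneg\<close>)
      ultimately have le: "\<bar>i $ k\<bar> \<le> (\<Sum>i\<in>A. l1 i)" for k by (rule order_trans)
      have "0 \<le> (\<Sum>i\<in>A. l1 i)" by (auto simp: l1_def intro!: sum_nonneg)
      then show ?thesis unfolding cube_def using le by simp
    qed
    then show thesis using that by blast
  qed
  have main: "\<exists>X'. local_min (cube 0 n) X' \<and> X' \<inter> A = X \<inter> A \<and>
      delta UNIV A X' \<le> delta UNIV A X + e \<and> delta UNIV A (X - A) \<le> delta UNIV A (X' - A) + e"
    if "0 < e" for e
  proof -
    define e' where "e' = e / (2 * (real (card A) + 1))"
    have e': "0 < e'" using that by (simp add: e'_def)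
    have "2 * e' * real (card A) \<le> 2 * e' * (real (card A) + 1)" using e' by simp
    also have "\<dots> = e" by (simp add: e'_def field_simps)
    finally have le: "2 * e' * real (card A) \<le> e" .
    obtain F0 where F0: "\<And>i. finite (F0 i)" "\<And>i. I i (- F0 i) \<le> e'" using I_tail[OF e'] by metis
    define F where "F = A \<union> (\<Union>i\<in>A. F0 i)"
    have F: "finite F" using A F0 by (auto simp: F_def)
    have tail: "I i (- F) \<le> e'" if "i \<in> A" for i
      using I_mono[of "- F" "- F0 i" i] F0(2)[of i] that by (force simp: F_def)
    obtain X' where X': "X' \<inter> F = X \<inter> F" "local_min (cube 0 n) X'" using approx[OF F] by blast
    have "(X - A) \<inter> F = (X' - A) \<inter> F" using X'(1) by auto
    then have "delta UNIV A X' \<le> delta UNIV A X + e" "delta UNIV A (X - A) \<le> delta UNIV A (X' - A) + e"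
      using delta_close[OF X'(1) tail] delta_close[of "X - A" F "X' - A", OF _ tail] le by fastforce+
    moreover have "X' \<inter> A = X \<inter> A" using X'(1) by (auto simp: F_def)
    ultimately show ?thesis using X'(2) by blast
  qed
  show "(A \<inter> X = {} \<longrightarrow> 0 \<le> delta UNIV A X) \<and> (A \<subseteq> X \<longrightarrow> delta UNIV A (X - A) \<le> 0)"
  proof (intro conjI impI)
    assume dis: "A \<inter> X = {}"
    show "0 \<le> delta UNIV A X"
    proof (rule field_le_epsilon)
      fix e :: real assume "0 < e"
      then obtain X' where X': "local_min (cube 0 n) X'" "X' \<inter> A = X \<inter> A" "delta UNIV A X' \<le> delta UNIV A X + e"
        using main by blast
      then have "0 \<le> delta UNIV A X'" using A n dis by (auto simp: local_min_def)
      then show "0 \<le> delta UNIV A X + e" using X' by linarith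
    qed
  next
    assume sub: "A \<subseteq> X"
    show "delta UNIV A (X - A) \<le> 0"
    proof (rule field_le_epsilon)
      fix e :: real assume "0 < e"
      then obtain X' where X': "local_min (cube 0 n) X'" "X' \<inter> A = X \<inter> A"
        "delta UNIV A (X - A) \<le> delta UNIV A (X' - A) + e"
        using main by blast
      then have "delta UNIV A (X' - A) \<le> 0" using A n sub by (auto simp: local_min_def)
      then show "delta UNIV A (X - A) \<le> 0 + e" using X' by linarith
    qed
  qed
qed

end

section \<open>Approximating a real direction by integer directions\<close>

lemma floor_multiple_tendsto: "(\<lambda>n. real_of_int \<lfloor>real n * x\<rfloor> / real n) \<longlonglongrightarrow> x"
proof (rule tendsto_sandwich)
  show "\<forall>\<^sub>F n in sequentially. x - 1 / real n \<le> real_of_int \<lfloor>real n * x\<rfloor> / real n"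
  proof (rule eventually_sequentiallyI[of 1])
    fix n :: nat assume n: "1 \<le> n"
    have "real n * x - 1 \<le> real_of_int \<lfloor>real n * x\<rfloor>" by linarith
    then have "(real n * x - 1) / real n \<le> real_of_int \<lfloor>real n * x\<rfloor> / real n"
      by (rule divide_right_mono) simp
    moreover have "(real n * x - 1) / real n = x - 1 / real n" using n by (simp add: field_simps)
    ultimately show "x - 1 / real n \<le> real_of_int \<lfloor>real n * x\<rfloor> / real n" by simp
  qed
  show "\<forall>\<^sub>F n in sequentially. real_of_int \<lfloor>real n * x\<rfloor> / real n \<le> x"
  proof (rule eventually_sequentiallyI[of 1])
    fix n :: nat assume n: "1 \<le> n"
    have "real_of_int \<lfloor>real n * x\<rfloor> / real n \<le> (real n * x) / real n"
      by (rule divide_right_mono) auto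
    then show "real_of_int \<lfloor>real n * x\<rfloor> / real n \<le> x" using n by simp
  qed
  have "(\<lambda>n. x - 1 / real n) \<longlonglongrightarrow> x - 0"
    by (intro tendsto_diff tendsto_const lim_const_over_n)
  then show "(\<lambda>n. x - 1 / real n) \<longlonglongrightarrow> x" by simp
qed simp

text \<open>Divided by \<open>n\<close>, the heights and the norm of this vector converge to those
  of \<open>w\<close>. The strip condition compares heights with \<open>l1\<close>, so it survives
  the limit.\<close>

definition int_approx :: "real^'d \<Rightarrow> nat \<Rightarrow> int^'d" where
  "int_approx w n = (\<chi> k. \<lfloor>real n * w $ k\<rfloor>)"

lemma ht_int_approx: "(\<lambda>n. real_of_int (ht (int_approx w n) i) / real n) \<longlonglongrightarrow> dotp w i"
proof -
  have "(\<lambda>n. \<Sum>k\<in>UNIV. real_of_int \<lfloor>real n * w $ k\<rfloor> / real n * real_of_int (i $ k)) \<longlonglongrightarrow> dotp w i"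
    unfolding dotp_def by (intro tendsto_sum tendsto_mult floor_multiple_tendsto tendsto_const)
  moreover have "(\<Sum>k\<in>UNIV. real_of_int \<lfloor>real n * w $ k\<rfloor> / real n * real_of_int (i $ k)) =
      real_of_int (ht (int_approx w n) i) / real n" for n
    by (simp add: ht_def int_approx_def sum_divide_distrib)
  ultimately show ?thesis by simp
qed

lemma l1_int_approx: "(\<lambda>n. real_of_int (l1 (int_approx w n)) / real n) \<longlonglongrightarrow> rl1 w"
proof -
  have "(\<lambda>n. \<Sum>k\<in>UNIV. \<bar>real_of_int \<lfloor>real n * w $ k\<rfloor> / real n\<bar>) \<longlonglongrightarrow> rl1 w"
    unfolding rl1_def by (intro tendsto_sum tendsto_rabs floor_multiple_tendsto)
  moreover have "(\<Sum>k\<in>UNIV. \<bar>real_of_int \<lfloor>real n * w $ k\<rfloor> / real n\<bar>) =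
      real_of_int (l1 (int_approx w n)) / real n" for n
    by (simp add: l1_def int_approx_def sum_divide_distrib abs_divide)
  ultimately show ?thesis by simp
qed

lemma rl1_pos: "w \<noteq> 0 \<Longrightarrow> 0 < rl1 w"
proof -
  assume "w \<noteq> 0"
  then obtain n where "w $ n \<noteq> 0" by (auto simp: vec_eq_iff)
  then show ?thesis unfolding rl1_def by (intro sum_pos2[of UNIV n]) auto
qed

lemma dotp_diff: "dotp w (i - j) = dotp w i - dotp w j"
  by (simp add: dotp_def algebra_simps sum_subtractf)

lemma abs_dotp_le: "\<bar>dotp w i\<bar> \<le> rl1 w * real_of_int (l1 i)"
proof -
  have "\<bar>dotp w i\<bar> \<le> (\<Sum>k\<in>UNIV. \<bar>w $ k * real_of_int (i $ k)\<bar>)" unfolding dotp_def by (rule sum_abs)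
  also have "\<dots> \<le> (\<Sum>k\<in>UNIV. \<bar>w $ k\<bar> * real_of_int (l1 i))"
  proof (rule sum_mono)
    fix k
    have "\<bar>i $ k\<bar> \<le> l1 i" unfolding l1_def by (rule member_le_sum) auto
    then have "\<bar>real_of_int (i $ k)\<bar> \<le> real_of_int (l1 i)" by linarith
    then show "\<bar>w $ k * real_of_int (i $ k)\<bar> \<le> \<bar>w $ k\<bar> * real_of_int (l1 i)"
      unfolding abs_mult by (rule mult_left_mono) simp
  qed
  also have "\<dots> = rl1 w * real_of_int (l1 i)" by (simp add: rl1_def sum_distrib_right)
  finally show ?thesis .
qed

definition sgnw :: "real^'d \<Rightarrow> int^'d" where
  "sgnw w = (\<chi> k. if w $ k < 0 then - 1 else 1)"

lemma dotp_sgnw: "dotp w (m *s sgnw w) = real_of_int m * rl1 w"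
  by (auto simp: dotp_def sgnw_def rl1_def sum_distrib_left intro!: sum.cong)

context spin_model
begin

lemma local_min_subset: "local_min T X \<Longrightarrow> S \<subseteq> T \<Longrightarrow> local_min S X"
  unfolding local_min_def by (meson order_trans)

text \<open>Only a strict inequality for \<open>w\<close> forces the corresponding one for the
  approximating directions, so the limit controls open half spaces. The closed ones are recovered in
  \<open>planelike_exists\<close> by a translation.\<close>

lemma local_min_direction:
  fixes w :: "real^'a"
  assumes D: "pure_radius D" and w: "w \<noteq> 0"
  shows "\<exists>X. local_min UNIV X \<and> (\<forall>i. dotp w i < 0 \<longrightarrow> i \<in> X) \<and>
    (\<forall>i. real (2 * D + 3 * \<tau>) * rl1 w < dotp w i \<longrightarrow> i \<notin> X)"
proof -
  define q where "q = int_approx w"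
  have "\<forall>\<^sub>F n in sequentially. 0 < real_of_int (l1 (q n)) / real n"
    unfolding q_def by (rule order_tendstoD(1)[OF l1_int_approx rl1_pos[OF w]])
  then obtain n0 where n0: "\<And>n. n \<ge> n0 \<Longrightarrow> 0 < real_of_int (l1 (q n)) / real n"
    by (auto simp: eventually_sequentially)
  have q_nz: "q n \<noteq> 0" if "n \<ge> n0" for n
    using n0[OF that] by (auto simp: l1_def)
  have "\<exists>X. (\<forall>i. ht (q (n + n0)) i \<le> 0 \<longrightarrow> i \<in> X) \<and>
    (\<forall>i\<in>X. ht (q (n + n0)) i \<le> int (2 * D + 3 * \<tau>) * l1 (q (n + n0))) \<and> local_min (cube 0 n) X" for n
    by (rule planelike_integer_direction[OF D q_nz]) simp
  then obtain X where X: "\<And>n i. ht (q (n + n0)) i \<le> 0 \<Longrightarrow> i \<in> X n"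
    "\<And>n i. i \<in> X n \<Longrightarrow> ht (q (n + n0)) i \<le> int (2 * D + 3 * \<tau>) * l1 (q (n + n0))"
    "\<And>n. local_min (cube 0 n) (X n)"
    by metis
  obtain r Y where r: "strict_mono r" and Y: "\<And>i. \<forall>\<^sub>F n in sequentially. i \<in> X (r n) \<longleftrightarrow> i \<in> Y"
    using convergent_subsequence_of_sets[of X] by blast
  have r_lim: "filterlim (\<lambda>n. r n + n0) at_top at_top"
    using filterlim_subseq[OF r] by (rule filterlim_at_top_mono) auto
  have ht_lim: "(\<lambda>n. real_of_int (ht (q (r n + n0)) i) / real (r n + n0)) \<longlonglongrightarrow> dotp w i" for i
    unfolding q_def by (rule filterlim_compose[OF ht_int_approx r_lim])
  have l1_lim: "(\<lambda>n. real_of_int (l1 (q (r n + n0))) / real (r n + n0)) \<longlonglongrightarrow> rl1 w"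
    unfolding q_def by (rule filterlim_compose[OF l1_int_approx r_lim])
  show ?thesis
  proof (intro exI[of _ Y] conjI allI impI)
    show "local_min UNIV Y"
    proof (rule local_min_limit)
      fix F :: "(int^'a) set" and n :: nat assume F: "finite F"
      have "\<forall>\<^sub>F m in sequentially. \<forall>i\<in>F. i \<in> X (r m) \<longleftrightarrow> i \<in> Y"
        using F Y by (simp add: eventually_ball_finite)
      moreover have "\<forall>\<^sub>F m in sequentially. n \<le> m" by (rule eventually_ge_at_top)
      ultimately have "\<forall>\<^sub>F m in sequentially. (\<forall>i\<in>F. i \<in> X (r m) \<longleftrightarrow> i \<in> Y) \<and> n \<le> m"
        by (rule eventually_conj)
      then obtain m where m: "\<forall>i\<in>F. i \<in> X (r m) \<longleftrightarrow> i \<in> Y" "n \<le> m"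
        using eventually_happens by force
      have "n \<le> r m" using m(2) seq_suble[OF r, of m] by simp
      then have "cube 0 n \<subseteq> cube (0::int^'a) (r m)" by (auto simp: cube_def intro: order_trans)
      then have "local_min (cube 0 n) (X (r m))" by (rule local_min_subset[OF X(3)])
      then show "\<exists>X'. X' \<inter> F = Y \<inter> F \<and> local_min (cube 0 n) X'" using m(1) by blast
    qed
  next
    fix i assume "dotp w i < 0"
    then have "\<forall>\<^sub>F n in sequentially. real_of_int (ht (q (r n + n0)) i) / real (r n + n0) < 0"
      by (rule order_tendstoD(2)[OF ht_lim])
    then have "\<forall>\<^sub>F n in sequentially. i \<in> X (r n)"
    proof (rule eventually_mono)
      fix n assume "real_of_int (ht (q (r n + n0)) i) / real (r n + n0) < 0"
      then have "ht (q (r n + n0)) i \<le> 0" by (auto simp: divide_less_0_iff)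
      then show "i \<in> X (r n)" by (rule X(1))
    qed
    then have "\<forall>\<^sub>F n in sequentially. i \<in> Y" using Y[of i] by eventually_elim simp
    then show "i \<in> Y" by simp
  next
    fix i assume i: "real (2 * D + 3 * \<tau>) * rl1 w < dotp w i"
    have "(\<lambda>n. real_of_int (ht (q (r n + n0)) i) / real (r n + n0) -
        real (2 * D + 3 * \<tau>) * (real_of_int (l1 (q (r n + n0))) / real (r n + n0)))
      \<longlonglongrightarrow> dotp w i - real (2 * D + 3 * \<tau>) * rl1 w"
      by (intro tendsto_diff tendsto_mult tendsto_const ht_lim l1_lim)
    then have "\<forall>\<^sub>F n in sequentially. 0 < real_of_int (ht (q (r n + n0)) i) / real (r n + n0) -
        real (2 * D + 3 * \<tau>) * (real_of_int (l1 (q (r n + n0))) / real (r n + n0))"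
      by (rule order_tendstoD(1)) (use i in simp)
    then have "\<forall>\<^sub>F n in sequentially. i \<notin> X (r n)"
    proof (rule eventually_mono)
      fix n
      let ?m = "real (r n + n0)"
      assume pos: "0 < real_of_int (ht (q (r n + n0)) i) / ?m -
        real (2 * D + 3 * \<tau>) * (real_of_int (l1 (q (r n + n0))) / ?m)"
      show "i \<notin> X (r n)"
      proof
        assume "i \<in> X (r n)"
        from X(2)[OF this] have "real_of_int (ht (q (r n + n0)) i)
            \<le> real_of_int (int (2 * D + 3 * \<tau>) * l1 (q (r n + n0)))"
          by (simp only: of_int_le_iff)
        then have "real_of_int (ht (q (r n + n0)) i) / ?m
            \<le> real_of_int (int (2 * D + 3 * \<tau>) * l1 (q (r n + n0))) / ?m"
          by (rule divide_right_mono) simp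
        then show False using pos by simp
      qed
    qed
    then have "\<forall>\<^sub>F n in sequentially. i \<notin> Y" using Y[of i] by eventually_elim simp
    then show "i \<notin> Y" by simp
  qed
qed

lemma planelike_exists:
  fixes w :: "real^'a"
  assumes D: "pure_radius D" and w: "w \<noteq> 0"
  shows "\<exists>u. ground_state J h u \<and> planelike (real (2 * D + 6 * \<tau>)) w u"
proof -
  obtain X where X: "local_min UNIV X" "\<And>i. dotp w i < 0 \<Longrightarrow> i \<in> X"
    "\<And>i. real (2 * D + 3 * \<tau>) * rl1 w < dotp w i \<Longrightarrow> i \<notin> X"
    using local_min_direction[OF D w] by blast
  \<comment> \<open>The shift raises heights by \<open>2 * \<tau> * rl1 w\<close>, so all sites of
    height below \<open>2 * rl1 w\<close> become plus and a plus site next to a minus site has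
    positive height. The upper edge \<open>2 * D + 5 * \<tau>\<close> stays strictly below
    \<open>2 * D + 6 * \<tau>\<close>, which permits a closed condition there.\<close>
  define k where "k = int (2 * \<tau>) *s sgnw w"
  have k: "k \<in> lat \<tau>" by (simp add: k_def lat_def)
  have dk: "dotp w (i - k) = dotp w i - real (2 * \<tau>) * rl1 w" for i
    unfolding dotp_diff k_def dotp_sgnw by simp
  define u where "u = spin (translate k X)"
  have pos: "0 < rl1 w" by (rule rl1_pos[OF w])
  have tau: "1 * rl1 w \<le> real \<tau> * rl1 w" using tau_pos pos by (intro mult_right_mono) auto
  have M: "real (2 * D + 6 * \<tau>) * rl1 w = real (2 * D + 3 * \<tau>) * rl1 w + 3 * (real \<tau> * rl1 w)"
    "real (2 * \<tau>) * rl1 w = 2 * (real \<tau> * rl1 w)"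
    by (simp_all add: algebra_simps)
  have plus: "u i = 1" if "dotp w i < 2 * rl1 w" for i
  proof -
    have "dotp w (i - k) < 0" using that dk[of i] M(2) tau by linarith
    then show ?thesis using X(2) by (simp add: u_def spin_def)
  qed
  have minus: "u i = - 1" if "real (2 * D + 6 * \<tau>) * rl1 w \<le> dotp w i" for i
  proof -
    have "real (2 * D + 3 * \<tau>) * rl1 w < dotp w (i - k)" using that dk[of i] M tau pos by linarith
    then show ?thesis using X(3) by (simp add: u_def spin_def)
  qed
  have scale: "dotp (w /\<^sub>R rl1 w) i = dotp w i / rl1 w" for i
    by (simp add: dotp_def sum_divide_distrib divide_inverse mult_ac sum_distrib_left)
  have "ground_state J h u"
    unfolding u_def by (intro ground_state_spin local_min_translate X(1) k)
  moreover have "planelike (real (2 * D + 6 * \<tau>)) w u"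
    unfolding planelike_def scale
  proof (intro conjI allI impI subsetI CollectI)
    fix i assume "i \<in> interface u"
    then obtain j where i: "u i = 1" and j: "l1 (i - j) = 1" "u j = - 1" by (auto simp: interface_def)
    have "2 * rl1 w \<le> dotp w j" using plus[of j] j(2) by fastforce
    moreover have "\<bar>dotp w i - dotp w j\<bar> \<le> rl1 w"
      using abs_dotp_le[of w "i - j"] j(1) by (simp add: dotp_diff)
    ultimately have "0 \<le> dotp w i" using pos by linarith
    then show "0 \<le> dotp w i / rl1 w" using pos by simp
    have "dotp w i < real (2 * D + 6 * \<tau>) * rl1 w" using minus[of i] i by fastforce
    then show "dotp w i / rl1 w \<le> real (2 * D + 6 * \<tau>)" using pos by (simp add: pos_divide_le_eq)
  next
    fix i assume "real (2 * D + 6 * \<tau>) \<le> dotp w i / rl1 w"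
    then show "u i = - 1" using pos by (intro minus) (simp add: pos_le_divide_eq)
  next
    fix i assume "dotp w i / rl1 w \<le> 0"
    then have "dotp w i \<le> 0" using pos by (simp add: divide_le_0_iff)
    then show "u i = 1" using pos by (intro plus) linarith
  qed
  ultimately show ?thesis by blast
qed

end

section \<open>Energy estimates in cubes\<close>

lemma linf_le_iff: "linf v \<le> a \<longleftrightarrow> (\<forall>k. \<bar>v $ k\<bar> \<le> a)"
  unfolding linf_def by (subst Max_le_iff) auto

lemma linf_triangle: "linf (u + v) \<le> linf u + linf v"
proof -
  have "\<bar>u $ k\<bar> \<le> linf u" "\<bar>v $ k\<bar> \<le> linf v" for k
    using linf_le_iff[of u "linf u"] linf_le_iff[of v "linf v"] by auto
  then have "\<bar>(u + v) $ k\<bar> \<le> linf u + linf v" for k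
    unfolding vector_add_component by (meson abs_triangle_ineq add_mono order_trans)
  then show ?thesis unfolding linf_le_iff by blast
qed

lemma linf_nonneg: "0 \<le> linf v"
  using linf_le_iff[of v "linf v"] abs_ge_zero order_trans by blast

lemma linf_le_l1: "linf v \<le> l1 v"
  unfolding linf_le_iff l1_def by (auto intro!: member_le_sum)

lemma mem_cube_iff: "i \<in> cube x t \<longleftrightarrow> linf (i - x) \<le> int t"
  by (simp add: cube_def linf_le_iff)

lemma cube_mono: "s \<le> t \<Longrightarrow> cube x s \<subseteq> cube x t"
  by (auto simp: mem_cube_iff)

text \<open>Walk from \<open>a\<close> towards \<open>b\<close> by unit steps in coordinates where
  they differ: the walk stays in the box and must leave \<open>X\<close> at some step.\<close>

lemma adjacent_in_cell:
  fixes X :: "(int^'d) set"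
  assumes "a \<in> cell m c" "b \<in> cell m c" "a \<in> X" "b \<notin> X"
  shows "\<exists>i\<in>cell m c - X. \<exists>j\<in>cell m c \<inter> X. l1 (i - j) = 1"
  using assms(1,3)
proof (induction "nat (l1 (a - b))" arbitrary: a rule: less_induct)
  case less
  have "a \<noteq> b" using less(3) assms(4) by blast
  then obtain k where k: "a $ k \<noteq> b $ k" unfolding vec_eq_iff by blast
  define z where "z = (\<chi> l. if l = k then a $ k + sgn (b $ k - a $ k) else a $ l)"
  have zk: "z $ k = a $ k + sgn (b $ k - a $ k)" and zl: "\<And>l. l \<noteq> k \<Longrightarrow> z $ l = a $ l"
    by (simp_all add: z_def)
  have split: "l1 v = \<bar>v $ k\<bar> + (\<Sum>l\<in>UNIV - {k}. \<bar>v $ l\<bar>)" for v :: "int^'d"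
    unfolding l1_def by (rule sum.remove) auto
  have "l1 (z - a) = 1" unfolding split using k zl by (simp add: zk abs_sgn_eq)
  have "\<bar>z $ k - b $ k\<bar> + 1 = \<bar>a $ k - b $ k\<bar>"
    using k unfolding zk by (cases "a $ k < b $ k") auto
  moreover have "(\<Sum>l\<in>UNIV - {k}. \<bar>(z - b) $ l\<bar>) = (\<Sum>l\<in>UNIV - {k}. \<bar>(a - b) $ l\<bar>)"
    using zl by (intro sum.cong) auto
  ultimately have dec: "l1 (z - b) + 1 = l1 (a - b)" unfolding split by simp
  have z: "z \<in> cell m c"
    unfolding cell_def
  proof (intro CollectI allI)
    fix l
    have "c $ l \<le> a $ l" "a $ l < c $ l + int m" "c $ l \<le> b $ l" "b $ l < c $ l + int m"
      using less(2) assms(2) by (auto simp: cell_def)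
    then show "c $ l \<le> z $ l \<and> z $ l < c $ l + int m"
      using k zk zl[of l] by (cases "l = k"; cases "a $ k < b $ k") auto
  qed
  show ?case
  proof (cases "z \<in> X")
    case True
    have "0 \<le> l1 (z - b)" by (auto simp: l1_def intro: sum_nonneg)
    then have "nat (l1 (z - b)) < nat (l1 (a - b))" using dec by linarith
    then show ?thesis using less(1) z True by blast
  next
    case False
    then show ?thesis using z less(2,3) \<open>l1 (z - a) = 1\<close> by blast
  qed
qed

section \<open>Surface against bulk energy in a cube\<close>

context spin_model
begin

abbreviation far :: "int^'a \<Rightarrow> nat \<Rightarrow> (int^'a) set" where
  "far i n \<equiv> {j. int n \<le> linf (j - i)}"

text \<open>A site at distance \<open>a\<close> from \<open>x\<close> sees the complement of
  \<open>cube x t\<close> only from distance \<open>t - a + 1\<close> on. These distances are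
  distinct for distinct \<open>t\<close>, so each \<open>\<beta> n\<close> is charged at most once
  per site. Dividing by the \<open>r\<close> radii gives one with small boundary flux.\<close>

lemma tail_average:
  assumes \<beta>: "\<And>i n. 1 \<le> n \<Longrightarrow> I i (far i n) \<le> \<beta> n" and A: "finite A"
  shows "(\<Sum>t\<in>{r<..2 * r}. \<Sum>i\<in>A \<inter> cube x t. I i (- cube x t))
    \<le> real (card A) * (\<Sum>n\<in>{1..2 * r + 1}. \<beta> n)"
proof -
  have \<beta>_nonneg: "0 \<le> \<beta> n" if "1 \<le> n" for n using \<beta>[OF that] I_nonneg order_trans by blast
  have "(\<Sum>t\<in>{r<..2 * r}. \<Sum>i\<in>A \<inter> cube x t. I i (- cube x t)) =
      (\<Sum>t\<in>{r<..2 * r}. \<Sum>i\<in>A. if i \<in> cube x t then I i (- cube x t) else 0)"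
    by (rule sum.cong[OF refl]) (rule sum.inter_restrict[OF A])
  also have "\<dots> = (\<Sum>i\<in>A. \<Sum>t\<in>{r<..2 * r}. if i \<in> cube x t then I i (- cube x t) else 0)"
    by (rule sum.swap)
  also have "\<dots> \<le> (\<Sum>i\<in>A. \<Sum>n\<in>{1..2 * r + 1}. \<beta> n)"
  proof (rule sum_mono)
    fix i assume "i \<in> A"
    define a where "a = nat (linf (i - x))"
    have a: "int a = linf (i - x)" by (simp add: a_def linf_nonneg)
    have mem: "i \<in> cube x t \<longleftrightarrow> a \<le> t" for t by (simp add: mem_cube_iff a[symmetric])
    have "(\<Sum>t\<in>{r<..2 * r}. if i \<in> cube x t then I i (- cube x t) else 0) =
        (\<Sum>t\<in>{r<..2 * r} \<inter> {t. a \<le> t}. I i (- cube x t))"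
      by (subst sum.inter_restrict) (auto simp: mem)
    also have "\<dots> \<le> (\<Sum>t\<in>{r<..2 * r} \<inter> {t. a \<le> t}. \<beta> (t - a + 1))"
    proof (rule sum_mono)
      fix t assume "t \<in> {r<..2 * r} \<inter> {t. a \<le> t}"
      then have "a \<le> t" by simp
      have "- cube x t \<subseteq> far i (t - a + 1)"
      proof
        fix j assume "j \<in> - cube x t"
        then have "int t < linf (j - x)" by (simp add: mem_cube_iff)
        also have "\<dots> \<le> linf (j - i) + linf (i - x)" using linf_triangle[of "j - i" "i - x"] by simp
        finally show "j \<in> far i (t - a + 1)" using \<open>a \<le> t\<close> a by simp
      qed
      then have "I i (- cube x t) \<le> I i (far i (t - a + 1))" by (rule I_mono)
      also have "\<dots> \<le> \<beta> (t - a + 1)" by (rule \<beta>) simp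
      finally show "I i (- cube x t) \<le> \<beta> (t - a + 1)" .
    qed
    also have "\<dots> = (\<Sum>n\<in>(\<lambda>t. t - a + 1) ` ({r<..2 * r} \<inter> {t. a \<le> t}). \<beta> n)"
      by (subst sum.reindex) (auto simp: inj_on_def)
    also have "\<dots> \<le> (\<Sum>n\<in>{1..2 * r + 1}. \<beta> n)"
      by (rule sum_mono2) (auto intro: \<beta>_nonneg)
    finally show "(\<Sum>t\<in>{r<..2 * r}. if i \<in> cube x t then I i (- cube x t) else 0)
      \<le> (\<Sum>n\<in>{1..2 * r + 1}. \<beta> n)" .
  qed
  also have "\<dots> = real (card A) * (\<Sum>n\<in>{1..2 * r + 1}. \<beta> n)" by simp
  finally show ?thesis .
qed

text \<open>The middle cell of side \<open>\<tau>\<close> in \<open>cell (3 * \<tau>) c\<close>. The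
  margin lets a ball of radius at most \<open>\<tau>\<close> around any of its sites fit into the
  large cell, so that energies found in different large cells add up.\<close>

definition inner_cell :: "int^'a \<Rightarrow> (int^'a) set" where
  "inner_cell c = cell \<tau> (c + (\<chi> k. int \<tau>))"

lemma inner_cell_subset: "inner_cell c \<subseteq> cell (3 * \<tau>) c"
proof
  fix i assume "i \<in> inner_cell c"
  then have 1: "c $ k + int \<tau> \<le> i $ k \<and> i $ k < c $ k + int \<tau> + int \<tau>" for k
    by (simp add: inner_cell_def cell_def)
  have "c $ k \<le> i $ k \<and> i $ k < c $ k + int (3 * \<tau>)" for k
    using 1[of k] tau_pos by (simp add: algebra_simps)
  then show "i \<in> cell (3 * \<tau>) c" by (simp add: cell_def)
qed

text \<open>\<open>cube x (m * p)\<close> contains \<open>(2 * p) ^ CARD('a)\<close> disjoint boxes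
  of side \<open>m\<close>, indexed by \<open>Y\<close>.\<close>

lemma grid_sum_le:
  fixes f :: "int^'a \<Rightarrow> real"
  assumes m: "0 < m" and f: "\<And>i. 0 \<le> f i" and T: "finite T" "cube x (m * p) \<subseteq> T"
    and \<kappa>: "\<And>c. cell m c \<subseteq> cube x (m * p) \<Longrightarrow> \<kappa> \<le> sum f (cell m c \<inter> S)"
  shows "\<kappa> * (2 * real p) ^ CARD('a) \<le> sum f (T \<inter> S)"
proof -
  define Y where "Y = {y::int^'a. \<forall>k. y $ k \<in> {- int p..<int p}}"
  define c where "c y = x + int m *s y" for y
  have Y: "finite Y" unfolding Y_def by (rule finite_vec_box) simp
  have "card {- int p..<int p} = 2 * p" by simp
  then have card_Y: "card Y = (2 * p) ^ CARD('a)"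
    unfolding Y_def card_vec_box by (simp only: prod_constant)
  have sub: "cell m (c y) \<subseteq> cube x (m * p)" if "y \<in> Y" for y
  proof
    fix i assume i: "i \<in> cell m (c y)"
    show "i \<in> cube x (m * p)" unfolding cube_def
    proof (intro CollectI allI)
      fix k
      have "- int p \<le> y $ k \<and> y $ k < int p" using that by (simp add: Y_def)
      then have y: "- int p \<le> y $ k" "y $ k + 1 \<le> int p" by simp_all
      have "int m * (- int p) \<le> int m * y $ k" "int m * (y $ k + 1) \<le> int m * int p"
        by (rule mult_left_mono[OF y(1)], simp, rule mult_left_mono[OF y(2)], simp)
      moreover have "x $ k + int m * y $ k \<le> i $ k" "i $ k < x $ k + int m * y $ k + int m"
        using i by (simp_all add: cell_def c_def)
      ultimately show "\<bar>i $ k - x $ k\<bar> \<le> int (m * p)" by (simp add: abs_le_iff algebra_simps)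
    qed
  qed
  have div_eq: "(i $ k - x $ k) div int m = y $ k" if "i \<in> cell m (c y)" for i k y
  proof (rule int_div_pos_eq)
    show "i $ k - x $ k = int m * y $ k + (i $ k - x $ k - int m * y $ k)" by simp
    have "x $ k + int m * y $ k \<le> i $ k" "i $ k < x $ k + int m * y $ k + int m"
      using that by (simp_all add: cell_def c_def)
    then show "0 \<le> i $ k - x $ k - int m * y $ k" "i $ k - x $ k - int m * y $ k < int m"
      by linarith+
  qed
  have disj: "y = y'" if "i \<in> cell m (c y)" "i \<in> cell m (c y')" for i y y'
    unfolding vec_eq_iff using div_eq[OF that(1)] div_eq[OF that(2)] by simp
  have "\<kappa> * (2 * real p) ^ CARD('a) = (\<Sum>y\<in>Y. \<kappa>)" using card_Y by simp
  also have "\<dots> \<le> (\<Sum>y\<in>Y. sum f (cell m (c y) \<inter> S))"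
    by (rule sum_mono) (rule \<kappa>[OF sub])
  also have "\<dots> = sum f (\<Union>y\<in>Y. cell m (c y) \<inter> S)"
  proof (rule sum.UNION_disjoint[symmetric])
    show "\<forall>y\<in>Y. \<forall>y'\<in>Y. y \<noteq> y' \<longrightarrow> (cell m (c y) \<inter> S) \<inter> (cell m (c y') \<inter> S) = {}"
      using disj by blast
  qed (use Y finite_cell in auto)
  also have "\<dots> \<le> sum f (T \<inter> S)"
  proof (rule sum_mono2)
    show "(\<Union>y\<in>Y. cell m (c y) \<inter> S) \<subseteq> T \<inter> S" using sub T(2) by blast
  qed (use T f in auto)
  finally show ?thesis .
qed

text \<open>Turning the minus sites of \<open>cube x t\<close> into plus creates flux only through
  the boundary of the cube and costs at most \<open>\<mu> / 2\<close> per site from the field, while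
  it saves at least \<open>\<kappa>\<close> for every mixed cell. Assumption \<open>small\<close>
  makes this profitable if all cells are mixed; \<open>5 * r\<close> bounds the side
  \<open>4 * r + 1\<close> of the cube.\<close>

lemma pure_radius_criterion:
  assumes \<beta>: "\<And>i n. 1 \<le> n \<Longrightarrow> I i (far i n) \<le> \<beta> n"
    and h: "\<And>i. \<bar>h i\<bar> \<le> \<mu>" and p: "1 \<le> p" and r: "r = 3 * \<tau> * p"
    and lower: "\<And>x X c. local_min (cube x (2 * r)) X \<Longrightarrow> cell (3 * \<tau>) c \<subseteq> cube x (2 * r) \<Longrightarrow>
      \<not> inner_cell c \<subseteq> X \<Longrightarrow> inner_cell c \<inter> X \<noteq> {} \<Longrightarrow> \<kappa> \<le> (\<Sum>i\<in>cell (3 * \<tau>) c \<inter> - X. I i X)"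
    and small: "(5 * real r) ^ CARD('a) * ((\<Sum>n\<in>{1..2 * r + 1}. \<beta> n) / real r + \<mu> / 2) < \<kappa> * (2 * real p) ^ CARD('a)"
  shows "pure_radius (2 * r)"
  unfolding pure_radius_def
proof (intro allI impI)
  fix x :: "int^'a" and X assume X: "local_min (cube x (2 * r)) X"
  show "\<exists>c. cell \<tau> c \<subseteq> cube x (2 * r) \<and> (cell \<tau> c \<subseteq> X \<or> cell \<tau> c \<inter> X = {})"
  proof (rule ccontr)
    assume "\<not> ?thesis"
    then have mixed: "\<not> cell \<tau> c \<subseteq> X" "cell \<tau> c \<inter> X \<noteq> {}" if "cell \<tau> c \<subseteq> cube x (2 * r)" for c
      using that by blast+
    have r1: "1 \<le> r" using p tau_pos by (simp add: r)
    define S where "S = (\<Sum>n\<in>{1..2 * r + 1}. \<beta> n)"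
    have \<mu>: "0 \<le> \<mu>" using h[of undefined] by linarith
    have S0: "0 \<le> S" unfolding S_def
    proof (rule sum_nonneg)
      fix n assume "n \<in> {1..2 * r + 1}"
      then show "0 \<le> \<beta> n" using \<beta>[of n undefined] I_nonneg[of undefined] by (meson atLeastAtMost_iff order_trans)
    qed
    define N where "N = real (card (cube x (2 * r)))"
    have N: "N \<le> (5 * real r) ^ CARD('a)"
      unfolding N_def card_cube of_nat_power by (rule power_mono) (use r1 in auto)
    define A where "A = cube x (2 * r) \<inter> - X"
    have A: "finite A" "real (card A) \<le> N"
      unfolding A_def N_def using finite_cube by (auto intro!: card_mono)
    have "\<exists>t\<in>{r<..2 * r}. (\<Sum>i\<in>A \<inter> cube x t. I i (- cube x t)) \<le> N * (S / real r)"
    proof (rule ccontr)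
      assume "\<not> ?thesis"
      then have "\<And>t. t \<in> {r<..2 * r} \<Longrightarrow> N * (S / real r) < (\<Sum>i\<in>A \<inter> cube x t. I i (- cube x t))"
        unfolding not_le[symmetric] by blast
      then have "(\<Sum>t\<in>{r<..2 * r}. N * (S / real r)) < (\<Sum>t\<in>{r<..2 * r}. \<Sum>i\<in>A \<inter> cube x t. I i (- cube x t))"
        using r1 by (intro sum_strict_mono) auto
      also have "\<dots> \<le> real (card A) * S" unfolding S_def by (rule tail_average[OF \<beta> A(1)])
      also have "\<dots> \<le> N * S" using A(2) S0 by (rule mult_right_mono)
      finally show False using r1 by simp
    qed
    then obtain t where t: "t \<in> {r<..2 * r}"
      "(\<Sum>i\<in>A \<inter> cube x t. I i (- cube x t)) \<le> N * (S / real r)" by blast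
    define At where "At = cube x t \<inter> - X"
    have At: "At = A \<inter> cube x t" using t(1) cube_mono[of t "2 * r" x] by (auto simp: A_def At_def)
    have At_fin: "finite At" using A(1) by (simp add: At)
    have "At \<subseteq> cube x (2 * r)" "At \<inter> X = {}" by (auto simp: At A_def)
    then have "0 \<le> delta UNIV At X" using X At_fin unfolding local_min_def by blast
    also have "\<dots> \<le> (\<Sum>i\<in>At. I i (- cube x t) - I i X + \<mu> / 2)"
      unfolding delta_def Int_UNIV_right
    proof (rule sum_mono)
      fix i
      have "I i (- (At \<union> X)) \<le> I i (- cube x t)" by (rule I_mono) (auto simp: At_def)
      then show "I i (- (At \<union> X)) - I i X + h i / 2 \<le> I i (- cube x t) - I i X + \<mu> / 2"
        using h[of i] by (simp add: abs_le_iff)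
    qed
    finally have "(\<Sum>i\<in>At. I i X) \<le> (\<Sum>i\<in>At. I i (- cube x t)) + real (card At) * (\<mu> / 2)"
      by (simp add: sum.distrib sum_subtractf)
    also have "real (card At) * (\<mu> / 2) \<le> N * (\<mu> / 2)"
    proof (rule mult_right_mono)
      have "card At \<le> card A" using A(1) by (auto simp: At intro!: card_mono)
      then show "real (card At) \<le> N" using A(2) by linarith
    qed (use \<mu> in simp)
    also have "(\<Sum>i\<in>At. I i (- cube x t)) \<le> N * (S / real r)" using t(2) by (simp only: At)
    finally have "(\<Sum>i\<in>At. I i X) \<le> N * (S / real r + \<mu> / 2)" by (simp add: algebra_simps)
    also have "\<dots> \<le> (5 * real r) ^ CARD('a) * (S / real r + \<mu> / 2)"
      using S0 \<mu> by (intro mult_right_mono N) simp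
    finally have upper: "(\<Sum>i\<in>At. I i X) < \<kappa> * (2 * real p) ^ CARD('a)" using small unfolding S_def by linarith
    have "\<kappa> * (2 * real p) ^ CARD('a) \<le> sum (\<lambda>i. I i X) (cube x t \<inter> - X)"
    proof (rule grid_sum_le)
      show "0 < 3 * \<tau>" using tau_pos by simp
      show "0 \<le> I i X" for i by (rule I_nonneg)
      show "finite (cube x t)" by (rule finite_cube)
      have "3 * \<tau> * p \<le> t" using t(1) r by simp
      then show "cube x (3 * \<tau> * p) \<subseteq> cube x t" by (rule cube_mono)
      fix c assume "cell (3 * \<tau>) c \<subseteq> cube x (3 * \<tau> * p)"
      then have c: "cell (3 * \<tau>) c \<subseteq> cube x (2 * r)" using cube_mono[of r "2 * r" x] r by auto
      moreover note inner_cell_subset[of c]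
      ultimately have "inner_cell c \<subseteq> cube x (2 * r)" by simp
      then show "\<kappa> \<le> sum (\<lambda>i. I i X) (cell (3 * \<tau>) c \<inter> - X)"
        using mixed unfolding inner_cell_def by (intro lower[OF X c]) (auto simp: inner_cell_def)
    qed
    then show False using upper by (simp add: At_def)
  qed
qed

text \<open>A mixed cell contains neighbours of opposite sign, coupled by at least
  \<open>lam\<close>. This counts one pair per cell whatever its side, so the admissible field
  strength shrinks as \<open>\<tau>\<close> grows.\<close>

lemma pure_radius_short_range:
  assumes lam: "\<And>i j. l1 (i - j) = 1 \<Longrightarrow> lam \<le> J i j"
    and \<beta>: "\<And>i n. 1 \<le> n \<Longrightarrow> I i (far i n) \<le> \<beta> n"
    and h: "\<And>i. \<bar>h i\<bar> \<le> \<mu>" and p: "1 \<le> p" and r: "r = 3 * \<tau> * p"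
    and small: "(5 * real r) ^ CARD('a) * ((\<Sum>n\<in>{1..2 * r + 1}. \<beta> n) / real r + \<mu> / 2) < lam * (2 * real p) ^ CARD('a)"
  shows "pure_radius (2 * r)"
proof (rule pure_radius_criterion[OF \<beta> h p r _ small])
  fix X and c :: "int^'a" assume *: "\<not> inner_cell c \<subseteq> X" "inner_cell c \<inter> X \<noteq> {}"
  then obtain a b where "a \<in> cell (3 * \<tau>) c" "b \<in> cell (3 * \<tau>) c" "a \<in> X" "b \<notin> X" using inner_cell_subset[of c] by blast
  then obtain i j where i: "i \<in> cell (3 * \<tau>) c - X" and j: "j \<in> cell (3 * \<tau>) c \<inter> X" "l1 (i - j) = 1"
    using adjacent_in_cell by blast
  have "lam \<le> J i j" by (rule lam[OF j(2)])
  also have "\<dots> = I i {j}" by (simp add: I_def)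
  also have "\<dots> \<le> I i X" using j by (intro I_mono) auto
  also have "\<dots> \<le> (\<Sum>i\<in>cell (3 * \<tau>) c \<inter> - X. I i X)"
    using i by (intro member_le_sum) (auto simp: I_nonneg finite_cell)
  finally show "lam \<le> (\<Sum>i\<in>cell (3 * \<tau>) c \<inter> - X. I i X)" .
qed

end

section \<open>Power law couplings: tails, isoperimetry and density\<close>

lemma sum_powr_le:
  assumes s: "0 < s" "s < 1"
  shows "(\<Sum>n\<in>{1..m}. real n powr (- s)) \<le> real m powr (1 - s) / (1 - s)"
proof (induction m)
  case (Suc m)
  have "real (Suc m) powr (- s) \<le> (real (Suc m) powr (1 - s) - real m powr (1 - s)) / (1 - s)"
  proof (cases "m = 0")
    case True
    then show ?thesis using s by (simp add: field_simps)
  next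
    case False
    have "\<exists>z. real m < z \<and> z < real (Suc m) \<and>
        real (Suc m) powr (1 - s) - real m powr (1 - s) = (real (Suc m) - real m) * ((1 - s) * z powr (1 - s - 1))"
    proof (rule MVT2)
      show "((\<lambda>a. a powr (1 - s)) has_real_derivative (1 - s) * x powr (1 - s - 1)) (at x)"
        if "real m \<le> x" for x
        by (rule has_real_derivative_powr) (use False that in linarith)
    qed simp
    then obtain z where z: "real m < z" "z < real (Suc m)"
      "real (Suc m) powr (1 - s) - real m powr (1 - s) = (1 - s) * z powr (- s)" by auto
    have "real (Suc m) powr (- s) \<le> z powr (- s)"
      using z s False by (intro powr_mono2') auto
    then show ?thesis unfolding z(3) using s by simp
  qed
  then show ?case using Suc s by (simp add: diff_divide_distrib)
qed simp

lemma l1_minus: "l1 (i - j) = l1 (j - i)"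
  unfolding l1_def by (simp add: abs_minus_commute)

lemma linf_minus: "linf (i - j) = linf (j - i)"
  unfolding linf_def by (simp add: abs_minus_commute)

lemma l1_le_linf: "l1 (v::int^'d) \<le> int CARD('d) * linf v"
proof -
  have "l1 v \<le> (\<Sum>k\<in>(UNIV::'d set). linf v)" unfolding l1_def
    using linf_le_iff[of v "linf v"] by (intro sum_mono) auto
  then show ?thesis by simp
qed

lemma powr_dim_split:
  assumes "0 < x"
  shows "x ^ d * x powr (- real d - s) = x powr (- s)"
  using assms by (simp add: powr_realpow[symmetric] powr_add[symmetric])

context spin_model
begin

text \<open>Dyadic shells: at distances from \<open>X\<close> up to \<open>2 * X\<close> there are
  at most \<open>(5 * X) ^ d\<close> sites, each coupled by at most
  \<open>\<Lambda> * X powr (- d - s)\<close>. With \<open>X = 2 ^ K * n\<close> the shells form a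
  geometric series of ratio \<open>2 powr (- s)\<close>.\<close>

lemma tail_power_law:
  assumes up: "\<And>i j. i \<noteq> j \<Longrightarrow> J i j \<le> \<Lambda> * real_of_int (l1 (i - j)) powr (- real CARD('a) - s)"
    and \<Lambda>: "0 \<le> \<Lambda>" and s: "0 < s" and n: "1 \<le> n"
  shows "I i (far i n) \<le> \<Lambda> * 5 ^ CARD('a) / (1 - 2 powr (- s)) * real n powr (- s)"
  unfolding I_def
proof (rule infsum_le_finite_sums[OF summ])
  define q where "q = 2 powr (- s)"
  have q: "0 < q" "q < 1" unfolding q_def using s powr_less_one[of 2 "- s"] by (auto simp: powr_minus)
  define D where "D = \<Lambda> * 5 ^ CARD('a) * real n powr (- s)"
  have D: "0 \<le> D" using \<Lambda> by (simp add: D_def)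
  have dyadic: "sum (J i) F \<le> D * (\<Sum>k<K. q ^ k)"
    if "finite F" "F \<subseteq> {j. int n \<le> linf (j - i) \<and> linf (j - i) < 2 ^ K * int n}" for F K
    using that
  proof (induction K arbitrary: F)
    case 0
    have "j \<notin> F" for j
    proof
      assume "j \<in> F"
      then have "int n \<le> linf (j - i) \<and> linf (j - i) < 2 ^ 0 * int n" using 0 by blast
      then show False by (simp only: power_0 mult_1) linarith
    qed
    then have "F = {}" by blast
    then show ?case by simp
  next
    case (Suc K)
    define F2 where "F2 = {j\<in>F. 2 ^ K * int n \<le> linf (j - i)}"
    define X where "X = 2 ^ K * real n"
    have "1 * 1 \<le> X" unfolding X_def by (rule mult_mono) (use n in auto)
    then have X: "1 \<le> X" by simp
    have "sum (J i) F2 \<le> real (card F2) * (\<Lambda> * X powr (- real CARD('a) - s))"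
    proof (rule sum_bounded_above)
      fix j assume "j \<in> F2"
      then have j: "2 ^ K * int n \<le> linf (j - i)" by (simp add: F2_def)
      then have "2 ^ K * int n \<le> l1 (i - j)" using linf_le_l1[of "j - i"] l1_minus[of i j] by simp
      then have "real_of_int (2 ^ K * int n) \<le> real_of_int (l1 (i - j))" by (simp only: of_int_le_iff)
      then have "X \<le> real_of_int (l1 (i - j))" by (simp add: X_def)
      then have "real_of_int (l1 (i - j)) powr (- real CARD('a) - s) \<le> X powr (- real CARD('a) - s)"
        using X s by (intro powr_mono2') auto
      moreover have "i \<noteq> j" using \<open>X \<le> real_of_int (l1 (i - j))\<close> X by (auto simp: l1_def)
      ultimately show "J i j \<le> \<Lambda> * X powr (- real CARD('a) - s)"
        using up[of i j] \<Lambda> by (meson mult_left_mono order_trans)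
    qed
    also have "\<dots> \<le> (5 * X) ^ CARD('a) * (\<Lambda> * X powr (- real CARD('a) - s))"
    proof (rule mult_right_mono)
      have "F2 \<subseteq> cube i (2 * (2 ^ K * n))"
      proof
        fix j assume "j \<in> F2"
        then have "linf (j - i) < 2 ^ Suc K * int n" using Suc.prems(2) unfolding F2_def by blast
        then show "j \<in> cube i (2 * (2 ^ K * n))" by (simp add: mem_cube_iff)
      qed
      then have "card F2 \<le> card (cube i (2 * (2 ^ K * n)))" by (rule card_mono[OF finite_cube])
      then have "real (card F2) \<le> real (card (cube i (2 * (2 ^ K * n))))" by (simp only: of_nat_le_iff)
      also have "\<dots> = (4 * X + 1) ^ CARD('a)"
      proof -
        have "real (2 * (2 * (2 ^ K * n)) + 1) = 4 * X + 1" by (simp add: X_def)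
        then show ?thesis by (simp only: card_cube of_nat_power)
      qed
      also have "\<dots> \<le> (5 * X) ^ CARD('a)" using X by (intro power_mono) auto
      finally show "real (card F2) \<le> (5 * X) ^ CARD('a)" .
    qed (use \<Lambda> in simp)
    also have "\<dots> = \<Lambda> * 5 ^ CARD('a) * (X ^ CARD('a) * X powr (- real CARD('a) - s))"
      by (simp add: power_mult_distrib)
    also have "\<dots> = \<Lambda> * 5 ^ CARD('a) * X powr (- s)" using X by (subst powr_dim_split) auto
    also have "\<dots> = D * q ^ K"
      by (simp add: D_def X_def q_def powr_mult powr_realpow[symmetric] powr_powr mult.commute)
    finally have F2: "sum (J i) F2 \<le> D * q ^ K" .
    have "sum (J i) (F - F2) \<le> D * (\<Sum>k<K. q ^ k)"
      using Suc.prems by (intro Suc.IH) (auto simp: F2_def)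
    moreover have "sum (J i) F = sum (J i) (F - F2) + sum (J i) F2"
      using Suc.prems(1) by (intro sum.subset_diff) (auto simp: F2_def)
    ultimately show ?case using F2 by (simp add: algebra_simps)
  qed
  fix F assume F: "finite F" "F \<subseteq> far i n"
  obtain K where K: "\<And>j. j \<in> F \<Longrightarrow> linf (j - i) < int K"
  proof -
    have "linf (j - i) < int (nat (\<Sum>j\<in>F. linf (j - i)) + 1)" if "j \<in> F" for j
      using member_le_sum[of j F "\<lambda>j. linf (j - i)"] F(1) that by (simp add: linf_nonneg)
    then show thesis using that by blast
  qed
  have "sum (J i) F \<le> D * (\<Sum>k<K. q ^ k)"
  proof (rule dyadic[OF F(1)], rule subsetI, rule CollectI, rule conjI)
    fix j assume j: "j \<in> F"
    then show "int n \<le> linf (j - i)" using F(2) by auto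
    have "int K * 1 \<le> 2 ^ K * int n"
    proof (rule mult_mono)
      have "int K < int (2 ^ K)" by (simp only: of_nat_less_iff less_exp)
      then show "int K \<le> 2 ^ K" by simp
    qed (use n in auto)
    then show "linf (j - i) < 2 ^ K * int n" using K[OF j] by simp
  qed
  also have "(\<Sum>k<K. q ^ k) \<le> 1 / (1 - q)"
  proof -
    have "(\<Sum>k<K. q ^ k) = (1 - q ^ K) / (1 - q)" using q by (simp add: sum_gp_strict)
    also have "\<dots> \<le> 1 / (1 - q)" using q by (intro divide_right_mono) auto
    finally show ?thesis .
  qed
  finally show "sum (J i) F \<le> \<Lambda> * 5 ^ CARD('a) / (1 - 2 powr (- s)) * real n powr (- s)"
    using D by (simp add: D_def q_def mult_left_mono)
qed

text \<open>A cube whose radius is the integer part of \<open>\<rho>\<close> has at least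
  \<open>\<rho> ^ d\<close> sites, so at least half that many lie outside \<open>A\<close>, at
  \<open>l1\<close> distance at most \<open>d * \<rho>\<close> from \<open>i\<close>. Summed over
  \<open>A\<close> this is a fractional isoperimetric inequality.\<close>

lemma isoperimetric:
  assumes low: "\<And>i j. i \<noteq> j \<Longrightarrow> lam * real_of_int (l1 (i - j)) powr (- real CARD('a) - s) \<le> J i j"
    and lam: "0 < lam" and s: "0 < s"
    and A: "finite A" "real (card A) \<le> \<rho> ^ CARD('a) / 2" and i: "i \<in> A" and \<rho>: "0 < \<rho>"
  shows "lam / 2 * real CARD('a) powr (- real CARD('a) - s) * \<rho> powr (- s) \<le> I i (- A)"
proof -
  let ?d = "CARD('a)"
  have "1 \<le> card A" using A(1) i by (metis One_nat_def Suc_leI card_gt_0_iff empty_iff)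
  then have "1 \<le> real (card A)" by simp
  then have "1 < \<rho> ^ ?d" using A(2) by linarith
  then have \<rho>1: "1 \<le> \<rho>" using power_le_one[of \<rho> ?d] \<rho> by linarith
  define m where "m = nat \<lfloor>\<rho>\<rfloor>"
  have m: "real m \<le> \<rho>" "\<rho> < real m + 1" using \<rho>1 by (auto simp: m_def)
  define B where "B = cube i m - A"
  have B: "finite B" by (simp add: B_def finite_cube)
  have "card (cube i m) \<le> card B + card A"
    using card_mono[OF _ Un_upper1[of "cube i m" A]] card_Un_le[of B A] A(1) finite_cube[of i m]
    by (simp add: B_def Un_Diff_cancel2)
  then have "real (card (cube i m)) \<le> real (card B) + real (card A)" by linarith
  moreover have "\<rho> ^ ?d \<le> real (card (cube i m))"
    unfolding card_cube of_nat_power using m \<rho> by (intro power_mono) auto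
  ultimately have card_B: "\<rho> ^ ?d / 2 \<le> real (card B)" using A(2) by linarith
  define x where "x = real ?d * \<rho>"
  have x: "0 < x" using \<rho> by (simp add: x_def)
  have "lam / 2 * real ?d powr (- real ?d - s) * \<rho> powr (- s) = \<rho> ^ ?d / 2 * (lam * x powr (- real ?d - s))"
    using powr_dim_split[OF \<rho>, of ?d s, symmetric] \<rho> by (simp add: x_def powr_mult)
  also have "\<dots> \<le> real (card B) * (lam * x powr (- real ?d - s))"
    using card_B lam by (intro mult_right_mono) auto
  also have "\<dots> \<le> sum (J i) B"
  proof (rule sum_bounded_below)
    fix j assume j: "j \<in> B"
    then have "i \<noteq> j" using i by (auto simp: B_def)
    have "linf (i - j) \<le> int m" using j linf_minus[of i j] by (simp add: B_def mem_cube_iff)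
    then have "int ?d * linf (i - j) \<le> int ?d * int m" by (rule mult_left_mono) simp
    with l1_le_linf[of "i - j"] have "l1 (i - j) \<le> int ?d * int m" by (rule order_trans)
    then have "real_of_int (l1 (i - j)) \<le> real_of_int (int ?d * int m)" by (simp only: of_int_le_iff)
    also have "\<dots> = real ?d * real m" by simp
    also have "\<dots> \<le> x" unfolding x_def using m by (intro mult_left_mono) auto
    finally have "x powr (- real ?d - s) \<le> real_of_int (l1 (i - j)) powr (- real ?d - s)"
      using s l1_pos[of "i - j"] \<open>i \<noteq> j\<close> by (intro powr_mono2') auto
    then show "lam * x powr (- real ?d - s) \<le> J i j"
      using low[OF \<open>i \<noteq> j\<close>] lam by (meson less_imp_le mult_left_mono order_trans)
  qed
  also have "\<dots> = I i B" using B by (simp add: I_def)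
  also have "\<dots> \<le> I i (- A)" by (rule I_mono) (auto simp: B_def)
  finally show ?thesis .
qed

lemma sum_tail_le:
  assumes s: "0 < s" "s < 1" and C: "0 \<le> C" and r: "1 \<le> r"
  shows "(\<Sum>n\<in>{1..2 * r + 1}. C * real n powr (- s)) \<le> 3 * C / (1 - s) * real r powr (1 - s)"
proof -
  have "(\<Sum>n\<in>{1..2 * r + 1}. C * real n powr (- s)) \<le> C * (real (2 * r + 1) powr (1 - s) / (1 - s))"
    unfolding sum_distrib_left[symmetric] by (rule mult_left_mono[OF sum_powr_le[OF s] C])
  also have "\<dots> \<le> C * ((3 * real r) powr (1 - s) / (1 - s))"
    using s r C by (intro mult_left_mono divide_right_mono powr_mono2) auto
  also have "(3 * real r) powr (1 - s) = 3 powr (1 - s) * real r powr (1 - s)" by (simp add: powr_mult)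
  also have "C * (3 powr (1 - s) * real r powr (1 - s) / (1 - s)) \<le> C * (3 * real r powr (1 - s) / (1 - s))"
    using s C powr_mono[of "1 - s" 1 "3::real"]
    by (intro mult_left_mono divide_right_mono mult_right_mono) auto
  finally show ?thesis by (simp add: algebra_simps)
qed

text \<open>A doubling argument of De Giorgi type. If \<open>Z\<close> were thin at scale
  \<open>2 * r\<close>, \<open>isoperimetric\<close> would bound the boundary flux of
  \<open>Z \<inter> cube x t\<close> from below, while stability bounds it by twice the flux out of
  the cube. Averaging over \<open>t\<close> gives \<open>V1 * 2 ^ d \<le> V2\<close>, which the
  induction hypothesis excludes for a thin set. The condition relating \<open>\<eta>\<close> to
  \<open>C\<close> supplies the factor \<open>2 ^ d\<close>.\<close>

lemma density:
  assumes low: "\<And>i j. i \<noteq> j \<Longrightarrow> lam * real_of_int (l1 (i - j)) powr (- real CARD('a) - s) \<le> J i j"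
    and lam: "0 < lam" and s: "0 < s" "s < 1"
    and tail: "\<And>i n. 1 \<le> n \<Longrightarrow> I i (far i n) \<le> C * real n powr (- s)" and C: "0 < C"
    and \<eta>: "0 < \<eta>" "\<eta> \<le> 1"
      "2 ^ CARD('a) * (6 * C / (1 - s)) \<le> lam / 2 * real CARD('a) powr (- real CARD('a) - s) * \<eta> powr (- s)"
    and x: "x \<in> Z"
    and stable: "\<And>A. finite A \<Longrightarrow> A \<subseteq> Z \<inter> cube x (2 ^ K) \<Longrightarrow> (\<Sum>i\<in>A. I i (- Z)) \<le> (\<Sum>i\<in>A. I i (Z - A))"
  shows "k \<le> K \<Longrightarrow> \<eta> ^ CARD('a) / 2 ^ (CARD('a) + 1) * (2 ^ k) ^ CARD('a) \<le> real (card (Z \<inter> cube x (2 ^ k)))"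
proof (induction k)
  case 0
  have "x \<in> Z \<inter> cube x (2 ^ 0)" using x by (simp add: cube_def)
  then have "1 \<le> card (Z \<inter> cube x (2 ^ 0))"
    using finite_cube[of x "2 ^ 0"] by (metis One_nat_def Suc_leI card_gt_0_iff empty_iff finite_Int)
  moreover have "\<eta> ^ CARD('a) / 2 ^ (CARD('a) + 1) \<le> 1 / 1"
  proof (rule frac_le)
    show "\<eta> ^ CARD('a) \<le> 1" using \<eta>(1,2) by (intro power_le_one) auto
    show "(1::real) \<le> 2 ^ (CARD('a) + 1)" by (rule one_le_power) simp
  qed auto
  ultimately have "\<eta> ^ CARD('a) / 2 ^ (CARD('a) + 1) \<le> real (card (Z \<inter> cube x (2 ^ 0)))" by linarith
  then show ?case by (simp only: power_0 power_one mult_1_right)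
next
  case (Suc k)
  let ?d = "CARD('a)"
  define r :: nat where "r = 2 ^ k"
  have r: "1 \<le> r" "2 * r = 2 ^ Suc k" by (simp_all add: r_def)
  define V1 where "V1 = real (card (Z \<inter> cube x r))"
  define V2 where "V2 = real (card (Z \<inter> cube x (2 * r)))"
  have IH: "\<eta> ^ ?d / 2 ^ (?d + 1) * real r ^ ?d \<le> V1" using Suc by (simp add: V1_def r_def)
  \<comment> \<open>The constant is arranged so that the claim at scale \<open>2 * r\<close> is
    exactly the volume threshold of \<open>isoperimetric\<close> for radius
    \<open>\<eta> * r\<close>.\<close>
  have goal: "\<eta> ^ ?d / 2 ^ (?d + 1) * (2 ^ Suc k) ^ ?d = (\<eta> * real r) ^ ?d / 2"
    by (simp add: r_def power_mult_distrib)
  show ?case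
  proof (rule ccontr)
    assume "\<not> ?thesis"
    then have V2: "V2 < (\<eta> * real r) ^ ?d / 2" unfolding goal by (simp add: V2_def r)
    define L where "L = lam / 2 * real ?d powr (- real ?d - s)"
    define a where "a = 6 * C / (1 - s)"
    have a: "0 < a" using C s by (simp add: a_def)
    have per_t: "V1 * (L * (\<eta> * real r) powr (- s)) \<le> 2 * (\<Sum>i\<in>Z \<inter> cube x (2 * r) \<inter> cube x t. I i (- cube x t))"
      if t: "t \<in> {r<..2 * r}" for t
    proof -
      define A where "A = Z \<inter> cube x t"
      have sub: "cube x r \<subseteq> cube x t" "cube x t \<subseteq> cube x (2 * r)" using t by (auto intro!: cube_mono)
      have A: "finite A" "A = Z \<inter> cube x (2 * r) \<inter> cube x t" using sub(2) by (auto simp: A_def finite_cube)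
      have "real (card A) \<le> V2"
        unfolding V2_def using A(2) finite_cube by (auto intro!: card_mono)
      then have card_A: "real (card A) \<le> (\<eta> * real r) ^ ?d / 2" using V2 by linarith
      have "V1 \<le> real (card A)"
        unfolding V1_def A_def using sub(1) finite_cube by (auto intro!: card_mono)
      then have "V1 * (L * (\<eta> * real r) powr (- s)) \<le> real (card A) * (L * (\<eta> * real r) powr (- s))"
        using lam by (intro mult_right_mono) (auto simp: L_def)
      also have "\<dots> \<le> (\<Sum>i\<in>A. I i (- A))"
        unfolding L_def
        by (rule sum_bounded_below) (rule isoperimetric[OF low lam s(1) A(1) card_A], use \<eta> r in auto)
      also have "\<dots> = (\<Sum>i\<in>A. I i (- Z)) + (\<Sum>i\<in>A. I i (Z - A))"
      proof -
        have "I i (- A) = I i (- Z) + I i (Z - A)" for i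
        proof -
          have "I i (- Z \<union> (Z - A)) = I i (- Z) + I i (Z - A)" by (rule I_Un) auto
          moreover have "- Z \<union> (Z - A) = - A" by (auto simp: A_def)
          ultimately show ?thesis by (simp only:)
        qed
        then show ?thesis by (simp add: sum.distrib)
      qed
      also have "\<dots> \<le> 2 * (\<Sum>i\<in>A. I i (Z - A))"
      proof -
        have "cube x (2 * r) \<subseteq> cube x (2 ^ K)"
          unfolding r(2) using Suc.prems by (intro cube_mono power_increasing) auto
        then have "A \<subseteq> Z \<inter> cube x (2 ^ K)" using A(2) by blast
        from stable[OF A(1) this] show ?thesis by simp
      qed
      also have "(\<Sum>i\<in>A. I i (Z - A)) \<le> (\<Sum>i\<in>A. I i (- cube x t))"
        by (intro sum_mono I_mono) (auto simp: A_def)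
      finally show ?thesis unfolding A(2) by simp
    qed
    have "real r * (V1 * (L * (\<eta> * real r) powr (- s)))
        \<le> (\<Sum>t\<in>{r<..2 * r}. 2 * (\<Sum>i\<in>Z \<inter> cube x (2 * r) \<inter> cube x t. I i (- cube x t)))"
      using sum_bounded_below[of "{r<..2 * r}", OF per_t] by simp
    also have "\<dots> = 2 * (\<Sum>t\<in>{r<..2 * r}. \<Sum>i\<in>Z \<inter> cube x (2 * r) \<inter> cube x t. I i (- cube x t))"
      by (simp only: sum_distrib_left)
    also have "\<dots> \<le> 2 * (V2 * (\<Sum>n\<in>{1..2 * r + 1}. C * real n powr (- s)))"
      unfolding V2_def
      by (rule mult_left_mono[OF tail_average[OF tail]]) (simp_all add: finite_cube)
    also have "\<dots> \<le> 2 * (V2 * (3 * C / (1 - s) * real r powr (1 - s)))"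
      using sum_tail_le[OF s _ r(1), of C] C by (intro mult_left_mono) (auto simp: V2_def)
    also have "\<dots> = V2 * a * real r powr (1 - s)" by (simp add: a_def)
    also have "real r * (V1 * (L * (\<eta> * real r) powr (- s))) = V1 * (L * \<eta> powr (- s)) * real r powr (1 - s)"
    proof -
      have "real r * real r powr (- s) = real r powr (1 - s)"
        using r by (simp add: powr_diff powr_minus divide_inverse)
      then show ?thesis using \<eta> by (simp add: powr_mult algebra_simps)
    qed
    finally have "V1 * (L * \<eta> powr (- s)) \<le> V2 * a" using r by simp
    moreover have "V1 * (2 ^ ?d * a) \<le> V1 * (L * \<eta> powr (- s))"
      using \<eta>(3) by (intro mult_left_mono) (auto simp: L_def a_def V1_def)
    ultimately have "(V1 * 2 ^ ?d) * a \<le> V2 * a" by (simp add: mult.assoc)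
    then have "V1 * 2 ^ ?d \<le> V2" using a by simp
    moreover have "(\<eta> * real r) ^ ?d / 2 = \<eta> ^ ?d / 2 ^ (?d + 1) * real r ^ ?d * 2 ^ ?d"
      by (simp add: power_mult_distrib)
    moreover have "\<dots> \<le> V1 * 2 ^ ?d" using IH by (rule mult_right_mono) simp
    ultimately show False using V2 by linarith
  qed
qed

lemma local_minD:
  assumes "local_min S X" "finite A" "A \<subseteq> S"
  shows "A \<inter> X = {} \<Longrightarrow> 0 \<le> delta UNIV A X" "A \<subseteq> X \<Longrightarrow> delta UNIV A (X - A) \<le> 0"
  using assms unfolding local_min_def by simp_all

text \<open>By \<open>density\<close>, applied to \<open>X\<close> and to its complement, a mixed
  cell has at least \<open>W\<close> sites of each sign and hence energy \<open>W * (W * E)\<close>,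
  of order \<open>\<tau> powr (d - s)\<close>. The surface term has the same order in
  \<open>\<tau>\<close>, so \<open>\<tau>\<close> cancels and only \<open>p\<close> must be large;
  hence a strip width linear in \<open>\<tau>\<close>.\<close>

lemma pure_radius_power_law:
  assumes h: "\<And>i. h i = 0"
    and low: "\<And>i j. i \<noteq> j \<Longrightarrow> lam * real_of_int (l1 (i - j)) powr (- real CARD('a) - s) \<le> J i j"
    and lam: "0 < lam" and s: "0 < s" "s < 1"
    and tail: "\<And>i n. 1 \<le> n \<Longrightarrow> I i (far i n) \<le> C * real n powr (- s)" and C: "0 < C"
    and \<eta>: "0 < \<eta>" "\<eta> \<le> 1"
      "2 ^ CARD('a) * (6 * C / (1 - s)) \<le> lam / 2 * real CARD('a) powr (- real CARD('a) - s) * \<eta> powr (- s)"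
    and p: "1 \<le> p"
      "15 ^ CARD('a) * (3 * C / (1 - s)) * (3 * real p) powr (- s) <
        (\<eta> ^ CARD('a) / 2 ^ (CARD('a) + 1)) ^ 2 * lam * (3 * real CARD('a)) powr (- real CARD('a) - s) / 2 ^ CARD('a)"
  shows "pure_radius (2 * (3 * \<tau> * p))"
proof -
  let ?d = "CARD('a)"
  define \<epsilon> where "\<epsilon> = \<eta> ^ ?d / 2 ^ (?d + 1)"
  have \<epsilon>: "0 < \<epsilon>" using \<eta> by (simp add: \<epsilon>_def)
  define T where "T = real \<tau>"
  have T: "1 \<le> T" using tau_pos by (simp add: T_def)
  \<comment> \<open>The half comes from using radii \<open>2 ^ k\<close> with
    \<open>2 ^ k \<le> \<tau> < 2 ^ (k + 1)\<close>.\<close>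
  define W where "W = \<epsilon> * (T / 2) ^ ?d"
  have W: "0 < W" using \<epsilon> T by (simp add: W_def)
  \<comment> \<open>Two sites of one cell of side \<open>3 * \<tau>\<close> have \<open>l1\<close>
    distance at most \<open>3 * d * \<tau>\<close>, so \<open>E\<close> bounds their coupling from
    below.\<close>
  define E where "E = lam * (3 * real ?d * T) powr (- real ?d - s)"
  have E: "0 \<le> E" using lam by (simp add: E_def)
  show ?thesis
  proof (rule pure_radius_criterion[OF tail, where \<mu> = 0 and \<kappa> = "W * (W * E)" and p = p])
    show "\<bar>h i\<bar> \<le> 0" for i by (simp add: h)
    show "1 \<le> p" by (rule p(1))
  next
    fix x X c
    assume X: "local_min (cube x (2 * (3 * \<tau> * p))) X" and c: "cell (3 * \<tau>) c \<subseteq> cube x (2 * (3 * \<tau> * p))"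
      and mixed: "\<not> inner_cell c \<subseteq> X" "inner_cell c \<inter> X \<noteq> {}"
    obtain k where k: "2 ^ k \<le> \<tau>" "\<tau> < 2 ^ (k + 1)" using ex_power_ivl1[of 2 \<tau>] tau_pos by auto
    have ball: "cube a (2 ^ k) \<subseteq> cell (3 * \<tau>) c" if "a \<in> inner_cell c" for a
    proof
      fix i assume i: "i \<in> cube a (2 ^ k)"
      have "c $ n \<le> i $ n \<and> i $ n < c $ n + int (3 * \<tau>)" for n
      proof -
        have "\<bar>i $ n - a $ n\<bar> \<le> int (2 ^ k)" using i by (simp add: cube_def)
        moreover have "int (2 ^ k) \<le> int \<tau>" using k(1) by (simp only: of_nat_le_iff)
        moreover have "c $ n + int \<tau> \<le> a $ n \<and> a $ n < c $ n + int \<tau> + int \<tau>"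
          using that by (simp add: inner_cell_def cell_def)
        ultimately show ?thesis unfolding of_nat_mult of_nat_numeral by linarith
      qed
      then show "i \<in> cell (3 * \<tau>) c" by (simp add: cell_def)
    qed
    have dens: "W \<le> real (card (Z \<inter> cube a (2 ^ k)))"
      if a: "a \<in> Z" "a \<in> inner_cell c"
        and stable: "\<And>A. finite A \<Longrightarrow> A \<subseteq> Z \<inter> cube a (2 ^ k) \<Longrightarrow> (\<Sum>i\<in>A. I i (- Z)) \<le> (\<Sum>i\<in>A. I i (Z - A))"
      for Z a
    proof -
      have "\<tau> \<le> 2 * 2 ^ k" using k(2) by simp
      then have "real \<tau> \<le> real (2 * 2 ^ k)" by (simp only: of_nat_le_iff)
      then have "T / 2 \<le> 2 ^ k" by (simp add: T_def)
      then have "W \<le> \<epsilon> * (2 ^ k) ^ ?d"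
        unfolding W_def using \<epsilon> T by (intro mult_left_mono power_mono) auto
      also have "\<dots> \<le> real (card (Z \<inter> cube a (2 ^ k)))"
        unfolding \<epsilon>_def by (rule density[OF low lam s tail C \<eta> a(1) stable order_refl])
      finally show ?thesis .
    qed
    obtain a where a: "a \<in> X" "a \<in> inner_cell c" using mixed(2) by blast
    obtain b where b: "b \<in> - X" "b \<in> inner_cell c" using mixed(1) by blast
    have plus: "W \<le> real (card (X \<inter> cube a (2 ^ k)))"
    proof (rule dens[OF a])
      fix A assume A: "finite A" "A \<subseteq> X \<inter> cube a (2 ^ k)"
      have "A \<subseteq> cube x (2 * (3 * \<tau> * p))" using A(2) ball[OF a(2)] c by (meson Int_subset_iff order_trans)
      then have "delta UNIV A (X - A) \<le> 0" using A by (intro local_minD(2)[OF X]) auto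
      moreover have eq: "A \<union> (X - A) = X" using A(2) by auto
      have "delta UNIV A (X - A) = (\<Sum>i\<in>A. I i (- X)) - (\<Sum>i\<in>A. I i (X - A))"
        unfolding delta_def eq by (simp add: h sum_subtractf)
      ultimately show "(\<Sum>i\<in>A. I i (- X)) \<le> (\<Sum>i\<in>A. I i (X - A))" by simp
    qed
    have minus: "W \<le> real (card (- X \<inter> cube b (2 ^ k)))"
    proof (rule dens[OF b])
      fix A assume A: "finite A" "A \<subseteq> - X \<inter> cube b (2 ^ k)"
      have "A \<inter> X = {}" using A(2) by blast
      moreover have "A \<subseteq> cube x (2 * (3 * \<tau> * p))" using A(2) ball[OF b(2)] c by (meson Int_subset_iff order_trans)
      ultimately have "0 \<le> delta UNIV A X" by (intro local_minD(1)[OF X A(1)])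
      moreover have eq: "- (A \<union> X) = - X - A" by auto
      have "delta UNIV A X = (\<Sum>i\<in>A. I i (- X - A)) - (\<Sum>i\<in>A. I i X)"
        unfolding delta_def eq by (simp add: h sum_subtractf)
      ultimately show "(\<Sum>i\<in>A. I i (- (- X))) \<le> (\<Sum>i\<in>A. I i (- X - A))" by simp
    qed
    have point: "W * E \<le> I i X" if i: "i \<in> - X \<inter> cube b (2 ^ k)" for i
    proof -
      define B where "B = X \<inter> cube a (2 ^ k)"
      have B: "finite B" by (simp add: B_def finite_cube)
      have "W * E \<le> real (card B) * E" using plus E unfolding B_def by (rule mult_right_mono)
      also have "\<dots> \<le> sum (J i) B"
      proof (rule sum_bounded_below)
        fix j assume j: "j \<in> B"
        then have "i \<noteq> j" using i by (auto simp: B_def)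
        have ij: "i \<in> cell (3 * \<tau>) c" "j \<in> cell (3 * \<tau>) c"
          using ball[OF a(2)] ball[OF b(2)] i j by (auto simp: B_def)
        have "linf (i - j) \<le> int (3 * \<tau>)"
          unfolding linf_le_iff
        proof
          fix n
          have "c $ n \<le> i $ n \<and> i $ n < c $ n + int (3 * \<tau>)" "c $ n \<le> j $ n \<and> j $ n < c $ n + int (3 * \<tau>)"
            using ij unfolding cell_def by blast+
          then show "\<bar>(i - j) $ n\<bar> \<le> int (3 * \<tau>)" unfolding vector_minus_component by linarith
        qed
        then have "int ?d * linf (i - j) \<le> int ?d * int (3 * \<tau>)" by (rule mult_left_mono) simp
        with l1_le_linf[of "i - j"] have "l1 (i - j) \<le> int ?d * int (3 * \<tau>)" by (rule order_trans)
        then have "real_of_int (l1 (i - j)) \<le> real_of_int (int ?d * int (3 * \<tau>))" by (simp only: of_int_le_iff)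
        also have "\<dots> = 3 * real ?d * T" by (simp add: T_def)
        finally have "(3 * real ?d * T) powr (- real ?d - s) \<le> real_of_int (l1 (i - j)) powr (- real ?d - s)"
          using s l1_pos[of "i - j"] \<open>i \<noteq> j\<close> by (intro powr_mono2') auto
        then show "E \<le> J i j"
          unfolding E_def using low[OF \<open>i \<noteq> j\<close>] lam by (meson less_imp_le mult_left_mono order_trans)
      qed
      also have "\<dots> = I i B" using B by (simp add: I_def)
      also have "\<dots> \<le> I i X" by (rule I_mono) (simp add: B_def)
      finally show ?thesis .
    qed
    have "W * (W * E) \<le> real (card (- X \<inter> cube b (2 ^ k))) * (W * E)"
      using minus W E by (intro mult_right_mono) auto
    also have "\<dots> \<le> (\<Sum>i\<in>- X \<inter> cube b (2 ^ k). I i X)" by (rule sum_bounded_below) (rule point)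
    also have "\<dots> \<le> (\<Sum>i\<in>cell (3 * \<tau>) c \<inter> - X. I i X)"
      using ball[OF b(2)] by (intro sum_mono2) (auto simp: finite_cell I_nonneg)
    finally show "W * (W * E) \<le> (\<Sum>i\<in>cell (3 * \<tau>) c \<inter> - X. I i X)" .
  next
    define r where "r = 3 * \<tau> * p"
    define q where "q = 3 * C / (1 - s)"
    have q: "0 < q" using C s by (simp add: q_def)
    have r: "1 \<le> r" using tau_pos p(1) by (simp add: r_def)
    have rT: "real r = 3 * real p * T" by (simp add: r_def T_def)
    have P: "1 \<le> real p" using p(1) by simp
    define S where "S = (\<Sum>n\<in>{1..2 * r + 1}. C * real n powr (- s))"
    have "S / real r \<le> q * real r powr (1 - s) / real r"
      unfolding S_def q_def using sum_tail_le[OF s _ r, of C] C by (intro divide_right_mono) auto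
    also have "\<dots> = q * real r powr (- s)" using r by (simp add: powr_diff powr_minus divide_inverse)
    also have "real r powr (- s) = (3 * real p) powr (- s) * T powr (- s)" using P T unfolding rT by (simp add: powr_mult)
    finally have "(5 * real r) ^ ?d * (S / real r) \<le> (5 * real r) ^ ?d * (q * ((3 * real p) powr (- s) * T powr (- s)))"
      by (rule mult_left_mono) simp
    also have "5 * real r = 15 * real p * T" by (simp add: rT)
    also have "(15 * real p * T) ^ ?d * (q * ((3 * real p) powr (- s) * T powr (- s))) =
        (15 ^ ?d * q * (3 * real p) powr (- s)) * (real p ^ ?d * T ^ ?d * T powr (- s))"
      by (simp only: power_mult_distrib mult_ac)
    also have "\<dots> < (\<epsilon> ^ 2 * lam * (3 * real ?d) powr (- real ?d - s) / 2 ^ ?d) * (real p ^ ?d * T ^ ?d * T powr (- s))"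
      using p(2) P T unfolding \<epsilon>_def q_def by (intro mult_strict_right_mono) auto
    also have "\<dots> = W * (W * E) * (2 * real p) ^ ?d"
    proof -
      have "T powr (- s) = T ^ ?d * T powr (- real ?d - s)" using T by (subst powr_dim_split) auto
      moreover have "(3 * real ?d * T) powr (- real ?d - s) = (3 * real ?d) powr (- real ?d - s) * T powr (- real ?d - s)"
        using T by (simp add: powr_mult)
      ultimately show ?thesis
        by (simp add: W_def E_def power_mult_distrib power_divide power2_eq_square field_simps)
    qed
    finally have "(15 * real p * T) ^ ?d * (S / real r) < W * (W * E) * (2 * real p) ^ ?d" .
    moreover have "15 * real p * T = 5 * real r" by (simp add: rT)
    ultimately have "(5 * real r) ^ ?d * (S / real r + 0 / 2) < W * (W * E) * (2 * real p) ^ ?d"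
      by (simp only: div_0 add_0_right)
    then show "(5 * real (3 * \<tau> * p)) ^ ?d * ((\<Sum>n = 1..2 * (3 * \<tau> * p) + 1. C * real n powr (- s)) / real (3 * \<tau> * p) + 0 / 2)
        < W * (W * E) * (2 * real p) ^ ?d"
      unfolding S_def r_def .
  qed simp_all
qed

section \<open>Uniform tails and the choice of the constants\<close>

lemma sigma_upper:
  assumes "\<And>i. I i UNIV \<le> \<Lambda>"
  shows "I i (far i n) \<le> sigma J n"
proof -
  have "bdd_above (range (\<lambda>i. I i (far i n)))"
    using I_mono[OF subset_UNIV] assms by (intro bdd_aboveI2[of _ _ \<Lambda>]) (meson order_trans)
  then have "I i (far i n) \<le> (SUP i. I i (far i n))" by (rule cSUP_upper[OF UNIV_I])
  then show ?thesis by (simp add: sigma_def I_def)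
qed

lemma sigma_le: "(\<And>i. I i (far i n) \<le> e) \<Longrightarrow> sigma J n \<le> e"
  unfolding sigma_def by (rule cSUP_least) (auto simp: I_def)

text \<open>Each tail vanishes by summability, and invariance under \<open>lat \<tau>\<close>
  reduces the supremum to the finitely many sites of one cell.\<close>

lemma sigma_small:
  assumes "0 < e"
  shows "\<exists>n0. \<forall>n\<ge>n0. sigma J n \<le> e"
proof -
  obtain F where F: "\<And>c. finite (F c)" "\<And>c. I c (- F c) \<le> e" using I_tail[OF assms] by metis
  define n0 where "n0 = nat (\<Sum>c\<in>cell \<tau> 0. \<Sum>j\<in>F c. linf (j - c)) + 1"
  have far: "far c n \<subseteq> - F c" if "c \<in> cell \<tau> 0" "n0 \<le> n" for c n
  proof
    fix j assume "j \<in> far c n"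
    then have j: "int n \<le> linf (j - c)" by simp
    show "j \<in> - F c"
    proof
      assume "j \<in> F c"
      then have "linf (j - c) \<le> (\<Sum>j\<in>F c. linf (j - c))"
        by (intro member_le_sum) (auto simp: linf_nonneg F)
      also have "\<dots> \<le> (\<Sum>c\<in>cell \<tau> 0. \<Sum>j\<in>F c. linf (j - c))"
        by (rule member_le_sum[OF that(1)]) (auto intro: sum_nonneg simp: linf_nonneg finite_cell)
      finally have "linf (j - c) < int n0" unfolding n0_def by linarith
      then show False using j that(2) by linarith
    qed
  qed
  show ?thesis
  proof (intro exI allI impI sigma_le)
    fix n and i :: "int^'a" assume n: "n0 \<le> n"
    obtain k where k: "k \<in> lat \<tau>" "i - k \<in> cell \<tau> 0" using cell_lat[OF tau_pos] by blast
    have "far i n = translate k (far (i - k) n)" by (auto simp: algebra_simps)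
    then have "I i (far i n) = I (i - k) (far (i - k) n)"
      using I_translate[OF k(1), of "i - k" "far (i - k) n"] by simp
    also have "\<dots> \<le> I (i - k) (- F (i - k))" by (rule I_mono[OF far[OF k(2) n]])
    finally show "I i (far i n) \<le> e" using F(2) by (rule order_trans)
  qed
qed

end

lemma fund_domain_cell:
  assumes "\<tau> \<ge> 1"
  shows "fund_domain \<tau> (cell \<tau> c)"
  unfolding fund_domain_def
proof
  fix i
  obtain k where k: "k \<in> lat \<tau>" "i - k \<in> cell \<tau> c" using cell_lat[OF assms] by blast
  show "\<exists>!f. f \<in> cell \<tau> c \<and> lat_cong \<tau> i f"
  proof (rule ex1I[of _ "i - k"])
    show "i - k \<in> cell \<tau> c \<and> lat_cong \<tau> i (i - k)" using k by (simp add: lat_cong_def lat_def)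
    fix f assume f: "f \<in> cell \<tau> c \<and> lat_cong \<tau> i f"
    have "f $ n = (i - k) $ n" for n
    proof -
      have "int \<tau> dvd i $ n - f $ n" using f unfolding lat_cong_def by blast
      moreover have "int \<tau> dvd k $ n" using k(1) unfolding lat_def by blast
      ultimately have "int \<tau> dvd (i $ n - f $ n) - k $ n" by (rule dvd_diff)
      moreover have "(i $ n - f $ n) - k $ n = (i - k) $ n - f $ n" by simp
      ultimately have "int \<tau> dvd \<bar>(i - k) $ n - f $ n\<bar>" by (simp only: dvd_abs_iff)
      moreover have "\<bar>(i - k) $ n - f $ n\<bar> < int \<tau>"
      proof -
        have "c $ n \<le> (i - k) $ n \<and> (i - k) $ n < c $ n + int \<tau>" "c $ n \<le> f $ n \<and> f $ n < c $ n + int \<tau>"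
          using f k(2) unfolding cell_def by blast+
        then show ?thesis by linarith
      qed
      ultimately have "\<bar>(i - k) $ n - f $ n\<bar> = 0" using zdvd_imp_le by fastforce
      then show ?thesis by simp
    qed
    then show "f = i - k" unfolding vec_eq_iff by blast
  qed
qed

lemma spin_model_of_conds:
  assumes J: "J_conds lam \<Lambda> \<tau> J" and h: "h_conds \<mu> \<tau> h" and \<tau>: "\<tau> \<ge> 1"
  shows "spin_model J h \<tau>"
proof unfold_locales
  show "0 \<le> J i j" "J i j = J j i" "J i summable_on UNIV" for i j
    using J unfolding J_conds_def by blast+
  show "J (i + k) (j + k) = J i j" if "k \<in> lat \<tau>" for i j k
  proof -
    have "i + k - i = j + k - j \<and> lat_cong \<tau> (i + k) i" using that by (simp add: lat_cong_def lat_def)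
    then show ?thesis using J unfolding J_conds_def by blast
  qed
  show "h (i + k) = h i" if "k \<in> lat \<tau>" for i k
  proof -
    have "lat_cong \<tau> (i + k) i" using that by (simp add: lat_cong_def lat_def)
    then show ?thesis using h unfolding h_conds_def by blast
  qed
  show "subgrp (lat \<tau>)" by (rule lat_subgrp)
  show "1 \<le> \<tau>" by (rule \<tau>)
  show "sum h (cell \<tau> c) = 0" for c using h fund_domain_cell[OF \<tau>] unfolding h_conds_def by blast
qed

lemma cesaro_bound:
  fixes \<sigma> :: "nat \<Rightarrow> real"
  assumes bound: "\<And>n. \<sigma> n \<le> B" and B: "0 \<le> B" and small: "\<And>n. n0 \<le> n \<Longrightarrow> \<sigma> n \<le> e" and e: "0 \<le> e"
  shows "(\<Sum>n\<in>{1..m}. \<sigma> n) \<le> B * real n0 + e * real m"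
proof -
  have "(\<Sum>n\<in>{1..m}. \<sigma> n) \<le> (\<Sum>n\<in>{1..m}. (if n < n0 then B else 0) + e)"
  proof (rule sum_mono)
    fix n
    show "\<sigma> n \<le> (if n < n0 then B else 0) + e"
      using bound[of n] small[of n] e by (cases "n < n0") auto
  qed
  also have "\<dots> = B * real (card {n\<in>{1..m}. n < n0}) + e * real m"
    by (simp add: sum.distrib sum.If_cases Int_def)
  also have "card {n\<in>{1..m}. n < n0} \<le> card {..<n0}" by (rule card_mono) auto
  finally show ?thesis using B by (simp add: mult_left_mono)
qed

text \<open>The width has to be fixed before \<open>J\<close> is known. The scale \<open>p\<close>
  is therefore selected by a condition on \<open>\<sigma>\<close> and \<open>\<theta>\<close> alone;
  a given \<open>J\<close> with \<open>sigma J = \<sigma>\<close> then shows that such a scale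
  exists.\<close>

lemma ground_states_short_range:
  fixes \<sigma> :: "nat \<Rightarrow> real"
  assumes \<tau>: "\<tau> \<ge> 1" and lam: "lam > 0"
  shows "\<exists>M>0. \<forall>(J::int^'d \<Rightarrow> int^'d \<Rightarrow> real) (h::int^'d \<Rightarrow> real) \<mu>.
    J_conds lam \<Lambda> \<tau> J \<longrightarrow> sigma J = \<sigma> \<longrightarrow> 0 < \<mu> \<longrightarrow> \<mu> \<le> lam * (2 / (15 * real \<tau>)) ^ CARD('d) \<longrightarrow>
    h_conds \<mu> \<tau> h \<longrightarrow> (\<forall>w::real^'d. w \<noteq> 0 \<longrightarrow> (\<exists>u. ground_state J h u \<and> planelike M w u))"
proof -
  \<comment> \<open>With \<open>r = 3 * \<tau> * p\<close> one has
    \<open>5 * r = 15 * \<tau> * p\<close>, so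
    \<open>(5 * r) ^ d * \<theta> = lam * (2 * p) ^ d\<close> for every \<open>p\<close>. Half of
    \<open>\<theta>\<close> is spent on the averaged tail, half on \<open>\<mu> / 2\<close>.\<close>
  define \<theta> where "\<theta> = lam * (2 / (15 * real \<tau>)) ^ CARD('d)"
  have \<theta>: "0 < \<theta>" using lam \<tau> by (simp add: \<theta>_def)
  define good where "good p \<longleftrightarrow> 1 \<le> p \<and>
    (\<Sum>n\<in>{1..2 * (3 * \<tau> * p) + 1}. \<sigma> n) / real (3 * \<tau> * p) < \<theta> / 2" for p
  define p where "p = (SOME p. good p)"
  define D where "D = 2 * (3 * \<tau> * p)"
  have M: "0 < real (2 * D + 6 * \<tau>)" using \<tau> by simp
  show ?thesis
  proof (rule exI[of _ "real (2 * D + 6 * \<tau>)"], intro conjI M allI impI)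
    fix J :: "int^'d \<Rightarrow> int^'d \<Rightarrow> real" and h :: "int^'d \<Rightarrow> real" and \<mu> and w :: "real^'d"
    assume J: "J_conds lam \<Lambda> \<tau> J" and \<sigma>: "sigma J = \<sigma>" and \<mu>: "0 < \<mu>" "\<mu> \<le> lam * (2 / (15 * real \<tau>)) ^ CARD('d)"
      and h: "h_conds \<mu> \<tau> h" and w: "w \<noteq> 0"
    interpret spin_model J h \<tau> by (rule spin_model_of_conds[OF J h \<tau>])
    have total: "I i UNIV \<le> \<Lambda>" for i using J unfolding J_conds_def I_def by blast
    have tail: "I i (far i n) \<le> \<sigma> n" for i n using sigma_upper[OF total] unfolding \<sigma> .
    have \<Lambda>: "0 \<le> \<Lambda>" using total[of 0] I_nonneg[of 0 UNIV] by linarith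
    have \<sigma>_le: "\<sigma> n \<le> \<Lambda>" for n
      unfolding \<sigma>[symmetric] by (rule sigma_le, rule order_trans[OF I_mono[OF subset_UNIV] total])
    have "\<exists>p. good p"
    proof -
      \<comment> \<open>Since \<open>2 * r + 1 \<le> 3 * r\<close>, the late terms contribute at
        most \<open>\<theta> / 4 * r\<close>; \<open>m\<close> is chosen so that the early ones stay
        below the same amount.\<close>
      obtain n0 where n0: "\<And>n. n0 \<le> n \<Longrightarrow> \<sigma> n \<le> \<theta> / 12"
        using sigma_small[of "\<theta> / 12"] \<theta> unfolding \<sigma> by auto
      obtain m :: nat where m: "4 * \<Lambda> * real n0 / \<theta> < real m" using reals_Archimedean2 by blast
      define r where "r = 3 * \<tau> * Suc m"
      have "1 * Suc m \<le> r" unfolding r_def by (rule mult_right_mono) (use \<tau> in auto)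
      then have r: "real m < real r" "1 \<le> real r" by auto
      have "(\<Sum>n\<in>{1..2 * r + 1}. \<sigma> n) \<le> \<Lambda> * real n0 + \<theta> / 12 * real (2 * r + 1)"
        by (rule cesaro_bound[OF \<sigma>_le \<Lambda> n0]) (use \<theta> in auto)
      also have "\<theta> / 12 * real (2 * r + 1) \<le> \<theta> / 12 * (3 * real r)"
        using \<theta> r by (intro mult_left_mono) auto
      also have "\<Lambda> * real n0 < \<theta> / 4 * real r"
      proof -
        have "4 * \<Lambda> * real n0 < real m * \<theta>" using m by (simp only: pos_divide_less_eq[OF \<theta>])
        also have "\<dots> < real r * \<theta>" by (rule mult_strict_right_mono[OF r(1) \<theta>])
        finally show ?thesis by (simp add: mult_ac)
      qed
      finally have "(\<Sum>n\<in>{1..2 * r + 1}. \<sigma> n) < \<theta> / 2 * real r" by simp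
      then have "good (Suc m)" unfolding good_def r_def[symmetric] using r by (simp add: pos_divide_less_eq)
      then show ?thesis by blast
    qed
    then have p: "good p" unfolding p_def by (rule someI_ex)
    have "pure_radius (2 * (3 * \<tau> * p))"
    proof (rule pure_radius_short_range[OF _ tail _ _ refl])
      show "lam \<le> J i j" if "l1 (i - j) = 1" for i j using J that unfolding J_conds_def by blast
      show "\<bar>h i\<bar> \<le> \<mu>" for i using h unfolding h_conds_def by blast
      show p1: "1 \<le> p" using p by (simp add: good_def)
      define R where "R = 5 * real (3 * \<tau> * p)"
      have R: "0 < R" "R = 15 * real \<tau> * real p" using \<tau> p1 by (simp_all add: R_def)
      have "R ^ CARD('d) * ((\<Sum>n\<in>{1..2 * (3 * \<tau> * p) + 1}. \<sigma> n) / real (3 * \<tau> * p) + \<mu> / 2) < R ^ CARD('d) * \<theta>"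
      proof (rule mult_strict_left_mono)
        have "(\<Sum>n\<in>{1..2 * (3 * \<tau> * p) + 1}. \<sigma> n) / real (3 * \<tau> * p) < \<theta> / 2"
          using p unfolding good_def by (rule conjunct2)
        moreover have "\<mu> / 2 \<le> \<theta> / 2" using \<mu>(2) unfolding \<theta>_def[symmetric] by (rule divide_right_mono) simp
        ultimately have "(\<Sum>n\<in>{1..2 * (3 * \<tau> * p) + 1}. \<sigma> n) / real (3 * \<tau> * p) + \<mu> / 2 < \<theta> / 2 + \<theta> / 2"
          by (rule add_less_le_mono)
        then show "(\<Sum>n\<in>{1..2 * (3 * \<tau> * p) + 1}. \<sigma> n) / real (3 * \<tau> * p) + \<mu> / 2 < \<theta>"
          by (simp only: field_sum_of_halves)
      qed (use R(1) in simp)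
      also have "\<dots> = lam * (2 * real p) ^ CARD('d)"
        unfolding R(2) \<theta>_def using \<tau> by (simp add: power_mult_distrib power_divide)
      finally show "(5 * real (3 * \<tau> * p)) ^ CARD('d) *
          ((\<Sum>n\<in>{1..2 * (3 * \<tau> * p) + 1}. \<sigma> n) / real (3 * \<tau> * p) + \<mu> / 2) < lam * (2 * real p) ^ CARD('d)"
        unfolding R_def .
    qed
    then show "\<exists>u. ground_state J h u \<and> planelike (real (2 * D + 6 * \<tau>)) w u"
      unfolding D_def by (rule planelike_exists[OF _ w])
  qed
qed

lemma small_powr:
  fixes b s :: real
  assumes "0 < b" "0 < s"
  shows "\<exists>p::nat. 1 \<le> p \<and> (3 * real p) powr (- s) < b"
proof -
  have "((\<lambda>n. (3 * real n) powr (- s)) \<longlongrightarrow> 0) sequentially"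
    using assms by real_asymp
  then have "\<forall>\<^sub>F n in sequentially. (3 * real n) powr (- s) < b \<and> 1 \<le> n"
    using assms by (intro eventually_conj order_tendstoD(2) eventually_ge_at_top)
  then show ?thesis using eventually_happens by force
qed

text \<open>All constants down to \<open>p\<close> are fixed before \<open>\<tau>\<close> and
  \<open>J\<close>, which is possible because the criterion of \<open>pure_radius_power_law\<close>
  does not involve \<open>\<tau>\<close>.\<close>

lemma ground_states_power_law:
  assumes lam: "lam > 0" and \<Lambda>: "\<Lambda> \<ge> lam" and s: "0 < s" "s < 1"
  shows "\<exists>M0>0. \<forall>\<tau> (J::int^'d \<Rightarrow> int^'d \<Rightarrow> real). \<tau> \<ge> 1 \<longrightarrow> J_conds lam \<Lambda> \<tau> J \<longrightarrow> JP s lam \<Lambda> J \<longrightarrow>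
    (\<forall>w::real^'d. w \<noteq> 0 \<longrightarrow> (\<exists>u. ground_state J (\<lambda>_. 0) u \<and> planelike (M0 * real \<tau>) w u))"
proof -
  let ?d = "CARD('d)"
  define C where "C = \<Lambda> * 5 ^ ?d / (1 - 2 powr (- s))"
  have "2 powr (- s) < 2 powr 0" using s by (intro powr_less_mono) auto
  then have C: "0 < C" using lam \<Lambda> by (simp add: C_def)
  define a where "a = lam / 2 * real ?d powr (- real ?d - s)"
  have a: "0 < a" using lam by (simp add: a_def)
  define b where "b = 2 ^ ?d * (6 * C / (1 - s))"
  have b: "0 < b" using C s by (simp add: b_def)
  \<comment> \<open>The solution of \<open>b = a * \<eta> powr (- s)\<close>, truncated at
    1.\<close>
  define \<eta> where "\<eta> = min 1 ((b / a) powr (- 1 / s))"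
  have \<eta>: "0 < \<eta>" "\<eta> \<le> 1" using a b by (auto simp: \<eta>_def)
  have "b \<le> a * \<eta> powr (- s)"
  proof -
    have "b / a = ((b / a) powr (- 1 / s)) powr (- s)" using a b s by (simp add: powr_powr)
    also have "\<dots> \<le> \<eta> powr (- s)" using \<eta> s by (intro powr_mono2') (auto simp: \<eta>_def)
    finally show ?thesis using a by (simp add: pos_divide_le_eq mult.commute)
  qed
  then have \<eta>3: "2 ^ ?d * (6 * C / (1 - s)) \<le> lam / 2 * real ?d powr (- real ?d - s) * \<eta> powr (- s)"
    unfolding a_def b_def .
  define A where "A = 15 ^ ?d * (3 * C / (1 - s))"
  have A: "0 < A" using C s by (simp add: A_def)
  define B where "B = (\<eta> ^ ?d / 2 ^ (?d + 1)) ^ 2 * lam * (3 * real ?d) powr (- real ?d - s) / 2 ^ ?d"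
  have B: "0 < B" using \<eta> lam by (simp add: B_def)
  obtain p :: nat where p: "1 \<le> p" "(3 * real p) powr (- s) < B / A"
    using small_powr[of "B / A" s] A B s by auto
  have p2: "15 ^ ?d * (3 * C / (1 - s)) * (3 * real p) powr (- s) <
      (\<eta> ^ ?d / 2 ^ (?d + 1)) ^ 2 * lam * (3 * real ?d) powr (- real ?d - s) / 2 ^ ?d"
    unfolding A_def[symmetric] B_def[symmetric] using p(2) A by (simp add: pos_less_divide_eq mult.commute)
  \<comment> \<open>For \<open>D = 6 * \<tau> * p\<close> the width
    \<open>2 * D + 6 * \<tau>\<close> equals \<open>(12 * p + 6) * \<tau>\<close>.\<close>
  define M0 where "M0 = 12 * real p + 6"
  show ?thesis
  proof (rule exI[of _ M0], intro conjI allI impI)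
    show "0 < M0" by (simp add: M0_def)
    fix \<tau> and J :: "int^'d \<Rightarrow> int^'d \<Rightarrow> real" and w :: "real^'d"
    assume \<tau>: "\<tau> \<ge> 1" and J: "J_conds lam \<Lambda> \<tau> J" and JP: "JP s lam \<Lambda> J" and w: "w \<noteq> 0"
    have "h_conds 1 \<tau> (\<lambda>_::int^'d. 0)" by (simp add: h_conds_def)
    then interpret spin_model J "\<lambda>_. 0" \<tau> by (rule spin_model_of_conds[OF J _ \<tau>])
    have low: "lam * real_of_int (l1 (i - j)) powr (- real ?d - s) \<le> J i j"
      and up: "J i j \<le> \<Lambda> * real_of_int (l1 (i - j)) powr (- real ?d - s)" if "i \<noteq> j" for i j
      using JP that unfolding JP_def by blast+
    have tail: "I i (far i n) \<le> C * real n powr (- s)" if "1 \<le> n" for i n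
      unfolding C_def by (rule tail_power_law[OF up _ s(1) that]) (use lam \<Lambda> in auto)
    have "pure_radius (2 * (3 * \<tau> * p))"
      by (rule pure_radius_power_law[OF refl low lam s tail C \<eta> \<eta>3 p(1) p2])
    then have "\<exists>u. ground_state J (\<lambda>_. 0) u \<and> planelike (real (2 * (2 * (3 * \<tau> * p)) + 6 * \<tau>)) w u"
      by (rule planelike_exists[OF _ w])
    moreover have "real (2 * (2 * (3 * \<tau> * p)) + 6 * \<tau>) = M0 * real \<tau>"
      by (simp add: M0_def algebra_simps)
    ultimately show "\<exists>u. ground_state J (\<lambda>_. 0) u \<and> planelike (M0 * real \<tau>) w u" by (simp only:)
  qed
qed

theorem theorem1p1:
  assumes "CARD('d::finite) \<ge> 2"
  shows
  "(\<forall>(\<tau>::nat) (lam::real). \<tau> \<ge> 1 \<longrightarrow> lam > 0 \<longrightarrow>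
     (\<exists>\<mu>0>0. \<forall>(\<Lambda>::real) (\<sigma>::nat \<Rightarrow> real). \<Lambda> \<ge> lam \<longrightarrow>
       (\<exists>M>0. \<forall>(J::int ^ 'd \<Rightarrow> int ^ 'd \<Rightarrow> real) (h::int ^ 'd \<Rightarrow> real) (\<mu>::real).
          J_conds lam \<Lambda> \<tau> J \<longrightarrow> sigma J = \<sigma> \<longrightarrow> 0 < \<mu> \<longrightarrow> \<mu> \<le> \<mu>0 \<longrightarrow> h_conds \<mu> \<tau> h \<longrightarrow>
          (\<forall>w::real ^ 'd. w \<noteq> 0 \<longrightarrow> (\<exists>u. ground_state J h u \<and> planelike M w u)))))
   \<and>
   (\<forall>(lam::real) (\<Lambda>::real) (s::real). lam > 0 \<longrightarrow> \<Lambda> \<ge> lam \<longrightarrow> 0 < s \<longrightarrow> s < 1 \<longrightarrow>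
     (\<exists>M0>0. \<forall>(\<tau>::nat) (J::int ^ 'd \<Rightarrow> int ^ 'd \<Rightarrow> real). \<tau> \<ge> 1 \<longrightarrow>
        J_conds lam \<Lambda> \<tau> J \<longrightarrow> JP s lam \<Lambda> J \<longrightarrow>
        (\<forall>w::real ^ 'd. w \<noteq> 0 \<longrightarrow>
           (\<exists>u. ground_state J (\<lambda>_. 0) u \<and> planelike (M0 * real \<tau>) w u))))"
proof (intro conjI allI impI)
  fix \<tau> :: nat and lam :: real assume *: "\<tau> \<ge> 1" "lam > 0"
  show "\<exists>\<mu>0>0. \<forall>(\<Lambda>::real) (\<sigma>::nat \<Rightarrow> real). \<Lambda> \<ge> lam \<longrightarrow>
       (\<exists>M>0. \<forall>(J::int ^ 'd \<Rightarrow> int ^ 'd \<Rightarrow> real) (h::int ^ 'd \<Rightarrow> real) (\<mu>::real).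
          J_conds lam \<Lambda> \<tau> J \<longrightarrow> sigma J = \<sigma> \<longrightarrow> 0 < \<mu> \<longrightarrow> \<mu> \<le> \<mu>0 \<longrightarrow> h_conds \<mu> \<tau> h \<longrightarrow>
          (\<forall>w::real ^ 'd. w \<noteq> 0 \<longrightarrow> (\<exists>u. ground_state J h u \<and> planelike M w u)))"
    \<comment> \<open>The threshold contains only \<open>lam\<close>, \<open>\<tau>\<close> and the
      dimension, so it can be fixed before \<open>\<Lambda>\<close> and
      \<open>\<sigma>\<close>.\<close>
    by (rule exI[of _ "lam * (2 / (15 * real \<tau>)) ^ CARD('d)"], intro conjI)
      (use * in simp, intro allI impI, rule ground_states_short_range[OF *])
qed (rule ground_states_power_law)

end
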